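(* Let $(I\times\Omega,\mathcal{V},\mathcal{Q})$ be the Fubini extension probability space with marginals $(I,\mathcal{I},\lambda)$ and $(\Omega,\mathcal{F},\mathbb{Q})$, and fix $T>0$. Let $\mathbf{B}=\{B^u:u\in I\}$ be an e.p.i. collection of Brownian motions on it, and let $(\Theta_t)_{t\in[0,T]}=\{(\theta_{t,u})_{t\in[0,T]}:u\in I\}$ be a real-valued process on $(I\times\Omega,\mathcal{V},\mathcal{Q})$, with $\Theta_t(u,\omega)=\theta_{t,u}(\omega)$, such that for all $(t,u)\in[0,T]\times I$ the random variable $\theta_{t,u}$ is $\sigma(B^u_s; s\le t)$-measurable. Define the process $(\mathcal{E}_t)_{t\in[0,T]}=\{(\mathcal{E}_{t,u})_{t\in[0,T]}:u\in I\}$ by $$\mathcal{E}_t:=\exp\Big\{\int_0^t\Theta_s\,d\mathbf{B}_s-\frac12\int_0^t\Theta_s^2\,ds\Big\}.$$ Suppose that for all $u\in I$ the process $(\mathcal{E}_{t,u})_{t\in[0,T]}$ is a $\mathbb{Q}$-martingale. Let $\mathcal{P}$ be the probability measure on $(I\times\Omega,\mathcal{V})$ defined by $\frac{d\mathcal{P}}{d\mathcal{Q}}=\mathcal{E}_T$. Then the process $\mathbf{W}=\{W^u:u\in I\}$ given by $$\mathbf{W}_t:=\mathbf{B}_t-\int_0^t\Theta_s\,ds,\qquad t\in[0,T],$$ is a standard Brownian motion on the probability space $(I\times\Omega,\mathcal{V},\mathcal{P})$.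
   Context: Let $I=[0,1]$. Fubini extension: given probability spaces $(I,\mathcal{I},\lambda)$ and $(\Omega,\mathcal{F},\mathbb{Q})$, a probability space $(I\times\Omega,\mathcal{V},\mathcal{Q})$ extending the product space $(I\times\Omega,\mathcal{I}\otimes\mathcal{F},\lambda\otimes\mathbb{Q})$ (i.e. $\mathcal{I}\otimes\mathcal{F}\subset\mathcal{V}$ and $\mathcal{Q}=\lambda\otimes\mathbb{Q}$ on $\mathcal{I}\otimes\mathcal{F}$) is a Fubini extension if for every $\mathcal{Q}$-integrable real-valued $\mathcal{V}$-measurable $g$: (i) $\omega\mapsto g(u,\omega)$ is integrable on $(\Omega,\mathcal{F},\mathbb{Q})$ for $\lambda$-a.e. $u$, and $u\mapsto g(u,\omega)$ is integrable on $(I,\mathcal{I},\lambda)$ for $\mathbb{Q}$-a.e. $\omega$; (ii) $u\mapsto\int_\Omega g(u,\omega)\,\mathbb{Q}(d\omega)$ and $\omega\mapsto\int_I g(u,\omega)\,\lambda(du)$ are integrable on $(I,\mathcal{I},\lambda)$ and $(\Omega,\mathcal{F},\mathbb{Q})$ respectively, and $$\int_{I\times\Omega} g\,d\mathcal{Q}=\int_I\Big(\int_\Omega g(u,\omega)\,\mathbb{Q}(d\omega)\Big)\lambda(du)=\int_\Omega\Big(\int_I g(u,\omega)\,\lambda(du)\Big)\mathbb{Q}(d\omega).$$ Throughout, $(I,\mathcal{I},\lambda)$ is an extension of the Lebesgue probability space on $[0,1]$, and $(I,\mathcal{I},\lambda)$, $(\Omega,\mathcal{F},\mathbb{Q})$,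 $(I\times\Omega,\mathcal{V},\mathcal{Q})$ are chosen (as is possible by a theorem of Sun and Zhang) so that for every measurable map $\varphi$ from $I$ to the Borel probability measures on the state space $E$ there is a $\mathcal{V}$-measurable $\Theta:I\times\Omega\to E$ with $\{\Theta(u,\cdot)\}_{u\in I}$ e.p.i. and $\Theta(u,\cdot)$ of law $\varphi(u)$ under $\mathbb{Q}$ for all $u\in I$. Essential pairwise independence (e.p.i.): a family $\{\Theta(u,\cdot):u\in I\}$ of random variables (or processes, regarded as path-valued random variables) on $(\Omega,\mathcal{F},\mathbb{Q})$ is e.p.i. if for $\lambda$-a.e. $u\in I$, $\Theta(u,\cdot)$ and $\Theta(v,\cdot)$ are independent for $\lambda$-a.e. $v\in I$. Standard Brownian motion on a probability space $(I\times\Omega,\mathcal{V},\mathcal{R})$: a real-valued process $(\mathbf{B}_t)$ such that (1) $\mathbf{B}_0=0$ $\mathcal{R}$-a.s.; (2) for $0\le s<t$, $\mathbf{B}_t-\mathbf{B}_s\sim\mathcal{N}(0,t-s)$ under $\mathcal{R}$; (3) for $0\le t_0<\dots<t_n$ the increments $\mathbf{B}_{t_k}-\mathbf{B}_{t_{k-1}}$ are independent under $\mathcal{R}$; (4) $t\mapsto\mathbf{B}_t(u,\omega)$ is continuous for $\mathcal{R}$-a.e. $(u,\omega)$. (Times are restricted to $[0,T]$ when the process is indexed by $[0,T]$.) Standard Brownian motion on $(\Omega,\mathcal{F},\mathbb{Q})$ is defined in the same way. E.p.i. collection of Brownian motions: a collection $\{(B^u_t)_{t\ge0}:u\in I\}$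 on $(I\times\Omega,\mathcal{V},\mathcal{Q})$ such that (1) $(u,\omega)\mapsto B^u_t(\omega)$ is jointly ($\mathcal{V}$-)measurable for all $t$; (2) the collection is e.p.i. and, for every $u\in I$, $(B^u_t)_{t\ge0}$ is a standard Brownian motion on $(\Omega,\mathcal{F},\mathbb{Q})$. Conventions: a family indexed by $u\in I$ is identified with a single process on $I\times\Omega$: $\mathbf{B}_t(u,\omega)=B^u_t(\omega)$, $\mathcal{E}_t(u,\omega)=\mathcal{E}_{t,u}(\omega)$, $\mathbf{W}_t(u,\omega)=W^u_t(\omega)$. The defining formulas are read index by index, i.e. $\mathcal{E}_{t,u}=\exp\{\int_0^t\theta_{s,u}\,dB^u_s-\frac12\int_0^t\theta_{s,u}^2\,ds\}$ and $W^u_t=B^u_t-\int_0^t\theta_{s,u}\,ds$. As usual, $\Theta$ is understood to be such that these integrals are well defined and the resulting processes $\mathcal{E}$ and $\mathbf{W}$ are processes on $(I\times\Omega,\mathcal{V})$, i.e. $\mathcal{V}$-measurable at each time.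
   Formalization: The formal theorem additionally assumes that the set of (u,ω) for which t ↦ B_t(u,ω) is continuous on [0,T] is 𝒱-measurable up to a null set; without this the a.e. path continuity of W can fail, even for Θ = 0. *)

theory Defs
  imports "HOL-Probability.Probability"
begin

section \<open>Extensions of measure spaces and essential pairwise independence\<close>

definition measure_extension :: "'a measure \<Rightarrow> 'a measure \<Rightarrow> bool" where
  "measure_extension M N \<longleftrightarrow>
     space N = space M \<and> sets M \<subseteq> sets N \<and> (\<forall>A\<in>sets M. emeasure N A = emeasure M A)"

definition fubini_extension :: "'i measure \<Rightarrow> 'w measure \<Rightarrow> ('i \<times> 'w) measure \<Rightarrow> bool" where
  "fubini_extension L M V \<longleftrightarrow>
     prob_space L \<and> prob_space M \<and> prob_space V \<and> measure_extension (L \<Otimes>\<^sub>M M) V \<and>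
     (\<forall>g :: 'i \<times> 'w \<Rightarrow> real. integrable V g \<longrightarrow>
        (AE u in L. integrable M (\<lambda>\<omega>. g (u, \<omega>))) \<and>
        (AE \<omega> in M. integrable L (\<lambda>u. g (u, \<omega>))) \<and>
        integrable L (\<lambda>u. \<integral>\<omega>. g (u, \<omega>) \<partial>M) \<and>
        integrable M (\<lambda>\<omega>. \<integral>u. g (u, \<omega>) \<partial>L) \<and>
        (\<integral>x. g x \<partial>V) = (\<integral>u. (\<integral>\<omega>. g (u, \<omega>) \<partial>M) \<partial>L) \<and>
        (\<integral>x. g x \<partial>V) = (\<integral>\<omega>. (\<integral>u. g (u, \<omega>) \<partial>L) \<partial>M))"

definition epi :: "'i measure \<Rightarrow> 'w measure \<Rightarrow> 'e measure \<Rightarrow> ('i \<Rightarrow> 'w \<Rightarrow> 'e) \<Rightarrow> bool" where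
  "epi L M N X \<longleftrightarrow> (AE u in L. AE v in L. prob_space.indep_var M N (X u) N (X v))"

text \<open>The state space is a Polish space, given by the type argument. The Borel probability
  measures on it carry the \<open>\<sigma>\<close>-algebra generated by the evaluations, which for a Polish space is
  the Borel \<open>\<sigma>\<close>-algebra of the weak topology.\<close>

definition rich_fubini_extension ::
  "'e::polish_space itself \<Rightarrow> 'i measure \<Rightarrow> 'w measure \<Rightarrow> ('i \<times> 'w) measure \<Rightarrow> bool" where
  "rich_fubini_extension E L M V \<longleftrightarrow>
     fubini_extension L M V \<and>
     (\<forall>\<phi> \<in> L \<rightarrow>\<^sub>M prob_algebra (borel :: 'e measure).
        \<exists>X :: 'i \<times> 'w \<Rightarrow> 'e. X \<in> borel_measurable V \<and> epi L M borel (\<lambda>u \<omega>. X (u, \<omega>)) \<and>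
          (\<forall>u\<in>space L. (\<lambda>\<omega>. X (u, \<omega>)) \<in> borel_measurable M \<and>
                        distr M borel (\<lambda>\<omega>. X (u, \<omega>)) = \<phi> u))"


section \<open>Brownian motion\<close>

text \<open>The set \<open>S\<close> is the time set, \<open>[0, \<infinity>)\<close> or \<open>[0, T]\<close>. That the underlying measure is
  a probability measure is part of the definition.\<close>

definition standard_brownian_motion ::
  "'a measure \<Rightarrow> real set \<Rightarrow> (real \<Rightarrow> 'a \<Rightarrow> real) \<Rightarrow> bool" where
  "standard_brownian_motion M S B \<longleftrightarrow>
     prob_space M \<and>
     (\<forall>t\<in>S. B t \<in> borel_measurable M) \<and>
     (AE x in M. B 0 x = 0) \<and>
     (\<forall>s\<in>S. \<forall>t\<in>S. s < t \<longrightarrow>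
        distributed M lborel (\<lambda>x. B t x - B s x) (\<lambda>y. ennreal (normal_density 0 (sqrt (t - s)) y))) \<and>
     (\<forall>n (\<tau> :: nat \<Rightarrow> real). \<tau> ` {..n} \<subseteq> S \<and> strict_mono_on {..n} \<tau> \<longrightarrow>
        prob_space.indep_vars M (\<lambda>_. borel) (\<lambda>k x. B (\<tau> (Suc k)) x - B (\<tau> k) x) {..<n}) \<and>
     (AE x in M. continuous_on S (\<lambda>t. B t x))"

definition epi_brownian_motions ::
  "'i measure \<Rightarrow> 'w measure \<Rightarrow> ('i \<times> 'w) measure \<Rightarrow> (real \<Rightarrow> 'i \<times> 'w \<Rightarrow> real) \<Rightarrow> bool" where
  "epi_brownian_motions L M V B \<longleftrightarrow>
     (\<forall>t\<in>{0..}. B t \<in> borel_measurable V) \<and>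
     epi L M (\<Pi>\<^sub>M t\<in>{0..}. borel) (\<lambda>u \<omega>. \<lambda>t\<in>{0..}. B t (u, \<omega>)) \<and>
     (\<forall>u\<in>space L. standard_brownian_motion M {0..} (\<lambda>t \<omega>. B t (u, \<omega>)))"


section \<open>Filtrations and martingales\<close>

definition natural_filtration :: "'w measure \<Rightarrow> (real \<Rightarrow> 'w \<Rightarrow> real) \<Rightarrow> real \<Rightarrow> 'w measure" where
  "natural_filtration M B t =
     sigma (space M) (\<Union>s\<in>{0..t}. {B s -` A \<inter> space M | A. A \<in> sets borel})"

text \<open>Stochastic integrals are determined only up to null sets, so they are adapted to the
  following filtration but in general not to the natural one.\<close>

definition augmented_filtration :: "'w measure \<Rightarrow> (real \<Rightarrow> 'w \<Rightarrow> real) \<Rightarrow> real \<Rightarrow> 'w measure" where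
  "augmented_filtration M B t =
     sigma (space M) (sets (natural_filtration M B t) \<union> null_sets M)"

definition martingale_on ::
  "'w measure \<Rightarrow> real \<Rightarrow> (real \<Rightarrow> 'w measure) \<Rightarrow> (real \<Rightarrow> 'w \<Rightarrow> real) \<Rightarrow> bool" where
  "martingale_on M T F X \<longleftrightarrow>
     (\<forall>t\<in>{0..T}. X t \<in> borel_measurable (F t) \<and> integrable M (X t)) \<and>
     (\<forall>s t. 0 \<le> s \<and> s \<le> t \<and> t \<le> T \<longrightarrow>
        (AE \<omega> in M. real_cond_exp M (F s) (X t) \<omega> = X s \<omega>))"


section \<open>The Ito integral\<close>

definition tendsto_in_prob ::
  "'w measure \<Rightarrow> (nat \<Rightarrow> 'w \<Rightarrow> real) \<Rightarrow> ('w \<Rightarrow> real) \<Rightarrow> bool" where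
  "tendsto_in_prob M X Y \<longleftrightarrow>
     (\<forall>\<epsilon>>0. (\<lambda>k. measure M {\<omega>\<in>space M. \<bar>X k \<omega> - Y \<omega>\<bar> > \<epsilon>}) \<longlonglongrightarrow> 0)"

definition simple_integrand ::
  "(real \<Rightarrow> 'w measure) \<Rightarrow> real \<Rightarrow> nat \<Rightarrow> (nat \<Rightarrow> real) \<Rightarrow> (nat \<Rightarrow> 'w \<Rightarrow> real) \<Rightarrow> bool" where
  "simple_integrand F T n \<tau> \<xi> \<longleftrightarrow>
     \<tau> ` {..n} \<subseteq> {0..T} \<and> strict_mono_on {..n} \<tau> \<and>
     (\<forall>i<n. \<xi> i \<in> borel_measurable (F (\<tau> i)) \<and> (\<exists>c. \<forall>\<omega>\<in>space (F (\<tau> i)). \<bar>\<xi> i \<omega>\<bar> \<le> c))"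

definition simple_value ::
  "nat \<Rightarrow> (nat \<Rightarrow> real) \<Rightarrow> (nat \<Rightarrow> 'w \<Rightarrow> real) \<Rightarrow> real \<Rightarrow> 'w \<Rightarrow> real" where
  "simple_value n \<tau> \<xi> t \<omega> = (\<Sum>i<n. \<xi> i \<omega> * indicator {\<tau> i<..\<tau> (Suc i)} t)"

definition simple_integral ::
  "nat \<Rightarrow> (nat \<Rightarrow> real) \<Rightarrow> (nat \<Rightarrow> 'w \<Rightarrow> real) \<Rightarrow> (real \<Rightarrow> 'w \<Rightarrow> real) \<Rightarrow> real \<Rightarrow> 'w \<Rightarrow> real" where
  "simple_integral n \<tau> \<xi> B t \<omega> =
     (\<Sum>i<n. \<xi> i \<omega> * (B (min t (\<tau> (Suc i))) \<omega> - B (min t (\<tau> i)) \<omega>))"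

text \<open>The integrands: measurable adapted processes with almost surely square integrable paths.\<close>

definition ito_integrand ::
  "'w measure \<Rightarrow> real \<Rightarrow> (real \<Rightarrow> 'w measure) \<Rightarrow> (real \<Rightarrow> 'w \<Rightarrow> real) \<Rightarrow> bool" where
  "ito_integrand M T F \<theta> \<longleftrightarrow>
     (\<lambda>(t, \<omega>). \<theta> t \<omega>) \<in> borel_measurable (restrict_space borel {0..T} \<Otimes>\<^sub>M M) \<and>
     (\<forall>t\<in>{0..T}. \<theta> t \<in> borel_measurable (F t)) \<and>
     (AE \<omega> in M. (\<integral>\<^sup>+s\<in>{0..T}. ennreal ((\<theta> s \<omega>)\<^sup>2) \<partial>lborel) < \<infinity>)"

text \<open>\<open>is_ito_integral M T B \<theta> J\<close>: the process \<open>J\<close> is a version of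
  \<open>(\<integral>\<^sub>0\<^sup>t \<theta>\<^sub>s dB\<^sub>s)\<close> for \<open>t \<in> [0, T]\<close>. For a Brownian motion \<open>B\<close> the limits in
  probability of the integrals of the approximating simple processes exist and do not depend on
  the approximation, and \<open>J\<close> is a process with almost surely continuous paths consisting of
  these limits; hence \<open>J\<close> is unique up to indistinguishability.\<close>

definition is_ito_integral ::
  "'w measure \<Rightarrow> real \<Rightarrow> (real \<Rightarrow> 'w \<Rightarrow> real) \<Rightarrow> (real \<Rightarrow> 'w \<Rightarrow> real) \<Rightarrow> (real \<Rightarrow> 'w \<Rightarrow> real) \<Rightarrow> bool"
  where
  "is_ito_integral M T B \<theta> J \<longleftrightarrow>
     ito_integrand M T (augmented_filtration M B) \<theta> \<and>
     (\<forall>t\<in>{0..T}. J t \<in> borel_measurable M) \<and>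
     (AE \<omega> in M. continuous_on {0..T} (\<lambda>t. J t \<omega>)) \<and>
     (\<exists>n \<tau> \<xi>.
        (\<forall>k. simple_integrand (augmented_filtration M B) T (n k) (\<tau> k) (\<xi> k)) \<and>
        tendsto_in_prob M
          (\<lambda>k \<omega>. LBINT s:{0..T}. (simple_value (n k) (\<tau> k) (\<xi> k) s \<omega> - \<theta> s \<omega>)\<^sup>2) (\<lambda>_. 0) \<and>
        (\<forall>t\<in>{0..T}. tendsto_in_prob M (\<lambda>k. simple_integral (n k) (\<tau> k) (\<xi> k) B t) (J t)))"

end

theory Submission
  imports Defs
begin

text \<open>Fix an index \<open>u\<close>. For a simple integrand \<open>\<xi>\<close> and a deterministic step function \<open>f\<close> the complex
  exponential \<open>Z = exp (\<integral>(\<xi> + i f) dB - 1/2 \<integral>(\<xi> + i f)\<^sup>2 ds)\<close> has expectation \<open>1\<close>: each increment of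
  \<open>B\<close> is Gaussian and independent of the past. Its modulus is \<open>exp (1/2 \<integral>f\<^sup>2 ds)\<close> times the real
  exponential of \<open>\<xi>\<close>, which is positive with expectation \<open>1\<close>. If the simple integrands approximate
  \<open>\<theta>\<close>, the real exponentials converge almost surely along a subsequence to \<open>\<E>\<^sub>T\<close>, which also has
  expectation \<open>1\<close>, hence in \<open>L\<^sup>1\<close> by Scheffe's lemma. Thus \<open>Z\<close> has expectation \<open>1\<close> in the limit, and
  this says that under the measure with density \<open>\<E>\<^sub>T\<close> the increments of \<open>W\<^sup>u\<close> have the joint characteristic
  function of independent centred Gaussians. It does not depend on \<open>u\<close>, so the Fubini property
  gives the same characteristic function under \<open>P\<close>, and it determines the joint law.

  The indefinite integral of \<open>\<Theta>\<close> need not have measurable path properties, so path continuity of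
  \<open>W\<close> is obtained from its uniform continuity on the rationals, an event in \<open>V\<close>.\<close>

section \<open>Independence from joint characteristic functions\<close>

text \<open>The choice of \<open>Z\<close> rests on a factorization. With \<theta> in place of the
  simple integrand, \<open>Z\<close> is the real exponential times
  \<open>exp (1/2 \<integral>f^2 ds)\<close> times the unimodular factor
  \<open>exp (i (\<integral>f dB - \<integral>f \<theta> ds))\<close>. The cross term of the square
  is exactly the drift that turns increments of \<open>B\<close>, weighted by the values of
  \<open>f\<close>, into increments of \<open>W\<close>, so the mean of \<open>Z\<close> becomes a
  characteristic function. The imaginary part is deterministic so that the prefactor is a constant.
  The martingale hypothesis supplies the mean \<open>1\<close> of the limit: almost sure limits of
  nonnegative variables of mean \<open>1\<close> may lose mass, and then there is no convergence in
  mean. That the law of the increments is the same for every index is essential: a mixture over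
  \<open>u\<close> of laws with independent increments has in general dependent increments, so
  independence for each index separately would not carry over to \<open>P\<close>.\<close>

lemma (in prob_space) expectation_weight_indicator_eq:
  fixes w X :: "'a \<Rightarrow> real"
  assumes w: "integrable M w" "\<And>\<omega>. \<omega> \<in> space M \<Longrightarrow> 0 \<le> w \<omega>"
    and X[measurable]: "random_variable borel X"
    and factor: "\<And>t. (\<integral>\<omega>. w \<omega> * iexp (t * X \<omega>) \<partial>M) = expectation w * (\<integral>\<omega>. iexp (t * X \<omega>) \<partial>M)"
    and A[measurable]: "A \<in> sets borel"
  shows "expectation (\<lambda>\<omega>. w \<omega> * indicator A (X \<omega>)) = expectation w * prob (X -` A \<inter> space M)"
proof (cases "expectation w = 0")
  case True
  have "AE \<omega> in M. w \<omega> = 0"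
    using integral_nonneg_eq_0_iff_AE[OF w(1)] True w(2) by auto
  then have "expectation (\<lambda>\<omega>. w \<omega> * indicator A (X \<omega>)) = expectation (\<lambda>_. 0)"
    using borel_measurable_integrable[OF w(1)] by (intro integral_cong_AE) auto
  with True show ?thesis by simp
next
  case False
  define m where "m = expectation w"
  have m: "m > 0"
    using False w(2) by (simp add: m_def order_less_le integral_nonneg)
  have [measurable]: "w \<in> borel_measurable M"
    using w(1) by auto
  \<comment> \<open>The factorization says that \<open>X\<close> has the same characteristic
    function under the normalized weighted measure \<open>N\<close> as under \<open>M\<close>, so
    Levy uniqueness identifies the two laws. Mean zero was split off because \<open>N\<close>
    divides by \<open>m\<close>.\<close>
  define N where "N = density M (\<lambda>\<omega>. ennreal (w \<omega> / m))"
  have AEw: "AE \<omega> in M. 0 \<le> w \<omega> / m"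
    using w(2) m by auto
  have "emeasure N (space N) = (\<integral>\<^sup>+\<omega>. ennreal (w \<omega> / m) \<partial>M)"
    unfolding N_def by (simp add: emeasure_density cong: nn_integral_cong)
  also have "\<dots> = ennreal (\<integral>\<omega>. w \<omega> / m \<partial>M)"
    using w(1) AEw by (intro nn_integral_eq_integral) auto
  also have "\<dots> = 1"
    using m by (simp add: m_def)
  finally interpret N: prob_space N
    by (intro prob_spaceI)
  have [measurable]: "X \<in> borel_measurable N"
    by (simp add: N_def)
  have distr: "real_distribution (distr N borel X)" "real_distribution (distr M borel X)"
    by simp_all
  have "char (distr N borel X) t = char (distr M borel X) t" for t
  proof -
    have "char (distr N borel X) t = (\<integral>\<omega>. iexp (t * X \<omega>) \<partial>N)"
      unfolding char_def by (subst integral_distr) auto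
    also have "\<dots> = (\<integral>\<omega>. (w \<omega> / m) *\<^sub>R iexp (t * X \<omega>) \<partial>M)"
      unfolding N_def using AEw by (intro integral_density) auto
    also have "\<dots> = (\<integral>\<omega>. (w \<omega> * iexp (t * X \<omega>)) / m \<partial>M)"
      by (intro Bochner_Integration.integral_cong) (auto simp: scaleR_conv_of_real)
    also have "\<dots> = (\<integral>\<omega>. iexp (t * X \<omega>) \<partial>M)"
      using factor[of t] m by (simp add: m_def)
    also have "\<dots> = char (distr M borel X) t"
      unfolding char_def by (subst integral_distr) auto
    finally show ?thesis .
  qed
  then have "distr N borel X = distr M borel X"
    by (intro Levy_uniqueness distr) auto
  then have "measure (distr N borel X) A = measure (distr M borel X) A"
    by simp
  then have "N.prob (X -` A \<inter> space M) = prob (X -` A \<inter> space M)"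
    by (simp add: measure_distr) (simp add: N_def)
  moreover have "N.prob (X -` A \<inter> space M) = (\<integral>\<omega>. indicator (X -` A) \<omega> \<partial>N)"
    by (simp add: N_def)
  moreover have "\<dots> = (\<integral>\<omega>. (w \<omega> / m) *\<^sub>R indicator A (X \<omega>) \<partial>M)"
    unfolding N_def indicator_vimage comp_def using AEw by (intro integral_density) auto
  moreover have "\<dots> = (\<integral>\<omega>. (w \<omega> * indicator A (X \<omega>)) / m \<partial>M)"
    by (intro Bochner_Integration.integral_cong) auto
  ultimately show ?thesis
    using m by (simp add: m_def field_simps)
qed

text \<open>Comparing laws requires nonnegative weights. Conjugation separates the real and the
  imaginary part of the weight, and adding the bound \<open>c\<close> makes each of them
  nonnegative. Constants satisfy the factorization trivially, so the shift can be subtracted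
  again.\<close>

lemma (in prob_space) complex_expectation_weight_indicator_eq:
  fixes W :: "'a \<Rightarrow> complex" and X :: "'a \<Rightarrow> real"
  assumes W: "W \<in> borel_measurable M" "\<And>\<omega>. \<omega> \<in> space M \<Longrightarrow> norm (W \<omega>) \<le> c"
    and X[measurable]: "random_variable borel X"
    and factor: "\<And>t. (\<integral>\<omega>. W \<omega> * iexp (t * X \<omega>) \<partial>M) = (\<integral>\<omega>. W \<omega> \<partial>M) * (\<integral>\<omega>. iexp (t * X \<omega>) \<partial>M)"
    and A[measurable]: "A \<in> sets borel"
  shows "(\<integral>\<omega>. W \<omega> * indicator A (X \<omega>) \<partial>M) = (\<integral>\<omega>. W \<omega> \<partial>M) * prob (X -` A \<inter> space M)"
proof -
  note [measurable] = W(1)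
  define e where "e t \<omega> = iexp (t * X \<omega>)" for t \<omega>
  have [measurable]: "e t \<in> borel_measurable M" for t
    unfolding e_def by measurable
  have norm_e: "norm (e t \<omega>) = 1" for t \<omega>
    by (simp add: e_def)
  have cnj_e: "cnj (e t \<omega>) = e (- t) \<omega>" for t \<omega>
    by (simp add: e_def exp_cnj)
  have fac: "(\<integral>\<omega>. W \<omega> * e t \<omega> \<partial>M) = (\<integral>\<omega>. W \<omega> \<partial>M) * (\<integral>\<omega>. e t \<omega> \<partial>M)" for t
    unfolding e_def by (rule factor)
  have bdd: "integrable M f" if "f \<in> borel_measurable M" "\<And>\<omega>. \<omega> \<in> space M \<Longrightarrow> norm (f \<omega>) \<le> b"
    for f :: "'a \<Rightarrow> 'b::{banach, second_countable_topology}" and b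
    using that by (intro integrable_const_bound[where B = b]) auto
  have iW: "integrable M W" and iWX: "integrable M (\<lambda>\<omega>. W \<omega> * e t \<omega>)"
    and iWA: "integrable M (\<lambda>\<omega>. W \<omega> * indicator A (X \<omega>))" for t
    by (rule bdd[of _ c]; use W(2) in \<open>auto simp: norm_mult norm_e indicator_def intro: order_trans[OF norm_ge_zero]\<close>)+
  have iX: "integrable M (e t)" for t
    by (rule bdd[of _ 1]) (auto simp: norm_e)
  have icnj: "integrable M (\<lambda>\<omega>. cnj (W \<omega>) * e t \<omega>)" for t
    using integrable_cnj[OF iWX[of "- t"]] by (simp add: cnj_e)
  \<comment> \<open>Replacing \<open>t\<close> by \<open>- t\<close> and conjugating gives the factorization for the conjugate weight.\<close>
  have cnj: "(\<integral>\<omega>. cnj (W \<omega>) * e t \<omega> \<partial>M) = cnj (\<integral>\<omega>. W \<omega> \<partial>M) * (\<integral>\<omega>. e t \<omega> \<partial>M)" for t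
  proof -
    have "(\<integral>\<omega>. cnj (W \<omega>) * e t \<omega> \<partial>M) = (\<integral>\<omega>. cnj (W \<omega> * e (- t) \<omega>) \<partial>M)"
      by (simp add: cnj_e del: Bochner_Integration.integral_cnj)
    also have "\<dots> = cnj (\<integral>\<omega>. W \<omega> \<partial>M) * cnj (\<integral>\<omega>. e (- t) \<omega> \<partial>M)"
      by (subst Bochner_Integration.integral_cnj) (simp only: fac complex_cnj_mult)
    finally show ?thesis by (simp only: Bochner_Integration.integral_cnj[symmetric] cnj_e minus_minus)
  qed
  let ?p = "prob (X -` A \<inter> space M)"
  have pA: "expectation (\<lambda>\<omega>. indicator A (X \<omega>)) = ?p"
    unfolding Bochner_Integration.integral_indicator[of M "X -` A", symmetric]
    by (intro Bochner_Integration.integral_cong) (auto simp: indicator_def)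
  have iA: "integrable M (\<lambda>\<omega>. indicator A (X \<omega>) :: real)"
    by (rule bdd[of _ 1]) auto
  have shifted: "expectation (\<lambda>\<omega>. v \<omega> * indicator A (X \<omega>)) = expectation v * ?p"
    if v[measurable]: "v \<in> borel_measurable M" and vc: "\<And>\<omega>. \<omega> \<in> space M \<Longrightarrow> \<bar>v \<omega>\<bar> \<le> c"
      and vf: "\<And>t. (\<integral>\<omega>. v \<omega> * e t \<omega> \<partial>M) = expectation v * (\<integral>\<omega>. e t \<omega> \<partial>M)"
    for v :: "'a \<Rightarrow> real"
  proof -
    have iv: "integrable M v" and ivX: "integrable M (\<lambda>\<omega>. v \<omega> * e t \<omega>)"
      and ivA: "integrable M (\<lambda>\<omega>. v \<omega> * indicator A (X \<omega>))" for t
      by (rule bdd[of _ c]; use vc in \<open>auto simp: norm_mult norm_e abs_mult indicator_def intro: order_trans[OF abs_ge_zero]\<close>)+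
    have "expectation (\<lambda>\<omega>. (v \<omega> + c) * indicator A (X \<omega>)) = expectation (\<lambda>\<omega>. v \<omega> + c) * ?p"
    proof (rule expectation_weight_indicator_eq)
      fix t
      have "(\<integral>\<omega>. complex_of_real (v \<omega> + c) * e t \<omega> \<partial>M) = (\<integral>\<omega>. v \<omega> * e t \<omega> + c * e t \<omega> \<partial>M)"
        by (simp add: algebra_simps)
      also have "\<dots> = (expectation v + c) * (\<integral>\<omega>. e t \<omega> \<partial>M)"
        using ivX iX by (simp add: vf algebra_simps)
      also have "expectation v + c = expectation (\<lambda>\<omega>. v \<omega> + c)"
        using iv by (simp add: prob_space)
      finally show "(\<integral>\<omega>. complex_of_real (v \<omega> + c) * iexp (t * X \<omega>) \<partial>M)
          = expectation (\<lambda>\<omega>. v \<omega> + c) * (\<integral>\<omega>. iexp (t * X \<omega>) \<partial>M)"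
        using iv by (simp add: e_def prob_space)
    qed (use iv vc in \<open>force+\<close>)
    moreover have "expectation (\<lambda>\<omega>. (v \<omega> + c) * indicator A (X \<omega>)) =
      expectation (\<lambda>\<omega>. v \<omega> * indicator A (X \<omega>)) + c * ?p"
      using ivA iA by (simp add: distrib_right pA)
    moreover have "expectation (\<lambda>\<omega>. v \<omega> + c) = expectation v + c"
      using iv by (simp add: prob_space)
    ultimately show ?thesis by (simp add: algebra_simps)
  qed
  have Re: "expectation (\<lambda>\<omega>. Re (W \<omega>) * indicator A (X \<omega>)) = expectation (\<lambda>\<omega>. Re (W \<omega>)) * ?p"
  proof (rule shifted)
    fix t
    have "(\<integral>\<omega>. complex_of_real (Re (W \<omega>)) * e t \<omega> \<partial>M)
        = (\<integral>\<omega>. (W \<omega> * e t \<omega> + cnj (W \<omega>) * e t \<omega>) / 2 \<partial>M)"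
      by (intro Bochner_Integration.integral_cong refl)
         (simp add: complex_add_cnj flip: distrib_right)
    also have "\<dots> = ((\<integral>\<omega>. W \<omega> \<partial>M) + cnj (\<integral>\<omega>. W \<omega> \<partial>M)) / 2 * (\<integral>\<omega>. e t \<omega> \<partial>M)"
      using iWX icnj by (simp add: fac cnj algebra_simps add_divide_distrib)
    also have "\<dots> = expectation (\<lambda>\<omega>. Re (W \<omega>)) * (\<integral>\<omega>. e t \<omega> \<partial>M)"
      using iW by (simp add: complex_add_cnj)
    finally show "(\<integral>\<omega>. complex_of_real (Re (W \<omega>)) * e t \<omega> \<partial>M)
        = expectation (\<lambda>\<omega>. Re (W \<omega>)) * (\<integral>\<omega>. e t \<omega> \<partial>M)" .
  next
    show "\<bar>Re (W \<omega>)\<bar> \<le> c" if "\<omega> \<in> space M" for \<omega>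
      using abs_Re_le_cmod[of "W \<omega>"] W(2)[OF that] by linarith
  qed simp
  have Im: "expectation (\<lambda>\<omega>. Im (W \<omega>) * indicator A (X \<omega>)) = expectation (\<lambda>\<omega>. Im (W \<omega>)) * ?p"
  proof (rule shifted)
    fix t
    have Im_eq: "complex_of_real (Im z) = (z - cnj z) / (2 * \<i>)" for z
      by (simp add: complex_diff_cnj field_simps)
    have "(\<integral>\<omega>. complex_of_real (Im (W \<omega>)) * e t \<omega> \<partial>M)
        = (\<integral>\<omega>. (W \<omega> * e t \<omega> - cnj (W \<omega>) * e t \<omega>) / (2 * \<i>) \<partial>M)"
      unfolding Im_eq by (intro Bochner_Integration.integral_cong refl) (simp add: field_simps)
    also have "\<dots> = ((\<integral>\<omega>. W \<omega> \<partial>M) - cnj (\<integral>\<omega>. W \<omega> \<partial>M)) / (2 * \<i>) * (\<integral>\<omega>. e t \<omega> \<partial>M)"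
      using iWX icnj by (simp add: fac cnj algebra_simps diff_divide_distrib)
    also have "\<dots> = expectation (\<lambda>\<omega>. Im (W \<omega>)) * (\<integral>\<omega>. e t \<omega> \<partial>M)"
      unfolding Im_eq[symmetric] using iW by simp
    finally show "(\<integral>\<omega>. complex_of_real (Im (W \<omega>)) * e t \<omega> \<partial>M)
        = expectation (\<lambda>\<omega>. Im (W \<omega>)) * (\<integral>\<omega>. e t \<omega> \<partial>M)" .
  next
    show "\<bar>Im (W \<omega>)\<bar> \<le> c" if "\<omega> \<in> space M" for \<omega>
      using abs_Im_le_cmod[of "W \<omega>"] W(2)[OF that] by linarith
  qed simp
  have Re_ind: "Re (z * indicator A x) = Re z * indicator A x"
    and Im_ind: "Im (z * indicator A x) = Im z * indicator A x" for z and x :: real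
    by (simp_all add: indicator_def)
  have "Re (\<integral>\<omega>. W \<omega> * indicator A (X \<omega>) \<partial>M) = expectation (\<lambda>\<omega>. Re (W \<omega>) * indicator A (X \<omega>))"
    and "Im (\<integral>\<omega>. W \<omega> * indicator A (X \<omega>) \<partial>M) = expectation (\<lambda>\<omega>. Im (W \<omega>) * indicator A (X \<omega>))"
    by (simp_all only: integral_Re[OF iWA, symmetric] integral_Im[OF iWA, symmetric] Re_ind Im_ind)
  then show ?thesis
    using Re Im iW by (simp add: complex_eq_iff)
qed

text \<open>The exponentials are exchanged for indicators of arbitrary Borel sets one coordinate at
  a time. At each exchange the factors of all other coordinates form a bounded complex weight, to
  which the one-dimensional statement applies; after the last exchange the product formula for
  events remains.\<close>

lemma (in prob_space) indep_vars_if_char_prod: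
  fixes X :: "'i \<Rightarrow> 'a \<Rightarrow> real"
  assumes fin: "finite I"
    and X[measurable]: "\<And>k. k \<in> I \<Longrightarrow> random_variable borel (X k)"
    and char: "\<And>c. (\<integral>\<omega>. iexp (\<Sum>k\<in>I. c k * X k \<omega>) \<partial>M) = (\<Prod>k\<in>I. (\<integral>\<omega>. iexp (c k * X k \<omega>) \<partial>M))"
  shows "indep_vars (\<lambda>_. borel) X I"
proof (cases "I = {}")
  case True
  then show ?thesis by (auto simp: indep_vars_def indep_sets_def)
next
  case False
  \<comment> \<open>\<open>c\<close> stays free in the induction: the coordinate \<open>m\<close>
    being exchanged needs every frequency \<open>t\<close>, which is inserted as
    \<open>c(m := t)\<close>.\<close>
  have mixed: "(\<integral>\<omega>. (\<Prod>k\<in>S. indicator (A k) (X k \<omega>)) * iexp (\<Sum>k\<in>I - S. c k * X k \<omega>) \<partial>M)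
     = complex_of_real (\<Prod>k\<in>S. prob (X k -` A k \<inter> space M)) * (\<Prod>k\<in>I - S. (\<integral>\<omega>. iexp (c k * X k \<omega>) \<partial>M))"
    if S: "finite S" "S \<subseteq> I" "\<And>k. k \<in> I \<Longrightarrow> A k \<in> sets borel" for S A c
    using S
  proof (induction S arbitrary: c)
    case empty
    then show ?case using char[of c] by simp
  next
    case (insert m S)
    have S: "S \<subseteq> I" "m \<in> I" "m \<notin> S" "finite (I - insert m S)"
      using insert.prems(1) insert.hyps fin by auto
    then have IS: "I - S = insert m (I - insert m S)"
      by blast
    have [measurable]: "random_variable borel (X k)" "A k \<in> sets borel" if "k \<in> S" for k
      using that S X insert.prems by auto
    have [measurable]: "random_variable borel (X m)" "A m \<in> sets borel"
      using S X insert.prems by auto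
    have [measurable]: "random_variable borel (X k)" if "k \<in> I - insert m S" for k
      using that X by auto
    define W where "W \<omega> = (\<Prod>k\<in>S. indicator (A k) (X k \<omega>)) * iexp (\<Sum>k\<in>I - insert m S. c k * X k \<omega>)" for \<omega>
    define d where "d = complex_of_real (\<Prod>k\<in>S. prob (X k -` A k \<inter> space M)) *
      (\<Prod>k\<in>I - insert m S. (\<integral>\<omega>. iexp (c k * X k \<omega>) \<partial>M))"
    have [measurable]: "W \<in> borel_measurable M"
      unfolding W_def by measurable
    have char_m: "(\<integral>\<omega>. W \<omega> * iexp (t * X m \<omega>) \<partial>M) = d * (\<integral>\<omega>. iexp (t * X m \<omega>) \<partial>M)" for t
    proof -
      have "(\<integral>\<omega>. W \<omega> * iexp (t * X m \<omega>) \<partial>M) =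
        (\<integral>\<omega>. (\<Prod>k\<in>S. indicator (A k) (X k \<omega>)) * iexp (\<Sum>k\<in>I - S. (c(m := t)) k * X k \<omega>) \<partial>M)"
      proof (intro Bochner_Integration.integral_cong refl)
        fix \<omega>
        have "(\<Sum>k\<in>I - S. (c(m := t)) k * X k \<omega>) = t * X m \<omega> + (\<Sum>k\<in>I - insert m S. c k * X k \<omega>)"
          unfolding IS using S(4) by (subst sum.insert) (auto intro!: sum.cong)
        then show "W \<omega> * iexp (t * X m \<omega>) =
            (\<Prod>k\<in>S. indicator (A k) (X k \<omega>)) * iexp (\<Sum>k\<in>I - S. (c(m := t)) k * X k \<omega>)"
          by (simp only: W_def of_real_add distrib_left exp_add ac_simps)
      qed
      also have "\<dots> = complex_of_real (\<Prod>k\<in>S. prob (X k -` A k \<inter> space M)) *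
          (\<Prod>k\<in>I - S. (\<integral>\<omega>. iexp ((c(m := t)) k * X k \<omega>) \<partial>M))"
        by (intro insert.IH S insert.prems)
      also have "(\<Prod>k\<in>I - S. (\<integral>\<omega>. iexp ((c(m := t)) k * X k \<omega>) \<partial>M)) =
          (\<integral>\<omega>. iexp (t * X m \<omega>) \<partial>M) * (\<Prod>k\<in>I - insert m S. (\<integral>\<omega>. iexp (c k * X k \<omega>) \<partial>M))"
        unfolding IS using S(4) by (subst prod.insert) (auto intro!: prod.cong)
      finally show ?thesis by (simp add: d_def)
    qed
    \<comment> \<open>Frequency \<open>0\<close> identifies the constant \<open>d\<close> as the
      mean of the weight \<open>W\<close>, which is the form of the factorization required
      below.\<close>
    from char_m[of 0] have W_int: "(\<integral>\<omega>. W \<omega> \<partial>M) = d"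
      by (simp add: prob_space)
    have "(\<integral>\<omega>. W \<omega> * indicator (A m) (X m \<omega>) \<partial>M) = (\<integral>\<omega>. W \<omega> \<partial>M) * prob (X m -` A m \<inter> space M)"
    proof (rule complex_expectation_weight_indicator_eq[where c = 1])
      show "norm (W \<omega>) \<le> 1" for \<omega>
        unfolding W_def norm_mult norm_exp_i_times prod_norm[symmetric]
        by (simp add: prod_le_1 indicator_def)
      show "(\<integral>\<omega>. W \<omega> * iexp (t * X m \<omega>) \<partial>M) = (\<integral>\<omega>. W \<omega> \<partial>M) * (\<integral>\<omega>. iexp (t * X m \<omega>) \<partial>M)" for t
        unfolding char_m W_int ..
    qed auto
    moreover have "(\<integral>\<omega>. W \<omega> * indicator (A m) (X m \<omega>) \<partial>M) =
      (\<integral>\<omega>. (\<Prod>k\<in>insert m S. indicator (A k) (X k \<omega>)) * iexp (\<Sum>k\<in>I - insert m S. c k * X k \<omega>) \<partial>M)"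
      using insert.hyps by (intro Bochner_Integration.integral_cong) (auto simp: W_def)
    ultimately show ?case
      using insert.hyps by (simp add: W_int d_def)
  qed
  show ?thesis
  proof (subst indep_vars_finite[where E = "\<lambda>_. sets borel"])
    show "\<forall>A\<in>I \<rightarrow> sets borel. prob (\<Inter>j\<in>I. X j -` A j \<inter> space M) = (\<Prod>j\<in>I. prob (X j -` A j \<inter> space M))"
    proof
      fix A :: "'i \<Rightarrow> real set" assume A: "A \<in> I \<rightarrow> sets borel"
      then have Am[measurable]: "A k \<in> sets borel" if "k \<in> I" for k using that by auto
      have "complex_of_real (prob (\<Inter>j\<in>I. X j -` A j \<inter> space M)) =
        (\<integral>\<omega>. complex_of_real (indicator (\<Inter>j\<in>I. X j -` A j \<inter> space M) \<omega>) \<partial>M)"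
      proof -
        have "(\<Inter>j\<in>I. X j -` A j \<inter> space M) \<inter> space M = (\<Inter>j\<in>I. X j -` A j \<inter> space M)"
          using False by auto
        then show ?thesis
          by (simp only: integral_complex_of_real Bochner_Integration.integral_indicator)
      qed
      also have "\<dots> = (\<integral>\<omega>. (\<Prod>k\<in>I. indicator (A k) (X k \<omega>)) \<partial>M)"
      proof (intro Bochner_Integration.integral_cong refl)
        fix \<omega> assume "\<omega> \<in> space M"
        then show "complex_of_real (indicator (\<Inter>j\<in>I. X j -` A j \<inter> space M) \<omega>) = (\<Prod>k\<in>I. indicator (A k) (X k \<omega>))"
          using fin by (cases "\<forall>k\<in>I. X k \<omega> \<in> A k") (auto simp: indicator_def prod_zero_iff)
      qed
      also have "\<dots> = complex_of_real (\<Prod>k\<in>I. prob (X k -` A k \<inter> space M))"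
        using mixed[OF fin subset_refl Am] by simp
      finally show "prob (\<Inter>j\<in>I. X j -` A j \<inter> space M) = (\<Prod>j\<in>I. prob (X j -` A j \<inter> space M))"
        using of_real_eq_iff by blast
    qed
    show "sets borel = sigma_sets (space borel) (sets borel)" for i
      by (metis sets.sigma_sets_eq)
    show "random_variable borel (X i)" if "i \<in> I" for i
      using that by (rule X)
    show "Int_stable (sets borel)" for i
      by (rule sets.Int_stable)
    show "sets borel \<subseteq> Pow (space borel)" for i
      by (rule sets.space_closed)
  qed (use False fin in simp_all)
qed

section \<open>Gaussian increments and the filtration\<close>

lemma integral_normal_density_iexp:
  assumes "\<sigma> > 0"
  shows "(\<integral>y. normal_density \<mu> \<sigma> y *\<^sub>R iexp (t * y) \<partial>lborel) = iexp (t * \<mu>) * exp (- (t * \<sigma>)\<^sup>2 / 2)"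
proof -
  have std: "\<sigma> * normal_density \<mu> \<sigma> (\<mu> + \<sigma> * z) = std_normal_density z" for z
    using assms by (simp add: normal_density_def real_sqrt_mult power_mult_distrib)
  have "(\<integral>y. normal_density \<mu> \<sigma> y *\<^sub>R iexp (t * y) \<partial>lborel) =
    \<sigma> *\<^sub>R (\<integral>z. normal_density \<mu> \<sigma> (\<mu> + \<sigma> * z) *\<^sub>R iexp (t * (\<mu> + \<sigma> * z)) \<partial>lborel)"
    using assms by (subst lborel_integral_real_affine[where c = \<sigma> and t = \<mu>]) auto
  also have "\<dots> = (\<integral>z. \<sigma> *\<^sub>R (normal_density \<mu> \<sigma> (\<mu> + \<sigma> * z) *\<^sub>R iexp (t * (\<mu> + \<sigma> * z))) \<partial>lborel)"
    by (rule integral_scaleR_right[symmetric])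
  also have "\<dots> = (\<integral>z. iexp (t * \<mu>) * (std_normal_density z *\<^sub>R iexp (t * \<sigma> * z)) \<partial>lborel)"
    by (intro Bochner_Integration.integral_cong refl)
       (simp add: std[symmetric] scaleR_conv_of_real distrib_left exp_add mult_ac)
  also have "\<dots> = iexp (t * \<mu>) * (\<integral>z. std_normal_density z *\<^sub>R iexp (t * \<sigma> * z) \<partial>lborel)"
    by (rule integral_mult_right_zero)
  also have "(\<integral>z. std_normal_density z *\<^sub>R iexp (t * \<sigma> * z) \<partial>lborel) = char std_normal_distribution (t * \<sigma>)"
    unfolding char_def by (subst integral_density) auto
  finally show ?thesis
    by (simp add: char_std_normal_distribution)
qed

text \<open>Completing the square. The real part \<open>x\<close> of \<open>c\<close> is a
  Cameron-Martin tilt that moves the mean of the Gaussian from \<open>0\<close> to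
  \<open>x * d\<close>; the imaginary part leaves an oscillation, a phase and the constant
  \<open>exp (l\<^sup>2 * d / 2)\<close>, which cancel after integration over
  \<open>y\<close>.\<close>

lemma exponential_tilt_normal_density:
  fixes x l d :: real and c :: complex
  assumes "d > 0"
  defines "c \<equiv> complex_of_real x + \<i> * complex_of_real l"
  shows "normal_density 0 (sqrt d) y *\<^sub>R exp (c * y - c\<^sup>2 * d / 2) =
     exp (l\<^sup>2 * d / 2) * iexp (- (l * x * d)) * (normal_density (x * d) (sqrt d) y *\<^sub>R iexp (l * y))"
proof -
  have tilt: "exp (x * y - x\<^sup>2 * d / 2) * normal_density 0 (sqrt d) y = normal_density (x * d) (sqrt d) y"
  proof -
    have "x * y - x\<^sup>2 * d / 2 - y\<^sup>2 / (2 * d) = - (y - x * d)\<^sup>2 / (2 * d)"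
      using assms by (simp add: field_simps power2_eq_square)
    then have "exp (x * y - x\<^sup>2 * d / 2) * exp (- y\<^sup>2 / (2 * d)) = exp (- (y - x * d)\<^sup>2 / (2 * d))"
      by (simp flip: exp_add)
    then show ?thesis
      using assms by (simp add: normal_density_def)
  qed
  have "c * y - c\<^sup>2 * d / 2 =
      of_real (x * y - x\<^sup>2 * d / 2) + (of_real (l\<^sup>2 * d / 2) + (\<i> * of_real (- (l * x * d)) + \<i> * of_real (l * y)))"
    by (simp add: c_def power2_eq_square algebra_simps) (simp add: field_simps)
  then have "exp (c * y - c\<^sup>2 * d / 2) = of_real (exp (x * y - x\<^sup>2 * d / 2)) *
      (of_real (exp (l\<^sup>2 * d / 2)) * (iexp (- (l * x * d)) * iexp (l * y)))"
    by (simp only: exp_add exp_of_real)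
  then show ?thesis
    unfolding scaleR_conv_of_real tilt[symmetric] of_real_mult by (simp only: mult_ac)
qed

text \<open>The phases have modulus one, so the integral of the modulus is
  \<open>exp (l\<^sup>2 * d / 2)\<close> whatever the value of \<open>x\<close>. This uniformity
  gives integrability once \<open>x\<close> is replaced by a random variable.\<close>

lemma norm_exponential_tilt_normal_density:
  fixes x l d :: real and c :: complex
  assumes "d > 0"
  defines "c \<equiv> complex_of_real x + \<i> * complex_of_real l"
  shows "normal_density 0 (sqrt d) y * norm (exp (c * y - c\<^sup>2 * d / 2)) =
     exp (l\<^sup>2 * d / 2) * normal_density (x * d) (sqrt d) y"
proof -
  have "normal_density 0 (sqrt d) y * norm (exp (c * y - c\<^sup>2 * d / 2)) =
      norm (normal_density 0 (sqrt d) y *\<^sub>R exp (c * y - c\<^sup>2 * d / 2))"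
    by simp
  also have "\<dots> = exp (l\<^sup>2 * d / 2) * normal_density (x * d) (sqrt d) y"
    unfolding c_def exponential_tilt_normal_density[OF assms(1)] norm_mult norm_scaleR norm_exp_i_times by simp
  finally show ?thesis .
qed

text \<open>One step of the martingale property of the complex exponential. The past enters through
  \<open>(Z, x)\<close>, which is independent of the increment \<open>Y\<close>, so the expectation
  is an iterated integral. Integrating \<open>y\<close> first returns \<open>z\<close> by the tilt
  formula, and the absolute integral is a constant multiple of \<open>norm z\<close>, which
  justifies Fubini.\<close>

lemma (in prob_space) integral_exponential_gaussian_increment:
  fixes Z :: "'a \<Rightarrow> complex" and x Y :: "'a \<Rightarrow> real" and l d :: real
    and c :: "'a \<Rightarrow> complex"
  defines "c \<equiv> \<lambda>\<omega>. complex_of_real (x \<omega>) + \<i> * complex_of_real l"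
  assumes F: "subalgebra M F" "Z \<in> borel_measurable F" "x \<in> borel_measurable F"
    and indep: "\<And>A C. A \<in> sets F \<Longrightarrow> C \<in> sets borel \<Longrightarrow>
      prob (A \<inter> (Y -` C \<inter> space M)) = prob A * prob (Y -` C \<inter> space M)"
    and Y: "distributed M lborel Y (\<lambda>y. ennreal (normal_density 0 (sqrt d) y))" and d: "d > 0"
    and Z: "integrable M Z"
  shows "integrable M (\<lambda>\<omega>. Z \<omega> * exp (c \<omega> * Y \<omega> - (c \<omega>)\<^sup>2 * d / 2))" (is ?integrable)
    and "(\<integral>\<omega>. Z \<omega> * exp (c \<omega> * Y \<omega> - (c \<omega>)\<^sup>2 * d / 2) \<partial>M) = (\<integral>\<omega>. Z \<omega> \<partial>M)" (is ?integral)
proof -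
  define q where "q x = complex_of_real x + \<i> * complex_of_real l" for x
  define h :: "(complex \<times> real) \<times> real \<Rightarrow> complex" where
    "h = (\<lambda>p. fst (fst p) * exp (q (snd (fst p)) * snd p - (q (snd (fst p)))\<^sup>2 * d / 2))"
  define NY where "NY = density lborel (\<lambda>y. ennreal (normal_density 0 (sqrt d) y))"
  define NZ where "NZ = distr M (borel \<Otimes>\<^sub>M borel) (\<lambda>\<omega>. (Z \<omega>, x \<omega>))"
  have ZF: "(\<lambda>\<omega>. (Z \<omega>, x \<omega>)) \<in> F \<rightarrow>\<^sub>M borel \<Otimes>\<^sub>M borel"
    using F(2,3) by simp
  then have rv[measurable]: "(\<lambda>\<omega>. (Z \<omega>, x \<omega>)) \<in> M \<rightarrow>\<^sub>M borel \<Otimes>\<^sub>M borel" "Y \<in> M \<rightarrow>\<^sub>M borel"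
    using Y measurable_from_subalg[OF F(1)] by (auto simp: distributed_def)
  have "distr M borel Y = distr M lborel Y"
    by (rule distr_cong) auto
  with Y have NY: "distr M borel Y = NY"
    by (simp add: distributed_def NY_def)
  interpret NY: prob_space NY
    unfolding NY[symmetric] by (rule prob_space_distr) simp
  interpret NZ: prob_space NZ
    unfolding NZ_def by (rule prob_space_distr) simp
  interpret P: pair_prob_space NZ NY ..
  have sets[measurable_cong]: "sets NZ = sets (borel \<Otimes>\<^sub>M borel)" "sets NY = sets borel"
    by (simp_all add: NZ_def NY_def)
  \<comment> \<open>Independence is given event by event; rectangles determine the product measure,
    so this is enough to identify the joint law.\<close>
  have joint: "NZ \<Otimes>\<^sub>M NY = distr M ((borel \<Otimes>\<^sub>M borel) \<Otimes>\<^sub>M borel) (\<lambda>\<omega>. ((Z \<omega>, x \<omega>), Y \<omega>))"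
  proof (rule pair_measure_eqI)
    fix A C assume "A \<in> sets NZ" "C \<in> sets NY"
    then have [measurable]: "A \<in> sets (borel \<Otimes>\<^sub>M borel)" "C \<in> sets borel"
      by (simp_all add: NZ_def NY_def)
    let ?A = "(\<lambda>\<omega>. (Z \<omega>, x \<omega>)) -` A \<inter> space M" and ?C = "Y -` C \<inter> space M"
    have "?A \<in> sets F"
      using measurable_sets[OF ZF, of A] F(1) by (simp add: subalgebra_def)
    then have "prob (?A \<inter> ?C) = prob ?A * prob ?C"
      by (intro indep) auto
    then have "emeasure M (?A \<inter> ?C) = emeasure M ?A * emeasure M ?C"
      by (simp add: emeasure_eq_measure ennreal_mult)
    moreover have "(\<lambda>\<omega>. ((Z \<omega>, x \<omega>), Y \<omega>)) -` (A \<times> C) \<inter> space M = ?A \<inter> ?C"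
      by auto
    ultimately show "emeasure NZ A * emeasure NY C =
        emeasure (distr M ((borel \<Otimes>\<^sub>M borel) \<Otimes>\<^sub>M borel) (\<lambda>\<omega>. ((Z \<omega>, x \<omega>), Y \<omega>))) (A \<times> C)"
      unfolding NY[symmetric] NZ_def by (simp add: emeasure_distr)
  qed (simp_all add: NZ.sigma_finite_measure_axioms NY.sigma_finite_measure_axioms sets cong: sets_pair_measure_cong)
  have h[measurable]: "h \<in> borel_measurable ((borel \<Otimes>\<^sub>M borel) \<Otimes>\<^sub>M borel)"
    unfolding h_def q_def by measurable
  have int_y: "integrable NY (\<lambda>y. h ((z, x), y))" for z x
  proof -
    have "integrable lborel (\<lambda>y. normal_density 0 (sqrt d) y *\<^sub>R exp (q x * y - (q x)\<^sup>2 * d / 2))"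
    proof (rule Bochner_Integration.integrable_bound)
      show "integrable lborel (\<lambda>y. exp (l\<^sup>2 * d / 2) * normal_density (x * d) (sqrt d) y)"
        using d by simp
      show "AE y in lborel. norm (normal_density 0 (sqrt d) y *\<^sub>R exp (q x * y - (q x)\<^sup>2 * d / 2))
          \<le> norm (exp (l\<^sup>2 * d / 2) * normal_density (x * d) (sqrt d) y)"
        using norm_exponential_tilt_normal_density[OF d, of _ x l, folded q_def] by simp
    qed (auto simp: q_def)
    then have "integrable lborel (\<lambda>y. normal_density 0 (sqrt d) y *\<^sub>R h ((z, x), y))"
      by (simp add: h_def mult.commute[of z] flip: mult_scaleR_left)
    then show ?thesis
      unfolding NY_def by (subst integrable_density) (auto simp: h_def q_def)
  qed
  have norm_y: "(\<integral>y. norm (h ((z, x), y)) \<partial>NY) = exp (l\<^sup>2 * d / 2) * norm z" for z x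
  proof -
    have "(\<integral>y. norm (h ((z, x), y)) \<partial>NY) = (\<integral>y. normal_density 0 (sqrt d) y *\<^sub>R norm (h ((z, x), y)) \<partial>lborel)"
      unfolding NY_def by (subst integral_density) (auto simp: h_def q_def)
    also have "\<dots> = (\<integral>y. norm z * exp (l\<^sup>2 * d / 2) * normal_density (x * d) (sqrt d) y \<partial>lborel)"
      using norm_exponential_tilt_normal_density[OF d, of _ x l, folded q_def]
      by (intro Bochner_Integration.integral_cong) (auto simp: h_def norm_mult mult_ac)
    also have "\<dots> = norm z * exp (l\<^sup>2 * d / 2)"
      using d by simp
    finally show ?thesis by simp
  qed
  have int_1: "(\<integral>y. h ((z, x), y) \<partial>NY) = z" for z x
  proof -
    have "(\<integral>y. h ((z, x), y) \<partial>NY) = (\<integral>y. normal_density 0 (sqrt d) y *\<^sub>R h ((z, x), y) \<partial>lborel)"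
      unfolding NY_def by (subst integral_density) (auto simp: h_def q_def)
    also have "\<dots> = (\<integral>y. z * (exp (l\<^sup>2 * d / 2) * iexp (- (l * x * d))) *
        (normal_density (x * d) (sqrt d) y *\<^sub>R iexp (l * y)) \<partial>lborel)"
      using exponential_tilt_normal_density[OF d, of _ x l, folded q_def]
      by (intro Bochner_Integration.integral_cong) (auto simp: h_def scaleR_conv_of_real mult_ac)
    also have "\<dots> = z * (exp (l\<^sup>2 * d / 2) * iexp (- (l * x * d))) * (iexp (l * (x * d)) * exp (- (l * sqrt d)\<^sup>2 / 2))"
      using d by (simp only: integral_mult_right_zero integral_normal_density_iexp real_sqrt_gt_zero)
    also have "\<dots> = z * ((exp (l\<^sup>2 * d / 2) * exp (- (l * sqrt d)\<^sup>2 / 2)) * (iexp (- (l * x * d)) * iexp (l * (x * d))))"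
      by (simp only: mult_ac of_real_mult)
    \<comment> \<open>The prefactor of the tilt cancels against the decay of the Gaussian
      characteristic function; its phase cancels against the one that comes from the mean
      \<open>x * d\<close>.\<close>
    also have "exp (l\<^sup>2 * d / 2) * exp (- (l * sqrt d)\<^sup>2 / 2) = 1"
      using d by (simp add: power_mult_distrib flip: exp_add)
    also have "iexp (- (l * x * d)) * iexp (l * (x * d)) = 1"
      by (simp add: mult_ac flip: exp_add)
    finally show ?thesis by simp
  qed
  have int_Z: "integrable NZ (\<lambda>p. fst p)"
    unfolding NZ_def using Z rv by (subst integrable_distr_eq) auto
  have int_h: "integrable (NZ \<Otimes>\<^sub>M NY) h"
  proof (rule P.Fubini_integrable)
    have "integrable NZ (\<lambda>p. exp (l\<^sup>2 * d / 2) * norm (fst p))"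
      using int_Z by simp
    then show "integrable NZ (\<lambda>p. \<integral>y. norm (h (p, y)) \<partial>NY)"
      using norm_y[of "fst p" "snd p" for p] by simp
  qed (auto simp: int_y split_paired_all)
  have comp: "h ((Z \<omega>, x \<omega>), Y \<omega>) = Z \<omega> * exp (c \<omega> * Y \<omega> - (c \<omega>)\<^sup>2 * d / 2)" for \<omega>
    by (simp add: h_def c_def q_def)
  have meas: "(\<lambda>\<omega>. ((Z \<omega>, x \<omega>), Y \<omega>)) \<in> M \<rightarrow>\<^sub>M (borel \<Otimes>\<^sub>M borel) \<Otimes>\<^sub>M borel"
    by measurable
  show ?integrable
    using integrable_distr[OF meas, of h] int_h joint NY by (simp add: comp)
  have "(\<integral>\<omega>. Z \<omega> * exp (c \<omega> * Y \<omega> - (c \<omega>)\<^sup>2 * d / 2) \<partial>M) = (\<integral>p. h p \<partial>(NZ \<Otimes>\<^sub>M NY))"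
    using integral_distr[OF meas h] joint NY by (simp add: comp)
  also have "\<dots> = (\<integral>p. (\<integral>y. h (p, y) \<partial>NY) \<partial>NZ)"
    by (rule P.integral_fst'[OF int_h, symmetric])
  also have "\<dots> = (\<integral>p. fst p \<partial>NZ)"
    using int_1[of "fst p" "snd p" for p] by simp
  also have "\<dots> = (\<integral>\<omega>. Z \<omega> \<partial>M)"
    unfolding NZ_def by (subst integral_distr) auto
  finally show ?integral .
qed

lemma space_natural_filtration [simp]: "space (natural_filtration M B t) = space M"
  unfolding natural_filtration_def by (intro space_measure_of) auto

lemma sets_natural_filtration:
  "sets (natural_filtration M B t) =
     sigma_sets (space M) (\<Union>s\<in>{0..t}. {B s -` A \<inter> space M | A. A \<in> sets borel})"
  unfolding natural_filtration_def by (intro sets_measure_of) auto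

lemma space_augmented_filtration [simp]: "space (augmented_filtration M B t) = space M"
  unfolding augmented_filtration_def
  by (intro space_measure_of) (use sets.space_closed[of "natural_filtration M B t"] sets.space_closed[of M] in \<open>auto simp: null_sets_def\<close>)

text \<open>Flattens the two nested generated \<sigma>-algebras to a single generator, so that
  inclusions need only be checked on sets depending on one time and on null sets.\<close>

lemma sets_augmented_filtration:
  "sets (augmented_filtration M B t) =
     sigma_sets (space M) ((\<Union>s\<in>{0..t}. {B s -` A \<inter> space M | A. A \<in> sets borel}) \<union> null_sets M)"
    (is "_ = sigma_sets _ (?G \<union> _)")
proof -
  have "sigma_sets (space M) (sigma_sets (space M) ?G \<union> null_sets M) = sigma_sets (space M) (?G \<union> null_sets M)"
    by (intro antisym sigma_sets_mono' sigma_sets_mono)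
       (auto intro: sigma_sets.Basic sigma_sets_mono'[THEN subsetD, rotated])
  moreover have "sigma_sets (space M) ?G \<union> null_sets M \<subseteq> Pow (space M)"
    using sets.space_closed[of "natural_filtration M B t"] sets.space_closed[of M]
    by (auto simp: null_sets_def sets_natural_filtration)
  ultimately show ?thesis
    unfolding augmented_filtration_def sets_natural_filtration by (simp add: sets_measure_of)
qed

lemma augmented_filtration_mono:
  assumes "s \<le> t"
  shows "sets (augmented_filtration M B s) \<subseteq> sets (augmented_filtration M B t)"
  unfolding sets_augmented_filtration using assms by (intro sigma_sets_mono') fastforce

lemma measurable_augmented_filtration_mono:
  assumes "s \<le> t" "f \<in> measurable (augmented_filtration M B s) N"
  shows "f \<in> measurable (augmented_filtration M B t) N"
  using assms augmented_filtration_mono[OF assms(1), of M B] by (auto simp: measurable_def)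

lemma adapted_augmented_filtration:
  assumes "s \<in> {0..t}"
  shows "B s \<in> borel_measurable (augmented_filtration M B t)"
proof (rule measurableI)
  fix A :: "real set" assume "A \<in> sets borel"
  then show "B s -` A \<inter> space (augmented_filtration M B t) \<in> sets (augmented_filtration M B t)"
    using assms unfolding sets_augmented_filtration by (auto intro!: sigma_sets.Basic)
qed simp

lemma subalgebra_augmented_filtration:
  assumes "\<And>s. s \<in> {0..t} \<Longrightarrow> B s \<in> borel_measurable M"
  shows "subalgebra M (augmented_filtration M B t)"
  unfolding subalgebra_def sets_augmented_filtration
  using assms by (auto intro!: sets.sigma_sets_subset measurable_sets)

text \<open>Adding \<open>0\<close> and \<open>s\<close> to the times in \<open>R\<close> gives a
  partition whose last point before \<open>t\<close> is \<open>s\<close>. Relative to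
  \<open>B 0\<close>, every \<open>B r\<close> is a partial sum of the increments up to
  \<open>s\<close>, while \<open>B t - B s\<close> is one further increment, so independence of
  increments applies to the two blocks.\<close>

lemma (in prob_space) brownian_cylinder_indep_increment:
  assumes B: "standard_brownian_motion M {0..} B"
    and R: "finite R" "R \<subseteq> {0..s}" and A: "\<And>r. r \<in> R \<Longrightarrow> A r \<in> sets borel"
    and s: "0 \<le> s" "s < t" and C: "C \<in> sets borel"
  shows "prob ({\<omega>\<in>space M. \<forall>r\<in>R. B r \<omega> \<in> A r} \<inter> ((\<lambda>\<omega>. B t \<omega> - B s \<omega>) -` C \<inter> space M)) =
    prob {\<omega>\<in>space M. \<forall>r\<in>R. B r \<omega> \<in> A r} * prob ((\<lambda>\<omega>. B t \<omega> - B s \<omega>) -` C \<inter> space M)"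
proof -
  have B_meas[measurable]: "B r \<in> borel_measurable M" if "0 \<le> r" for r
    using B that by (auto simp: standard_brownian_motion_def)
  have B0: "AE \<omega> in M. B 0 \<omega> = 0"
    using B by (auto simp: standard_brownian_motion_def)
  define xs where "xs = sorted_list_of_set (R \<union> {0, s})"
  define n where "n = length xs"
  define \<tau> where "\<tau> k = (if k < n then xs ! k else t)" for k
  have xs: "set xs = R \<union> {0, s}" "sorted xs" "distinct xs"
    using R by (simp_all add: xs_def del: sorted_list_of_set.sorted_key_list_of_set_insert_remove)
  have xs_le: "x \<in> {0..s}" if "x \<in> set xs" for x
    using that xs(1) R(2) s by auto
  have n0: "n > 0"
    using xs(1) by (auto simp: n_def)
  \<comment> \<open>\<open>m\<close> is the index of the time \<open>s\<close>: the increments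
    \<open>0, ..., m - 1\<close> lie before \<open>s\<close>, and the increment \<open>m\<close>
    runs from \<open>s\<close> to \<open>t\<close>.\<close>
  define m where "m = n - 1"
  have nm: "n = Suc m"
    using n0 by (simp add: m_def)
  have \<tau>_mono: "\<tau> i < \<tau> j" if "i < j" "j \<le> n" for i j
  proof (cases "j < n")
    case True
    then show ?thesis
      using that xs(2,3) by (simp add: \<tau>_def n_def sorted_wrt_nth_less strict_sorted_iff)
  next
    case False
    then show ?thesis
      using that xs_le[of "xs ! i"] s by (auto simp: \<tau>_def n_def)
  qed
  have \<tau>_nonneg: "0 \<le> \<tau> k" for k
    using xs_le[of "xs ! k"] s by (auto simp: \<tau>_def n_def)
  have \<tau>_surj: "\<exists>j<n. \<tau> j = x" if "x \<in> R \<union> {0, s}" for x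
    using that unfolding xs(1)[symmetric] in_set_conv_nth n_def \<tau>_def by auto
  have \<tau>0: "\<tau> 0 = 0"
  proof -
    obtain j where j: "j < n" "\<tau> j = 0" using \<tau>_surj[of 0] by auto
    then have "j = 0"
      using \<tau>_mono[of 0 j] \<tau>_nonneg[of 0] by (cases j) auto
    with j show ?thesis by simp
  qed
  have \<tau>s: "\<tau> (m) = s"
  proof -
    obtain j where j: "j < n" "\<tau> j = s" using \<tau>_surj[of s] by auto
    moreover have "\<tau> (m) \<le> s"
      using xs_le[of "xs ! m"] nm by (auto simp: \<tau>_def n_def)
    ultimately have "\<not> j < m"
      using \<tau>_mono[of j m] nm by auto
    with j nm show ?thesis by (cases "j = m") auto
  qed
  have \<tau>n: "\<tau> (Suc m) = t" by (simp add: \<tau>_def nm)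
  define X where "X k \<omega> = B (\<tau> (Suc k)) \<omega> - B (\<tau> k) \<omega>" for k \<omega>
  have [measurable]: "X k \<in> borel_measurable M" for k
    unfolding X_def using \<tau>_nonneg by measurable
  have "\<tau> ` {..n} \<subseteq> {0..} \<and> strict_mono_on {..n} \<tau>"
    using \<tau>_mono \<tau>_nonneg by (auto simp: strict_mono_on_def)
  then have "indep_vars (\<lambda>_. borel) X {..<n}"
    unfolding X_def using B by (simp add: standard_brownian_motion_def)
  then have indep: "indep_var (PiM {..<m} (\<lambda>_. borel)) (\<lambda>\<omega>. restrict (\<lambda>k. X k \<omega>) {..<m})
      (PiM {m} (\<lambda>_. borel)) (\<lambda>\<omega>. restrict (\<lambda>k. X k \<omega>) {m})"
    by (rule indep_var_restrict) (auto simp: nm)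
  define J where "J = {j. j < n \<and> \<tau> j \<in> R}"
  define SA where "SA = {f \<in> space (PiM {..<m} (\<lambda>_. borel)). \<forall>j\<in>J. (\<Sum>k<j. f k) \<in> A (\<tau> j)}"
  define SC where "SC = {f \<in> space (PiM {m} (\<lambda>_. borel)). f (m) \<in> C}"
  have J: "finite J" "\<And>j. j \<in> J \<Longrightarrow> j \<le> m \<and> A (\<tau> j) \<in> sets borel"
    using A by (auto simp: J_def nm)
  have SA: "SA \<in> sets (PiM {..<m} (\<lambda>_. borel))"
    unfolding SA_def
  proof (rule sets.sets_Collect_finite_All[OF _ J(1)])
    fix j assume "j \<in> J"
    with J have [measurable]: "A (\<tau> j) \<in> sets borel" and "j \<le> m" by auto
    have "(\<lambda>f. \<Sum>k<j. f k) \<in> borel_measurable (PiM {..<m} (\<lambda>_. borel :: real measure))"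
      using \<open>j \<le> m\<close> by (intro borel_measurable_sum measurable_component_singleton) auto
    then show "{f \<in> space (PiM {..<m} (\<lambda>_. borel)). (\<Sum>k<j. f k) \<in> A (\<tau> j)} \<in> sets (PiM {..<m} (\<lambda>_. borel))"
      by measurable
  qed
  have SC: "SC \<in> sets (PiM {m} (\<lambda>_. borel))"
    unfolding SC_def using C measurable_component_singleton[of "m" "{m}" "\<lambda>_. borel :: real measure"] by measurable
  have tel: "(\<Sum>k<j. X k \<omega>) = B (\<tau> j) \<omega> - B 0 \<omega>" for j \<omega>
    unfolding X_def using sum_lessThan_telescope[of "\<lambda>k. B (\<tau> k) \<omega>" j] by (simp add: \<tau>0)
  \<comment> \<open>Increments determine a path only relative to its start, hence
    \<open>B r - B 0\<close> in the event; since \<open>B 0 = 0\<close> almost surely, it differs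
    from the cylinder event by a null set.\<close>
  let ?E = "{\<omega>\<in>space M. \<forall>r\<in>R. B r \<omega> - B 0 \<omega> \<in> A r}" and ?Y = "(\<lambda>\<omega>. B t \<omega> - B s \<omega>) -` C \<inter> space M"
  have E: "(\<lambda>\<omega>. restrict (\<lambda>k. X k \<omega>) {..<m}) -` SA \<inter> space M = ?E"
  proof -
    have "(\<forall>j\<in>J. (\<Sum>k<j. restrict (\<lambda>k. X k \<omega>) {..<m} k) \<in> A (\<tau> j)) \<longleftrightarrow> (\<forall>r\<in>R. B r \<omega> - B 0 \<omega> \<in> A r)" for \<omega>
    proof -
      have "(\<Sum>k<j. restrict (\<lambda>k. X k \<omega>) {..<m} k) = B (\<tau> j) \<omega> - B 0 \<omega>" if "j \<in> J" for j
        unfolding tel[symmetric] using J(2)[OF that] by (intro sum.cong) auto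
      then have "(\<forall>j\<in>J. (\<Sum>k<j. restrict (\<lambda>k. X k \<omega>) {..<m} k) \<in> A (\<tau> j)) \<longleftrightarrow>
          (\<forall>j\<in>J. B (\<tau> j) \<omega> - B 0 \<omega> \<in> A (\<tau> j))"
        by simp
      also have "\<dots> \<longleftrightarrow> (\<forall>r\<in>R. B r \<omega> - B 0 \<omega> \<in> A r)"
        using \<tau>_surj unfolding J_def by blast
      finally show ?thesis .
    qed
    then show ?thesis
      unfolding SA_def by (auto simp: space_PiM PiE_def extensional_def)
  qed
  have Y: "(\<lambda>\<omega>. restrict (\<lambda>k. X k \<omega>) {m}) -` SC \<inter> space M = ?Y"
    by (auto simp: SC_def space_PiM PiE_def extensional_def X_def \<tau>s \<tau>n)
  have "prob (?E \<inter> ?Y) = prob ?E * prob ?Y"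
  proof -
    have "?E \<inter> ?Y = (\<lambda>\<omega>. (restrict (\<lambda>k. X k \<omega>) {..<m}, restrict (\<lambda>k. X k \<omega>) {m})) -` (SA \<times> SC) \<inter> space M"
      unfolding E[symmetric] Y[symmetric] by blast
    then show ?thesis
      using indep_varD[OF indep SA SC] by (simp only: E Y)
  qed
  moreover have [measurable]: "?Y \<in> sets M"
    using s C by (intro measurable_sets[OF borel_measurable_diff]) auto
  have E1: "?E \<in> sets M"
    using SA unfolding E[symmetric] by measurable
  have E2: "{\<omega>\<in>space M. \<forall>r\<in>R. B r \<omega> \<in> A r} \<in> sets M"
    using R A by (intro sets.sets_Collect_finite_All) (auto intro!: measurable_sets_Collect simp: subset_eq)
  have "prob (?E \<inter> ?Y) = prob ({\<omega>\<in>space M. \<forall>r\<in>R. B r \<omega> \<in> A r} \<inter> ?Y)"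
    using B0 E1 E2 by (intro finite_measure_eq_AE) auto
  moreover have "prob ?E = prob {\<omega>\<in>space M. \<forall>r\<in>R. B r \<omega> \<in> A r}"
    using B0 E1 E2 by (intro finite_measure_eq_AE) auto
  ultimately show ?thesis by simp
qed

text \<open>A \<pi>-system argument: the factorization is known for cylinder events, which are
  stable under intersection, and therefore extends to the \<sigma>-algebra they generate.\<close>

lemma (in prob_space) brownian_increment_indep_filtration:
  assumes B: "standard_brownian_motion M {0..} B" and s: "0 \<le> s" "s < t"
    and A: "A \<in> sets (augmented_filtration M B s)" and C: "C \<in> sets borel"
  shows "prob (A \<inter> ((\<lambda>\<omega>. B t \<omega> - B s \<omega>) -` C \<inter> space M)) =
    prob A * prob ((\<lambda>\<omega>. B t \<omega> - B s \<omega>) -` C \<inter> space M)"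
proof -
  have B_meas[measurable]: "B r \<in> borel_measurable M" if "0 \<le> r" for r
    using B that by (auto simp: standard_brownian_motion_def)
  have [measurable]: "B s \<in> borel_measurable M" "B t \<in> borel_measurable M"
    using s by auto
  \<comment> \<open>Allowing null sets in the generator yields the augmented filtration at once.\<close>
  define G where "G = {E \<in> sets M. \<exists>R A. finite R \<and> R \<subseteq> {0..s} \<and> (\<forall>r. A r \<in> sets borel) \<and>
    (AE \<omega> in M. \<omega> \<in> E \<longleftrightarrow> (\<forall>r\<in>R. B r \<omega> \<in> A r))}"
  define H where "H = {(\<lambda>\<omega>. B t \<omega> - B s \<omega>) -` C \<inter> space M | C. C \<in> sets borel}"
  have "Int_stable G"
  proof (rule Int_stableI)
    fix E1 E2 assume "E1 \<in> G" "E2 \<in> G"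
    then obtain R1 A1 R2 A2 where
      1: "E1 \<in> sets M" "finite R1" "R1 \<subseteq> {0..s}" "\<And>r. A1 r \<in> sets borel" "AE \<omega> in M. \<omega> \<in> E1 \<longleftrightarrow> (\<forall>r\<in>R1. B r \<omega> \<in> A1 r)" and
      2: "E2 \<in> sets M" "finite R2" "R2 \<subseteq> {0..s}" "\<And>r. A2 r \<in> sets borel" "AE \<omega> in M. \<omega> \<in> E2 \<longleftrightarrow> (\<forall>r\<in>R2. B r \<omega> \<in> A2 r)"
      unfolding G_def by blast
    \<comment> \<open>Merges the constraints of the two cylinders; \<open>UNIV\<close> stands for
      the absent constraint at a time that occurs in only one of them.\<close>
    define A where "A r = (if r \<in> R1 then A1 r else UNIV) \<inter> (if r \<in> R2 then A2 r else UNIV)" for r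
    have "AE \<omega> in M. \<omega> \<in> E1 \<inter> E2 \<longleftrightarrow> (\<forall>r\<in>R1 \<union> R2. B r \<omega> \<in> A r)"
      using 1(5) 2(5) by eventually_elim (auto simp: A_def)
    moreover have "A r \<in> sets borel" for r
      using 1(4) 2(4) by (auto simp: A_def)
    ultimately show "E1 \<inter> E2 \<in> G"
      unfolding G_def using 1(1-3) 2(1-3) by (intro CollectI conjI exI[of _ "R1 \<union> R2"] exI[of _ A]) auto
  qed
  moreover have "Int_stable H"
  proof (rule Int_stableI)
    fix E1 E2 assume "E1 \<in> H" "E2 \<in> H"
    then obtain C1 C2 where "C1 \<in> sets borel" "C2 \<in> sets borel"
      "E1 = (\<lambda>\<omega>. B t \<omega> - B s \<omega>) -` C1 \<inter> space M" "E2 = (\<lambda>\<omega>. B t \<omega> - B s \<omega>) -` C2 \<inter> space M"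
      unfolding H_def by blast
    then show "E1 \<inter> E2 \<in> H"
      unfolding H_def by (intro CollectI exI[of _ "C1 \<inter> C2"]) auto
  qed
  moreover have "indep_set G H"
    unfolding indep_sets2_eq
  proof (intro conjI ballI)
    show "G \<subseteq> events" by (auto simp: G_def)
    show "H \<subseteq> events" unfolding H_def by auto
    fix E F assume "E \<in> G" "F \<in> H"
    then obtain R A C where E: "E \<in> sets M" "finite R" "R \<subseteq> {0..s}" "\<And>r. A r \<in> sets borel"
      "AE \<omega> in M. \<omega> \<in> E \<longleftrightarrow> (\<forall>r\<in>R. B r \<omega> \<in> A r)" and
      F: "C \<in> sets borel" "F = (\<lambda>\<omega>. B t \<omega> - B s \<omega>) -` C \<inter> space M"
      unfolding G_def H_def by blast
    let ?E = "{\<omega>\<in>space M. \<forall>r\<in>R. B r \<omega> \<in> A r}"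
    have [measurable]: "F \<in> sets M" using F by simp
    have [measurable]: "?E \<in> sets M"
      using E(2-4) by (intro sets.sets_Collect_finite_All) (auto intro!: measurable_sets_Collect simp: subset_eq)
    have AE: "AE \<omega> in M. \<omega> \<in> E \<longleftrightarrow> \<omega> \<in> ?E"
      using E(5) by (auto elim: AE_mp)
    have "prob (E \<inter> F) = prob (?E \<inter> F)" "prob E = prob ?E"
      using AE E(1) by (auto intro!: finite_measure_eq_AE)
    then show "prob (E \<inter> F) = prob E * prob F"
      using brownian_cylinder_indep_increment[OF B E(2,3,4) s F(1)] by (simp add: F(2))
  qed
  ultimately have indep: "indep_set (sigma_sets (space M) G) (sigma_sets (space M) H)"
    by (intro indep_set_sigma_sets)
  have "sets (augmented_filtration M B s) \<subseteq> sigma_sets (space M) G"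
    unfolding sets_augmented_filtration
  proof (intro sigma_sets_mono' Un_least UN_least subsetI)
    fix r E assume "r \<in> {0..s}" "E \<in> {B r -` A \<inter> space M | A. A \<in> sets borel}"
    then obtain A where "A \<in> sets borel" "E = B r -` A \<inter> space M" by blast
    with \<open>r \<in> {0..s}\<close> show "E \<in> G"
      unfolding G_def by (intro CollectI conjI exI[of _ "{r}"] exI[of _ "\<lambda>_. A"]) auto
  next
    \<comment> \<open>A null set is almost surely equal to the cylinder with the impossible
      constraint \<open>B 0 \<omega> \<in> {}\<close>.\<close>
    fix E assume "E \<in> null_sets M"
    then show "E \<in> G"
      unfolding G_def using s AE_not_in[of E M] by (intro CollectI conjI exI[of _ "{0}"] exI[of _ "\<lambda>_. {}"]) auto
  qed
  moreover have "(\<lambda>\<omega>. B t \<omega> - B s \<omega>) -` C \<inter> space M \<in> sigma_sets (space M) H"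
    using C unfolding H_def by (intro sigma_sets.Basic) auto
  ultimately show ?thesis
    using A by (intro indep_setD[OF indep]) auto
qed

section \<open>Stochastic exponentials of simple integrands\<close>

text \<open>Induction on the number of points of \<open>D\<close> strictly inside the interval,
  cutting at the largest one. With \<open>D\<close> the breakpoints of two step processes it moves
  along pieces on which both are constant, in place of an explicit common refinement of their
  partitions.\<close>

lemma interval_chain_induct:
  fixes a b :: real
  assumes D: "finite D" and ab: "a \<le> b" and Pa: "P a"
    and step: "\<And>s t. a \<le> s \<Longrightarrow> s < t \<Longrightarrow> t \<le> b \<Longrightarrow> D \<inter> {s<..<t} = {} \<Longrightarrow> P s \<Longrightarrow> P t"
  shows "P b"
proof -
  have "P x" if "a \<le> x" "x \<le> b" for x
    using that
  proof (induction "card (D \<inter> {a<..<x})" arbitrary: x rule: less_induct)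
    case less
    show ?case
    proof (cases "x = a \<or> D \<inter> {a<..<x} = {}")
      case True
      then show ?thesis
        using less.prems Pa step[of a x] by fastforce
    next
      case False
      define d where "d = Max (D \<inter> {a<..<x})"
      have fin: "finite (D \<inter> {a<..<x})"
        using D by auto
      have d: "d \<in> D \<inter> {a<..<x}"
        unfolding d_def using False fin by (intro Max_in) auto
      have d_max: "y \<le> d" if "y \<in> D \<inter> {a<..<x}" for y
        unfolding d_def using fin that by (rule Max_ge)
      have "card (D \<inter> {a<..<d}) < card (D \<inter> {a<..<x})"
        using d fin by (intro psubset_card_mono) auto
      then have "P d"
        using d less.prems by (intro less.hyps) auto
      moreover have "D \<inter> {d<..<x} = {}"
        using d d_max by fastforce
      ultimately show ?thesis
        using step[of d x] d less.prems by auto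
    qed
  qed
  then show ?thesis
    using ab by auto
qed

text \<open>The pieces of a step process are open on the left, so on \<open>{s<..t}\<close> the
  value at \<open>t\<close> is the representative; the value at \<open>s\<close> may belong to the
  preceding piece.\<close>

lemma simple_value_eq_right_endpoint:
  assumes "\<tau> ` {..n} \<inter> {s<..<t} = {}" "r \<in> {s<..t}"
  shows "simple_value n \<tau> \<xi> r \<omega> = simple_value n \<tau> \<xi> t \<omega>"
proof -
  have no_pt: "\<tau> i \<notin> {s<..<t}" if "i \<le> n" for i
    using assms(1) imageI[of i "{..n}" \<tau>] that by blast
  have "\<tau> i < r \<longleftrightarrow> \<tau> i < t" "r \<le> \<tau> (Suc i) \<longleftrightarrow> t \<le> \<tau> (Suc i)" if "i < n" for i
    using assms(2) no_pt[of i] no_pt[of "Suc i"] that by auto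
  then show ?thesis
    unfolding simple_value_def by (intro sum.cong) (auto simp: indicator_def)
qed

text \<open>As no breakpoint lies strictly between \<open>s\<close> and \<open>t\<close>, the
  interval lies after, inside or before each piece \<open>{\<tau> i<..\<tau> (Suc i)}\<close>, and
  only the piece containing it contributes.\<close>

lemma simple_integral_increment:
  assumes \<tau>: "strict_mono_on {..n} \<tau>" "\<tau> ` {..n} \<inter> {s<..<t} = {}" and st: "s < t"
  shows "simple_integral n \<tau> \<xi> B t \<omega> = simple_integral n \<tau> \<xi> B s \<omega> + simple_value n \<tau> \<xi> t \<omega> * (B t \<omega> - B s \<omega>)"
proof -
  have *: "\<xi> i \<omega> * (B (min t (\<tau> (Suc i))) \<omega> - B (min t (\<tau> i)) \<omega>) =
      \<xi> i \<omega> * (B (min s (\<tau> (Suc i))) \<omega> - B (min s (\<tau> i)) \<omega>) +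
      \<xi> i \<omega> * indicator {\<tau> i<..\<tau> (Suc i)} t * (B t \<omega> - B s \<omega>)" if "i < n" for i
  proof -
    have "\<tau> i < \<tau> (Suc i)"
      using that \<tau>(1) by (auto intro: strict_mono_onD)
    moreover have "\<tau> j \<notin> {s<..<t}" if "j \<le> n" for j
      using \<tau>(2) imageI[of j "{..n}" \<tau>] that by blast
    from this[of i] this[of "Suc i"] have "\<tau> i \<le> s \<or> t \<le> \<tau> i" "\<tau> (Suc i) \<le> s \<or> t \<le> \<tau> (Suc i)"
      using that by auto
    ultimately consider "\<tau> (Suc i) \<le> s" | "\<tau> i \<le> s" "t \<le> \<tau> (Suc i)" | "t \<le> \<tau> i"
      by linarith
    then show ?thesis
    proof cases
      case 1
      then show ?thesis using st \<open>\<tau> i < \<tau> (Suc i)\<close> by (simp add: indicator_def min_absorb2)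
    next
      case 2
      then show ?thesis using st \<open>\<tau> i < \<tau> (Suc i)\<close> by (simp add: indicator_def min_absorb1 min_absorb2 algebra_simps)
    next
      case 3
      then show ?thesis using st \<open>\<tau> i < \<tau> (Suc i)\<close> by (simp add: indicator_def min_absorb1)
    qed
  qed
  show ?thesis
    unfolding simple_integral_def simple_value_def sum_distrib_right sum.distrib[symmetric]
    by (intro sum.cong refl *) simp
qed

lemma simple_integral_0:
  assumes "\<And>i. i \<le> n \<Longrightarrow> 0 \<le> \<tau> i"
  shows "simple_integral n \<tau> \<xi> B 0 \<omega> = 0"
  unfolding simple_integral_def using assms by (intro sum.neutral) (auto simp: min_def order_antisym_conv)

text \<open>Predictability: a coefficient active at \<open>t\<close> has
  \<open>\<tau> i < t\<close>, and as no breakpoint lies strictly between, even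
  \<open>\<tau> i \<le> s\<close>. Hence the integrand on \<open>{s<..t}\<close> is known at time
  \<open>s\<close>, before the increment of \<open>B\<close>.\<close>

lemma simple_value_measurable_filtration:
  assumes \<xi>: "\<And>i. i < n \<Longrightarrow> \<xi> i \<in> borel_measurable (augmented_filtration M B (\<tau> i))"
    and \<tau>: "\<tau> ` {..n} \<inter> {s<..<t} = {}"
  shows "simple_value n \<tau> \<xi> t \<in> borel_measurable (augmented_filtration M B s)"
proof -
  have "(\<lambda>\<omega>. \<xi> i \<omega> * indicator {\<tau> i<..\<tau> (Suc i)} t) \<in> borel_measurable (augmented_filtration M B s)"
    if "i < n" for i
  proof (cases "\<tau> i < t")
    case True
    then have "\<tau> i \<le> s"
      using \<tau> imageI[of i "{..n}" \<tau>] that by fastforce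
    then have "\<xi> i \<in> borel_measurable (augmented_filtration M B s)"
      by (rule measurable_augmented_filtration_mono) (rule \<xi>[OF that])
    then show ?thesis by measurable
  qed (simp add: indicator_def)
  then show ?thesis
    unfolding simple_value_def[abs_def] by (intro borel_measurable_sum) auto
qed

lemma borel_measurable_simple_value [measurable]:
  "(\<lambda>t. simple_value n \<tau> \<xi> t \<omega>) \<in> borel_measurable borel"
  unfolding simple_value_def by measurable

lemma abs_simple_value_le:
  "\<bar>simple_value n \<tau> \<xi> t \<omega>\<bar> \<le> (\<Sum>i<n. \<bar>\<xi> i \<omega>\<bar>)"
  unfolding simple_value_def by (intro order_trans[OF sum_abs] sum_mono) (simp add: abs_mult indicator_def)

lemma set_integrable_bounded_borel:
  fixes g :: "real \<Rightarrow> 'b::{banach, second_countable_topology}"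
  assumes [measurable]: "g \<in> borel_measurable borel" and "\<And>r. norm (g r) \<le> c"
  shows "set_integrable lborel {a..b::real} g"
proof (rule set_integrable_bound[where f = "\<lambda>_. c"])
  show "set_integrable lborel {a..b} (\<lambda>_. c)"
    by (cases "a \<le> b") (auto simp: set_integrable_def)
  show "AE r in lborel. r \<in> {a..b} \<longrightarrow> norm (g r) \<le> norm c"
    using assms(2) order_trans[OF _ abs_ge_self] by auto
  show "set_borel_measurable lborel {a..b} g"
    unfolding set_borel_measurable_def by measurable
qed

text \<open>Between neighbouring breakpoints both integrands are constant, and \<open>Z\<close> is
  multiplied by the exponential of one Gaussian increment whose coefficient is known at the left
  endpoint. Each such factor preserves the mean, which is \<open>1\<close> at time
  \<open>0\<close>.\<close>

lemma (in prob_space) simple_stochastic_exponential: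
  fixes B :: "real \<Rightarrow> 'a \<Rightarrow> real" and l :: "nat \<Rightarrow> real"
  assumes B: "standard_brownian_motion M {0..} B" and T: "0 \<le> T"
    and \<xi>: "simple_integrand (augmented_filtration M B) T n \<tau> \<xi>"
    and \<sigma>: "\<sigma> ` {..N} \<subseteq> {0..T}" "strict_mono_on {..N} \<sigma>"
  defines "Z \<equiv> \<lambda>t \<omega>. exp (simple_integral n \<tau> \<xi> B t \<omega> + \<i> * simple_integral N \<sigma> (\<lambda>k _. l k) B t \<omega>
     - (CLBINT r:{0..t}. (simple_value n \<tau> \<xi> r \<omega> + \<i> * simple_value N \<sigma> (\<lambda>k _. l k) r \<omega>)\<^sup>2) / 2)"
  shows "integrable M (Z T)" "(\<integral>\<omega>. Z T \<omega> \<partial>M) = 1"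
proof -
  have \<tau>: "\<tau> ` {..n} \<subseteq> {0..T}" "strict_mono_on {..n} \<tau>"
    and \<xi>_meas: "\<And>i. i < n \<Longrightarrow> \<xi> i \<in> borel_measurable (augmented_filtration M B (\<tau> i))"
    using \<xi> by (auto simp: simple_integrand_def)
  define f where "f r = (\<Sum>k<N. l k * indicator {\<sigma> k<..\<sigma> (Suc k)} r)" for r :: real
  have f: "simple_value N \<sigma> (\<lambda>k _. l k) r \<omega> = f r" for r and \<omega> :: 'a
    by (simp add: simple_value_def f_def)
  define v where "v = simple_value n \<tau> \<xi>"
  define g where "g r \<omega> = (of_real (v r \<omega>) + \<i> * of_real (f r))\<^sup>2" for r \<omega>
  have B_meas: "B r \<in> borel_measurable M" if "0 \<le> r" for r
    using B that by (auto simp: standard_brownian_motion_def)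
  have [measurable]: "(\<lambda>r. v r \<omega>) \<in> borel_measurable borel" "f \<in> borel_measurable borel" for \<omega>
    unfolding v_def f_def by measurable
  have g_int: "set_integrable lborel {0..t} (\<lambda>r. g r \<omega>)" for t \<omega>
  proof (rule set_integrable_bounded_borel)
    show "(\<lambda>r. g r \<omega>) \<in> borel_measurable borel"
      unfolding g_def by measurable
    fix r
    have "norm (g r \<omega>) = (norm (of_real (v r \<omega>) + \<i> * of_real (f r)))\<^sup>2"
      by (simp add: g_def norm_power)
    also have "\<dots> \<le> (\<bar>v r \<omega>\<bar> + \<bar>f r\<bar>)\<^sup>2"
      by (intro power_mono order_trans[OF norm_triangle_ineq]) (auto simp: norm_mult)
    also have "\<dots> \<le> ((\<Sum>i<n. \<bar>\<xi> i \<omega>\<bar>) + (\<Sum>k<N. \<bar>l k\<bar>))\<^sup>2"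
      using abs_simple_value_le[of n \<tau> \<xi> r \<omega>] abs_simple_value_le[of N \<sigma> "\<lambda>k _. l k" r \<omega>]
      by (intro power_mono add_mono) (auto simp: v_def f)
    finally show "norm (g r \<omega>) \<le> ((\<Sum>i<n. \<bar>\<xi> i \<omega>\<bar>) + (\<Sum>k<N. \<bar>l k\<bar>))\<^sup>2" .
  qed
  have Z: "Z t \<omega> = exp (simple_integral n \<tau> \<xi> B t \<omega> + \<i> * simple_integral N \<sigma> (\<lambda>k _. l k) B t \<omega>
     - (CLBINT r:{0..t}. g r \<omega>) / 2)" for t \<omega>
    by (simp add: Z_def g_def v_def f)
  \<comment> \<open>Adaptedness and integrability are carried along with the mean: they are the
    premises under which the next Gaussian factor can be integrated out.\<close>
  define P where "P t \<longleftrightarrow> Z t \<in> borel_measurable (augmented_filtration M B t) \<and> integrable M (Z t) \<and> (\<integral>\<omega>. Z t \<omega> \<partial>M) = 1" for t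
  have "P T"
  proof (rule interval_chain_induct[where D = "\<tau> ` {..n} \<union> \<sigma> ` {..N}" and a = 0])
    have "Z 0 \<omega> = 1" for \<omega>
    proof -
      have "(CLBINT r:{0..0}. g r \<omega>) = 0"
      proof -
        have "AE r in lborel. indicat_real {0} r *\<^sub>R g r \<omega> = 0"
          using AE_lborel_singleton[of "0 :: real"] by eventually_elim (simp add: indicator_def)
        then show ?thesis
          unfolding set_lebesgue_integral_def by (simp add: integral_eq_zero_AE)
      qed
      then show ?thesis
        using \<tau>(1) \<sigma>(1) simple_integral_0[of n \<tau> \<xi> B \<omega>] simple_integral_0[of N \<sigma> "\<lambda>k _. l k" B \<omega>]
        unfolding Z by (simp add: image_subset_iff)
    qed
    then have "Z 0 = (\<lambda>_. 1)" by auto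
    then show "P 0"
      by (simp add: P_def prob_space)
    fix s t assume st: "0 \<le> s" "s < t" "t \<le> T" "(\<tau> ` {..n} \<union> \<sigma> ` {..N}) \<inter> {s<..<t} = {}" and Ps: "P s"
    then have \<tau>_st: "\<tau> ` {..n} \<inter> {s<..<t} = {}" and \<sigma>_st: "\<sigma> ` {..N} \<inter> {s<..<t} = {}"
      by auto
    define c where "c \<omega> = complex_of_real (v t \<omega>) + \<i> * complex_of_real (f t)" for \<omega>
    \<comment> \<open>\<open>c\<close> is the common value of the complex integrand on
      \<open>{s<..t}\<close>, so the quadratic term grows by the square of \<open>c\<close> times
      the length.\<close>
    have Q: "(CLBINT r:{0..t}. g r \<omega>) = (CLBINT r:{0..s}. g r \<omega>) + (c \<omega>)\<^sup>2 * (t - s)" for \<omega>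
    proof -
      have "(CLBINT r:{s<..t}. g r \<omega>) = (CLBINT r:{s<..t}. (c \<omega>)\<^sup>2)"
      proof (intro set_lebesgue_integral_cong allI impI)
        fix r assume "r \<in> {s<..t}"
        then have "v r \<omega> = v t \<omega>" "f r = f t"
          using simple_value_eq_right_endpoint[OF \<tau>_st, of r \<xi> \<omega>]
            simple_value_eq_right_endpoint[OF \<sigma>_st, of r "\<lambda>k _. l k" \<omega>]
          by (simp_all add: v_def f)
        then show "g r \<omega> = (c \<omega>)\<^sup>2"
          by (simp add: g_def c_def)
      qed simp
      also have "\<dots> = (c \<omega>)\<^sup>2 * (t - s)"
        using st by (simp add: set_lebesgue_integral_def scaleR_conv_of_real)
      moreover have "{0..t} = {0..s} \<union> {s<..t}"
        using st by auto
      moreover have "(CLBINT r:{0..s} \<union> {s<..t}. g r \<omega>) = (CLBINT r:{0..s}. g r \<omega>) + (CLBINT r:{s<..t}. g r \<omega>)"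
        using st by (intro set_integral_Un set_integrable_subset[OF g_int[of t]]) auto
      ultimately show ?thesis by metis
    qed
    have step: "Z t \<omega> = Z s \<omega> * exp (c \<omega> * (B t \<omega> - B s \<omega>) - (c \<omega>)\<^sup>2 * (t - s) / 2)" for \<omega>
      unfolding Z simple_integral_increment[OF \<tau>(2) \<tau>_st \<open>s < t\<close>] simple_integral_increment[OF \<sigma>(2) \<sigma>_st \<open>s < t\<close>] Q
        exp_add[symmetric] f
      by (rule arg_cong[where f = exp]) (simp add: c_def v_def field_simps)
    have Y: "distributed M lborel (\<lambda>\<omega>. B t \<omega> - B s \<omega>) (\<lambda>y. ennreal (normal_density 0 (sqrt (t - s)) y))"
      using B st by (auto simp: standard_brownian_motion_def)
    have sub: "subalgebra M (augmented_filtration M B s)"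
      using B_meas by (intro subalgebra_augmented_filtration) auto
    have v: "v t \<in> borel_measurable (augmented_filtration M B s)"
      unfolding v_def by (rule simple_value_measurable_filtration[OF \<xi>_meas \<tau>_st])
    have Zs: "Z s \<in> borel_measurable (augmented_filtration M B s)" "integrable M (Z s)" "(\<integral>\<omega>. Z s \<omega> \<partial>M) = 1"
      using Ps by (auto simp: P_def)
    have "0 < t - s" using st by simp
    note incr = integral_exponential_gaussian_increment[OF sub Zs(1) v brownian_increment_indep_filtration[OF B st(1,2)] Y this Zs(2), of "f t", folded c_def]
    have [measurable]: "Z s \<in> borel_measurable (augmented_filtration M B t)" "v t \<in> borel_measurable (augmented_filtration M B t)"
      "B s \<in> borel_measurable (augmented_filtration M B t)" "B t \<in> borel_measurable (augmented_filtration M B t)"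
      using Zs(1) v st by (auto intro: measurable_augmented_filtration_mono[of s t] adapted_augmented_filtration)
    show "P t"
    proof -
      have Zt: "Z t = (\<lambda>\<omega>. Z s \<omega> * exp (c \<omega> * (B t \<omega> - B s \<omega>) - (c \<omega>)\<^sup>2 * (t - s) / 2))"
        by (rule ext) (rule step)
      have "Z t \<in> borel_measurable (augmented_filtration M B t)"
        unfolding Zt c_def by measurable
      moreover have "integrable M (Z t)"
        unfolding Zt by (rule incr(1))
      moreover have "(\<integral>\<omega>. Z t \<omega> \<partial>M) = 1"
        unfolding Zt by (rule trans[OF incr(2) Zs(3)])
      ultimately show ?thesis
        unfolding P_def by blast
    qed
  qed (use T in auto)
  then show "integrable M (Z T)" "(\<integral>\<omega>. Z T \<omega> \<partial>M) = 1"
    by (auto simp: P_def)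
qed

section \<open>Passage to the limit\<close>

text \<open>Young's inequality with a weight: a small \<epsilon> controls the term with
  \<open>g\<close>, and for this fixed \<epsilon> the term divided by it vanishes as
  \<open>k\<close> grows.\<close>

lemma integral_mult_tendsto_0_L2:
  fixes g :: "'a \<Rightarrow> real" and d :: "nat \<Rightarrow> 'a \<Rightarrow> real"
  assumes g: "g \<in> borel_measurable M" "integrable M (\<lambda>x. (g x)\<^sup>2)"
    and d: "\<And>k. d k \<in> borel_measurable M" "\<And>k. integrable M (\<lambda>x. (d k x)\<^sup>2)"
    and lim: "(\<lambda>k. \<integral>x. (d k x)\<^sup>2 \<partial>M) \<longlonglongrightarrow> 0"
  shows "(\<lambda>k. \<integral>x. g x * d k x \<partial>M) \<longlonglongrightarrow> 0"
proof -
  note [measurable] = g(1) d(1)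
  have young: "\<bar>g x * d k x\<bar> \<le> \<epsilon> * (g x)\<^sup>2 + (d k x)\<^sup>2 / \<epsilon>" if "\<epsilon> > 0" for x k \<epsilon>
  proof -
    have "0 \<le> (\<epsilon> * \<bar>g x\<bar> - \<bar>d k x\<bar>)\<^sup>2 + \<epsilon> * \<bar>g x\<bar> * \<bar>d k x\<bar>"
      using that by simp
    then have "\<epsilon> * (\<bar>g x\<bar> * \<bar>d k x\<bar>) \<le> \<epsilon> * (\<epsilon> * (g x)\<^sup>2 + (d k x)\<^sup>2 / \<epsilon>)"
      using that by (simp add: power2_eq_square algebra_simps)
    then show ?thesis
      using that by (simp add: abs_mult)
  qed
  have int: "integrable M (\<lambda>x. g x * d k x)" for k
    by (rule Bochner_Integration.integrable_bound[OF Bochner_Integration.integrable_add[OF g(2) d(2)[of k]]])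
       (use young[of 1] in auto)
  have bound: "\<bar>\<integral>x. g x * d k x \<partial>M\<bar> \<le> \<epsilon> * (\<integral>x. (g x)\<^sup>2 \<partial>M) + (\<integral>x. (d k x)\<^sup>2 \<partial>M) / \<epsilon>" if "\<epsilon> > 0" for k \<epsilon>
  proof -
    have "\<bar>\<integral>x. g x * d k x \<partial>M\<bar> \<le> (\<integral>x. \<bar>g x * d k x\<bar> \<partial>M)"
      by (rule integral_abs_bound)
    also have "\<dots> \<le> (\<integral>x. \<epsilon> * (g x)\<^sup>2 + (d k x)\<^sup>2 / \<epsilon> \<partial>M)"
      using int[of k] g(2) d(2)[of k] young[OF that] by (intro integral_mono) auto
    also have "\<dots> = \<epsilon> * (\<integral>x. (g x)\<^sup>2 \<partial>M) + (\<integral>x. (d k x)\<^sup>2 \<partial>M) / \<epsilon>"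
      using g(2) d(2)[of k] by simp
    finally show ?thesis .
  qed
  show "(\<lambda>k. \<integral>x. g x * d k x \<partial>M) \<longlonglongrightarrow> 0"
  proof (rule tendstoI)
    fix e :: real assume e: "e > 0"
    define G where "G = (\<integral>x. (g x)\<^sup>2 \<partial>M)"
    have G: "G \<ge> 0" by (simp add: G_def)
    \<comment> \<open>The \<open>+ 1\<close> keeps the denominator positive when
      \<open>G = 0\<close> and makes \<open>\<epsilon> * G < e / 2\<close> strict.\<close>
    define \<epsilon> where "\<epsilon> = e / (2 * (G + 1))"
    have \<epsilon>: "\<epsilon> > 0" using e G by (simp add: \<epsilon>_def)
    have "\<epsilon> * G < e / 2"
      using e G by (simp add: \<epsilon>_def field_simps)
    moreover have "\<forall>\<^sub>F k in sequentially. (\<integral>x. (d k x)\<^sup>2 \<partial>M) < e / 2 * \<epsilon>"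
      using lim e \<epsilon> by (intro order_tendstoD) auto
    then have "\<forall>\<^sub>F k in sequentially. (\<integral>x. (d k x)\<^sup>2 \<partial>M) / \<epsilon> < e / 2"
      by eventually_elim (use \<epsilon> in \<open>simp add: field_simps\<close>)
    ultimately show "\<forall>\<^sub>F k in sequentially. dist (\<integral>x. g x * d k x \<partial>M) 0 < e"
    proof (elim eventually_mono)
      fix k assume "(\<integral>x. (d k x)\<^sup>2 \<partial>M) / \<epsilon> < e / 2" "\<epsilon> * G < e / 2"
      with bound[OF \<epsilon>, of k, folded G_def] show "dist (\<integral>x. g x * d k x \<partial>M) 0 < e"
        unfolding dist_real_def by linarith
    qed
  qed
qed

text \<open>The second limit follows from the first with \<open>g = f\<close>, since
  \<open>(a - f)^2 = a^2 - 2 f a + f^2\<close>. Both are used path by path in the exponent: the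
  first for the cross term of the complex exponential, the second for its quadratic term.\<close>

lemma integral_tendsto_L2:
  fixes f g :: "'a \<Rightarrow> real" and a :: "nat \<Rightarrow> 'a \<Rightarrow> real"
  assumes g: "g \<in> borel_measurable M" "integrable M (\<lambda>x. (g x)\<^sup>2)"
    and f: "f \<in> borel_measurable M" "integrable M (\<lambda>x. (f x)\<^sup>2)"
    and a: "\<And>k. a k \<in> borel_measurable M" "\<And>k. integrable M (\<lambda>x. (a k x)\<^sup>2)"
    and lim: "(\<lambda>k. \<integral>x. (a k x - f x)\<^sup>2 \<partial>M) \<longlonglongrightarrow> 0"
  shows "(\<lambda>k. \<integral>x. g x * a k x \<partial>M) \<longlonglongrightarrow> (\<integral>x. g x * f x \<partial>M)"
    and "(\<lambda>k. \<integral>x. (a k x)\<^sup>2 \<partial>M) \<longlonglongrightarrow> (\<integral>x. (f x)\<^sup>2 \<partial>M)"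
proof -
  note [measurable] = g(1) f(1) a(1)
  have prod: "integrable M (\<lambda>x. p x * q x)"
    if "p \<in> borel_measurable M" "integrable M (\<lambda>x. (p x)\<^sup>2)" "q \<in> borel_measurable M" "integrable M (\<lambda>x. (q x)\<^sup>2)"
    for p q :: "'a \<Rightarrow> real"
  proof (rule Bochner_Integration.integrable_bound[OF Bochner_Integration.integrable_add[OF that(2,4)]])
    show "AE x in M. norm (p x * q x) \<le> norm ((p x)\<^sup>2 + (q x)\<^sup>2)"
    proof (rule AE_I2)
      fix x
      have "0 \<le> (\<bar>p x\<bar> - \<bar>q x\<bar>)\<^sup>2 + \<bar>p x\<bar> * \<bar>q x\<bar>" by simp
      then show "norm (p x * q x) \<le> norm ((p x)\<^sup>2 + (q x)\<^sup>2)"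
        by (simp add: power2_eq_square abs_mult algebra_simps)
    qed
  qed (use that in measurable)
  have sq: "(a k x - f x)\<^sup>2 = (a k x)\<^sup>2 - 2 * (f x * a k x) + (f x)\<^sup>2" for k x
    by (simp add: power2_eq_square algebra_simps)
  have d: "integrable M (\<lambda>x. (a k x - f x)\<^sup>2)" for k
    unfolding sq using prod[OF f a] f a by simp
  have *: "(\<lambda>k. (\<integral>x. h x * (a k x - f x) \<partial>M) + (\<integral>x. h x * f x \<partial>M)) \<longlonglongrightarrow> 0 + (\<integral>x. h x * f x \<partial>M)"
    if "h \<in> borel_measurable M" "integrable M (\<lambda>x. (h x)\<^sup>2)" for h
    by (intro tendsto_add tendsto_const integral_mult_tendsto_0_L2[OF that]) (use d lim in auto)
  moreover have "(\<integral>x. h x * (a k x - f x) \<partial>M) + (\<integral>x. h x * f x \<partial>M) = (\<integral>x. h x * a k x \<partial>M)"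
    if "h \<in> borel_measurable M" "integrable M (\<lambda>x. (h x)\<^sup>2)" for h k
    using prod[OF that f] prod[OF that a] by (simp add: right_diff_distrib)
  ultimately have lim1: "(\<lambda>k. \<integral>x. h x * a k x \<partial>M) \<longlonglongrightarrow> (\<integral>x. h x * f x \<partial>M)"
    if "h \<in> borel_measurable M" "integrable M (\<lambda>x. (h x)\<^sup>2)" for h
    using that by simp
  then show "(\<lambda>k. \<integral>x. g x * a k x \<partial>M) \<longlonglongrightarrow> (\<integral>x. g x * f x \<partial>M)"
    using g by blast
  have "(\<lambda>k. (\<integral>x. (a k x - f x)\<^sup>2 \<partial>M) + 2 * (\<integral>x. f x * a k x \<partial>M) - (\<integral>x. (f x)\<^sup>2 \<partial>M)) \<longlonglongrightarrow>
      0 + 2 * (\<integral>x. f x * f x \<partial>M) - (\<integral>x. (f x)\<^sup>2 \<partial>M)"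
    using f by (intro tendsto_intros lim lim1)
  moreover have "(\<integral>x. (a k x - f x)\<^sup>2 \<partial>M) + 2 * (\<integral>x. f x * a k x \<partial>M) - (\<integral>x. (f x)\<^sup>2 \<partial>M) = (\<integral>x. (a k x)\<^sup>2 \<partial>M)" for k
    unfolding sq using prod[OF f a, of k] f a by simp
  ultimately show "(\<lambda>k. \<integral>x. (a k x)\<^sup>2 \<partial>M) \<longlonglongrightarrow> (\<integral>x. (f x)\<^sup>2 \<partial>M)"
    by (simp add: power2_eq_square)
qed

text \<open>Truncating the distance at \<open>1\<close> turns convergence in probability into
  convergence in mean, which yields an almost surely convergent subsequence. The truncated distance
  tends to \<open>0\<close> along it, so eventually the truncation is inactive.\<close>

lemma (in prob_space) tendsto_in_prob_AE_subseq:
  assumes X[measurable]: "\<And>k. X k \<in> borel_measurable M" and Y[measurable]: "Y \<in> borel_measurable M"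
    and lim: "tendsto_in_prob M X Y"
  shows "\<exists>r :: nat \<Rightarrow> nat. strict_mono r \<and> (AE \<omega> in M. (\<lambda>k. X (r k) \<omega>) \<longlonglongrightarrow> Y \<omega>)"
proof -
  define u where "u k \<omega> = min \<bar>X k \<omega> - Y \<omega>\<bar> 1" for k \<omega>
  have [measurable]: "u k \<in> borel_measurable M" for k
    unfolding u_def by measurable
  have u: "0 \<le> u k \<omega>" "u k \<omega> \<le> 1" for k \<omega>
    by (auto simp: u_def)
  have int_u: "integrable M (u k)" for k
    using u by (intro integrable_const_bound[where B = 1]) auto
  have bound: "expectation (u k) \<le> \<epsilon> + prob {\<omega>\<in>space M. \<bar>X k \<omega> - Y \<omega>\<bar> > \<epsilon>}" if "\<epsilon> > 0" for k \<epsilon>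
  proof -
    let ?S = "{\<omega>\<in>space M. \<bar>X k \<omega> - Y \<omega>\<bar> > \<epsilon>}"
    have S: "?S \<in> sets M" by measurable
    then have int_S: "integrable M (indicator ?S :: _ \<Rightarrow> real)"
      by (intro integrable_real_indicator) (auto simp: emeasure_eq_measure)
    have "expectation (u k) \<le> expectation (\<lambda>\<omega>. \<epsilon> + indicator ?S \<omega>)"
    proof (intro integral_mono Bochner_Integration.integrable_add)
      show "u k \<omega> \<le> \<epsilon> + indicator ?S \<omega>" if "\<omega> \<in> space M" for \<omega>
        using that \<open>\<epsilon> > 0\<close> by (auto simp: u_def indicator_def)
    qed (use int_u int_S in auto)
    also have "\<dots> = \<epsilon> + prob ?S"
      using S int_S by (subst Bochner_Integration.integral_add) (auto simp: prob_space Int_absorb2)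
    finally show ?thesis .
  qed
  have "(\<lambda>k. \<integral>\<omega>. norm (u k \<omega>) \<partial>M) \<longlonglongrightarrow> 0"
  proof (rule tendstoI)
    fix e :: real assume e: "e > 0"
    have "(\<lambda>k. prob {\<omega>\<in>space M. \<bar>X k \<omega> - Y \<omega>\<bar> > e / 2}) \<longlonglongrightarrow> 0"
      using lim half_gt_zero[OF e] unfolding tendsto_in_prob_def by blast
    then have "\<forall>\<^sub>F k in sequentially. prob {\<omega>\<in>space M. \<bar>X k \<omega> - Y \<omega>\<bar> > e / 2} < e / 2"
      using e by (intro order_tendstoD) auto
    then show "\<forall>\<^sub>F k in sequentially. dist (\<integral>\<omega>. norm (u k \<omega>) \<partial>M) 0 < e"
    proof eventually_elim
      case (elim k)
      then show ?case
        using bound[of "e / 2" k] e u by (simp add: dist_real_def)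
    qed
  qed
  then obtain r where r: "strict_mono r" "AE \<omega> in M. (\<lambda>k. u (r k) \<omega>) \<longlonglongrightarrow> 0"
    using tendsto_L1_AE_subseq[of M u, OF int_u] by blast
  from r(2) have "AE \<omega> in M. (\<lambda>k. X (r k) \<omega>) \<longlonglongrightarrow> Y \<omega>"
  proof eventually_elim
    case (elim \<omega>)
    have "\<forall>\<^sub>F k in sequentially. u (r k) \<omega> < 1"
      using elim by (rule order_tendstoD) simp
    then have "\<forall>\<^sub>F k in sequentially. u (r k) \<omega> = \<bar>X (r k) \<omega> - Y \<omega>\<bar>"
      by eventually_elim (auto simp: u_def min_def split: if_splits)
    then have "(\<lambda>k. \<bar>X (r k) \<omega> - Y \<omega>\<bar>) \<longlonglongrightarrow> 0"
      using elim by (simp add: tendsto_cong)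
    then show ?case
      by (simp add: tendsto_rabs_zero_iff LIM_zero_iff)
  qed
  with r(1) show ?thesis by blast
qed

lemma tendsto_in_prob_subseq:
  "tendsto_in_prob M X Y \<Longrightarrow> strict_mono r \<Longrightarrow> tendsto_in_prob M (\<lambda>k. X (r k)) Y"
  unfolding tendsto_in_prob_def
  using LIMSEQ_subseq_LIMSEQ[of "\<lambda>k. measure M {\<omega>\<in>space M. \<bar>X k \<omega> - Y \<omega>\<bar> > \<epsilon>}" 0 r for \<epsilon>]
  by (simp add: comp_def)

text \<open>\<open>E' k * U' k\<close> is split into \<open>(E' k - E) * U' k\<close> and
  \<open>E * U' k\<close>. The first part vanishes in mean by Scheffe's lemma and the uniform bound
  on \<open>U'\<close>; the second converges by domination with \<open>c * E\<close>.\<close>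

lemma (in prob_space) expectation_mult_eq_limit_Scheffe:
  fixes E :: "'a \<Rightarrow> real" and U :: "'a \<Rightarrow> complex"
  assumes Ek: "\<And>k. integrable M (E' k)" "\<And>k \<omega>. 0 \<le> E' k \<omega>" "\<And>k. expectation (E' k) = 1"
    and E: "integrable M E" "\<And>\<omega>. 0 \<le> E \<omega>" "expectation E = 1"
    and limE: "AE \<omega> in M. (\<lambda>k. E' k \<omega>) \<longlonglongrightarrow> E \<omega>"
    and U[measurable]: "\<And>k. U' k \<in> borel_measurable M" "U \<in> borel_measurable M"
    and Uc: "\<And>k \<omega>. norm (U' k \<omega>) \<le> c"
    and limU: "AE \<omega> in M. (\<lambda>k. U' k \<omega>) \<longlonglongrightarrow> U \<omega>"
    and eq: "\<And>k. (\<integral>\<omega>. E' k \<omega> * U' k \<omega> \<partial>M) = z"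
  shows "(\<integral>\<omega>. E \<omega> * U \<omega> \<partial>M) = z"
proof -
  have [measurable]: "E' k \<in> borel_measurable M" "E \<in> borel_measurable M" for k
    using Ek(1) E(1) by auto
  have c: "0 \<le> c" using Uc norm_ge_zero order_trans by blast
  have "(\<lambda>k. \<integral>\<^sup>+\<omega>. norm (E' k \<omega> - E \<omega>) \<partial>M) \<longlonglongrightarrow> 0"
  proof (rule Scheffe_lemma2)
    show "(\<integral>\<^sup>+\<omega>. norm (E' k \<omega>) \<partial>M) \<le> (\<integral>\<^sup>+\<omega>. norm (E \<omega>) \<partial>M)" for k
      using Ek E by (simp add: nn_integral_eq_integral)
  qed (use limE E in auto)
  then have "(\<lambda>k. ennreal (\<integral>\<omega>. norm (E' k \<omega> - E \<omega>) \<partial>M)) \<longlonglongrightarrow> ennreal 0"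
    using Ek(1) E(1) by (simp add: nn_integral_eq_integral)
  then have L1: "(\<lambda>k. \<integral>\<omega>. norm (E' k \<omega> - E \<omega>) \<partial>M) \<longlonglongrightarrow> 0"
    by (subst (asm) tendsto_ennreal_iff) auto
  have int1: "integrable M (\<lambda>\<omega>. (E' k \<omega> - E \<omega>) * U' k \<omega>)" for k
  proof (rule Bochner_Integration.integrable_bound)
    show "integrable M (\<lambda>\<omega>. c * norm (E' k \<omega> - E \<omega>))"
      using Ek(1) E(1) by auto
    show "AE \<omega> in M. norm ((E' k \<omega> - E \<omega>) * U' k \<omega>) \<le> norm (c * norm (E' k \<omega> - E \<omega>))"
      using Uc c by (auto simp: norm_mult abs_mult mult.commute[of c] intro!: mult_left_mono simp flip: of_real_diff)
  qed measurable
  have int2: "integrable M (\<lambda>\<omega>. E \<omega> * U' k \<omega>)" for k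
  proof (rule Bochner_Integration.integrable_bound)
    show "integrable M (\<lambda>\<omega>. c * E \<omega>)"
      using E(1) by auto
    show "AE \<omega> in M. norm (E \<omega> * U' k \<omega>) \<le> norm (c * E \<omega>)"
      using Uc c E(2) by (auto simp: norm_mult abs_mult mult.commute[of c] intro!: mult_left_mono)
  qed measurable
  have "(\<lambda>k. \<integral>\<omega>. (E' k \<omega> - E \<omega>) * U' k \<omega> \<partial>M) \<longlonglongrightarrow> 0"
  proof (rule Lim_null_comparison)
    show "(\<lambda>k. c * (\<integral>\<omega>. norm (E' k \<omega> - E \<omega>) \<partial>M)) \<longlonglongrightarrow> 0"
      using tendsto_mult_left[OF L1, of c] by simp
    have "norm (\<integral>\<omega>. (E' k \<omega> - E \<omega>) * U' k \<omega> \<partial>M) \<le> (\<integral>\<omega>. c * norm (E' k \<omega> - E \<omega>) \<partial>M)" for k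
    proof (rule order_trans[OF integral_norm_bound integral_mono])
      fix \<omega>
      show "norm ((E' k \<omega> - E \<omega>) * U' k \<omega>) \<le> c * norm (E' k \<omega> - E \<omega>)"
        using Uc c by (auto simp: norm_mult mult.commute[of c] intro!: mult_left_mono simp flip: of_real_diff)
    qed (use int1 Ek(1) E(1) in auto)
    then show "\<forall>\<^sub>F k in sequentially. norm (\<integral>\<omega>. (E' k \<omega> - E \<omega>) * U' k \<omega> \<partial>M) \<le> c * (\<integral>\<omega>. norm (E' k \<omega> - E \<omega>) \<partial>M)"
      by simp
  qed
  moreover have "(\<lambda>k. \<integral>\<omega>. E \<omega> * U' k \<omega> \<partial>M) \<longlonglongrightarrow> (\<integral>\<omega>. E \<omega> * U \<omega> \<partial>M)"
  proof (rule integral_dominated_convergence[where w = "\<lambda>\<omega>. c * E \<omega>"])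
    show "AE \<omega> in M. (\<lambda>k. complex_of_real (E \<omega>) * U' k \<omega>) \<longlonglongrightarrow> complex_of_real (E \<omega>) * U \<omega>"
      using limU by eventually_elim (intro tendsto_intros)
    show "AE \<omega> in M. norm (complex_of_real (E \<omega>) * U' k \<omega>) \<le> c * E \<omega>" for k
      using Uc E(2) by (auto simp: norm_mult mult.commute[of c] intro!: mult_left_mono)
  qed (use E(1) in auto)
  ultimately have "(\<lambda>k. (\<integral>\<omega>. (E' k \<omega> - E \<omega>) * U' k \<omega> \<partial>M) + (\<integral>\<omega>. E \<omega> * U' k \<omega> \<partial>M)) \<longlonglongrightarrow> 0 + (\<integral>\<omega>. E \<omega> * U \<omega> \<partial>M)"
    by (rule tendsto_add)
  moreover have "(\<integral>\<omega>. (E' k \<omega> - E \<omega>) * U' k \<omega> \<partial>M) + (\<integral>\<omega>. E \<omega> * U' k \<omega> \<partial>M) = z" for k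
    unfolding eq[of k, symmetric] by (subst Bochner_Integration.integral_add[symmetric, OF int1 int2]) (simp add: algebra_simps)
  ultimately show ?thesis
    using LIMSEQ_unique[OF _ tendsto_const[of z]] by simp
qed

lemma set_integral_eq_restrict_space:
  fixes g :: "real \<Rightarrow> 'b::{banach, second_countable_topology}"
  assumes "A \<in> sets borel"
  shows "(LINT s:A|lborel. g s) = (\<integral>s. g s \<partial>restrict_space lborel A)"
  using assms by (simp add: set_lebesgue_integral_def integral_restrict_space)

lemma set_integral_initial_eq_restrict_space:
  fixes g :: "real \<Rightarrow> real"
  assumes "t \<le> T"
  shows "(LBINT s:{0..t}. g s) = (\<integral>s. indicator {0..t} s * g s \<partial>restrict_space lborel {0..T})"
  using assms unfolding set_lebesgue_integral_def
  by (subst integral_restrict_space) (auto simp: indicator_def intro!: Bochner_Integration.integral_cong)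

lemma finite_measure_restrict_lborel: "finite_measure (restrict_space lborel {0..T::real})"
  by (rule finite_measureI) (simp add: emeasure_restrict_space space_restrict_space emeasure_lborel_Icc_eq)

text \<open>The half-open intervals are disjoint, so all mixed products in the square
  vanish.\<close>

lemma step_function_sq:
  fixes \<sigma> :: "nat \<Rightarrow> real"
  assumes "strict_mono_on {..N} \<sigma>"
  shows "(\<Sum>k<N. l k * indicator {\<sigma> k<..\<sigma> (Suc k)} s)\<^sup>2 = (\<Sum>k<N. (l k)\<^sup>2 * indicator {\<sigma> k<..\<sigma> (Suc k)} s :: real)"
proof (cases "\<exists>k<N. s \<in> {\<sigma> k<..\<sigma> (Suc k)}")
  case True
  then obtain k where k: "k < N" "s \<in> {\<sigma> k<..\<sigma> (Suc k)}" by blast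
  have mono: "\<sigma> i \<le> \<sigma> j" if "i \<le> j" "j \<le> N" for i j
    using strict_mono_onD[OF assms, of i j] that by (cases "i = j") auto
  have "s \<notin> {\<sigma> j<..\<sigma> (Suc j)}" if "j < N" "j \<noteq> k" for j
  proof (cases "j < k")
    case True
    then show ?thesis using mono[of "Suc j" k] k by auto
  next
    case False
    then show ?thesis using mono[of "Suc k" j] k that by auto
  qed
  then have "(\<Sum>j<N. a j * indicator {\<sigma> j<..\<sigma> (Suc j)} s) = (\<Sum>j<N. if j = k then a j else 0)" for a :: "nat \<Rightarrow> real"
    using k by (intro sum.cong) auto
  then show ?thesis
    using k by simp
next
  case False
  then have "(\<Sum>j<N. a j * indicator {\<sigma> j<..\<sigma> (Suc j)} s) = 0" for a :: "nat \<Rightarrow> real"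
    by (intro sum.neutral) auto
  then show ?thesis by simp
qed

lemma strict_mono_partition_step:
  assumes "\<sigma> ` {..N} \<subseteq> {0..T::real}" "strict_mono_on {..N} \<sigma>" "k < N"
  shows "0 \<le> \<sigma> k" "\<sigma> k < \<sigma> (Suc k)" "\<sigma> (Suc k) \<le> T"
  using assms by (auto simp: image_subset_iff intro: strict_mono_onD)

lemma ito_integrand_measurable_swap:
  assumes "ito_integrand M T F \<theta>"
  shows "(\<lambda>(\<omega>, s). \<theta> s \<omega>) \<in> borel_measurable (M \<Otimes>\<^sub>M restrict_space lborel {0..T})"
proof -
  have "(\<lambda>(s, \<omega>). \<theta> s \<omega>) \<in> borel_measurable (restrict_space borel {0..T} \<Otimes>\<^sub>M M)"
    using assms by (simp add: ito_integrand_def)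
  moreover have "sets (restrict_space borel {0..T}) = sets (restrict_space lborel {0..T})"
    by (intro sets_restrict_space_cong) simp
  ultimately have "(\<lambda>(s, \<omega>). \<theta> s \<omega>) \<in> borel_measurable (restrict_space lborel {0..T} \<Otimes>\<^sub>M M)"
    by (simp cong: measurable_cong_sets sets_pair_measure_cong)
  from measurable_compose[OF measurable_pair_swap' this] show ?thesis
    by (simp add: case_prod_beta comp_def)
qed

lemma ito_integrand_AE:
  assumes "ito_integrand M T F \<theta>"
  shows "AE \<omega> in M. (\<lambda>s. \<theta> s \<omega>) \<in> borel_measurable (restrict_space lborel {0..T}) \<and>
    integrable (restrict_space lborel {0..T}) (\<lambda>s. (\<theta> s \<omega>)\<^sup>2) \<and>
    integrable (restrict_space lborel {0..T}) (\<lambda>s. \<theta> s \<omega>)"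
proof -
  have "AE \<omega> in M. (\<integral>\<^sup>+s\<in>{0..T}. ennreal ((\<theta> s \<omega>)\<^sup>2) \<partial>lborel) < \<infinity>"
    using assms by (simp add: ito_integrand_def)
  then show ?thesis
    using AE_space
  proof eventually_elim
    case (elim \<omega>)
    interpret finite_measure "restrict_space lborel {0..T}"
      by (rule finite_measure_restrict_lborel)
    have [measurable]: "(\<lambda>s. \<theta> s \<omega>) \<in> borel_measurable (restrict_space lborel {0..T})"
      using measurable_compose[OF measurable_Pair1'[OF elim(2)] ito_integrand_measurable_swap[OF assms]] by simp
    have sq: "integrable (restrict_space lborel {0..T}) (\<lambda>s. (\<theta> s \<omega>)\<^sup>2)"
      using elim(1) by (intro integrableI_nonneg) (auto simp: nn_integral_restrict_space)
    have "integrable (restrict_space lborel {0..T}) (\<lambda>s. \<theta> s \<omega>)"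
    proof (rule Bochner_Integration.integrable_bound)
      show "integrable (restrict_space lborel {0..T}) (\<lambda>s. 1 + (\<theta> s \<omega>)\<^sup>2)"
        using sq by auto
      \<comment> \<open>From \<open>(\<bar>x\<bar> - 1 / 2)^2 \<ge> 0\<close>; the constant
        \<open>1\<close> in the dominating function is integrable because \<open>{0..T}\<close> has
        finite measure.\<close>
      have "\<bar>x\<bar> \<le> 1 + x\<^sup>2" for x :: real
        using power2_less_eq_zero_iff[of "\<bar>x\<bar> - 1"] zero_le_power2[of "\<bar>x\<bar> - 1 / 2"] by (simp add: power2_eq_square algebra_simps)
      then show "AE s in restrict_space lborel {0..T}. norm (\<theta> s \<omega>) \<le> norm (1 + (\<theta> s \<omega>)\<^sup>2)"
        by simp
    qed simp
    with sq show ?case by simp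
  qed
qed

lemma borel_measurable_parametric_integral:
  fixes h :: "'a \<Rightarrow> real \<Rightarrow> 'b::{banach, second_countable_topology}"
  assumes "(\<lambda>(\<omega>, s). h \<omega> s) \<in> borel_measurable (M \<Otimes>\<^sub>M restrict_space lborel {0..T})"
  shows "(\<lambda>\<omega>. \<integral>s. h \<omega> s \<partial>restrict_space lborel {0..T}) \<in> borel_measurable M"
proof -
  interpret finite_measure "restrict_space lborel {0..T}"
    by (rule finite_measure_restrict_lborel)
  show ?thesis
    using assms by (intro borel_measurable_lebesgue_integral) simp
qed

lemma borel_measurable_restrict_lborel_Pair2:
  assumes "g \<in> borel_measurable borel"
  shows "(\<lambda>x. g (snd x)) \<in> borel_measurable (M \<Otimes>\<^sub>M restrict_space lborel {0..T})"
  using assms by (intro measurable_compose[OF measurable_snd measurable_restrict_space1]) simp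

lemma simple_value_measurable_pair:
  assumes "\<And>i. i < n \<Longrightarrow> \<xi> i \<in> borel_measurable M"
  shows "(\<lambda>(\<omega>, s). simple_value n \<tau> \<xi> s \<omega>) \<in> borel_measurable (M \<Otimes>\<^sub>M restrict_space lborel {0..T})"
  unfolding simple_value_def case_prod_beta
  by (intro borel_measurable_sum borel_measurable_times measurable_compose[OF measurable_fst assms]
      borel_measurable_restrict_lborel_Pair2) auto

text \<open>Both convergences are given in probability, so a subsequence is extracted for the
  integrands and from it a further one for the integrals; the first almost sure limit survives the
  second selection.\<close>

lemma (in prob_space) ito_integral_AE_approximation:
  assumes B: "standard_brownian_motion M {0..} B" and T: "0 \<le> T" and ito: "is_ito_integral M T B \<theta> J"
  obtains n \<tau> \<xi> where
    "\<And>k. simple_integrand (augmented_filtration M B) T (n k) (\<tau> k) (\<xi> k)"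
    "AE \<omega> in M. (\<lambda>k. LBINT s:{0..T}. (simple_value (n k) (\<tau> k) (\<xi> k) s \<omega> - \<theta> s \<omega>)\<^sup>2) \<longlonglongrightarrow> 0"
    "AE \<omega> in M. (\<lambda>k. simple_integral (n k) (\<tau> k) (\<xi> k) B T \<omega>) \<longlonglongrightarrow> J T \<omega>"
proof -
  have B_meas: "B r \<in> borel_measurable M" if "0 \<le> r" for r
    using B that by (auto simp: standard_brownian_motion_def)
  have integrand: "ito_integrand M T (augmented_filtration M B) \<theta>" and JT: "J T \<in> borel_measurable M"
    using ito T by (auto simp: is_ito_integral_def)
  obtain n \<tau> \<xi> where simple: "\<And>k. simple_integrand (augmented_filtration M B) T (n k) (\<tau> k) (\<xi> k)"
    and D: "tendsto_in_prob M (\<lambda>k \<omega>. LBINT s:{0..T}. (simple_value (n k) (\<tau> k) (\<xi> k) s \<omega> - \<theta> s \<omega>)\<^sup>2) (\<lambda>_. 0)"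
    and I: "tendsto_in_prob M (\<lambda>k. simple_integral (n k) (\<tau> k) (\<xi> k) B T) (J T)"
  proof -
    have "T \<in> {0..T}" using T by simp
    then show thesis
      using ito that unfolding is_ito_integral_def by blast
  qed
  have \<tau>: "0 \<le> \<tau> k i" if "i \<le> n k" for k i
    using simple[of k] that by (auto simp: simple_integrand_def)
  have sub: "subalgebra M (augmented_filtration M B (\<tau> k i))" for k i
    using B_meas by (intro subalgebra_augmented_filtration) auto
  have \<xi>: "\<xi> k i \<in> borel_measurable M" if "i < n k" for k i
    using simple[of k] that by (auto simp: simple_integrand_def intro!: measurable_from_subalg[OF sub])
  have D_meas: "(\<lambda>\<omega>. LBINT s:{0..T}. (simple_value (n k) (\<tau> k) (\<xi> k) s \<omega> - \<theta> s \<omega>)\<^sup>2) \<in> borel_measurable M" for k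
  proof -
    have "(\<lambda>x. (simple_value (n k) (\<tau> k) (\<xi> k) (snd x) (fst x) - \<theta> (snd x) (fst x))\<^sup>2)
        \<in> borel_measurable (M \<Otimes>\<^sub>M restrict_space lborel {0..T})"
      using simple_value_measurable_pair[of "n k" "\<xi> k" M "\<tau> k" T, OF \<xi>]
        ito_integrand_measurable_swap[OF integrand]
      by (intro borel_measurable_power borel_measurable_diff) (simp_all add: case_prod_beta)
    then show ?thesis
      unfolding set_integral_eq_restrict_space[OF atLeastAtMost_borel]
      by (intro borel_measurable_parametric_integral) (simp add: case_prod_beta)
  qed
  have I_meas: "simple_integral (n k) (\<tau> k) (\<xi> k) B T \<in> borel_measurable M" for k
    unfolding simple_integral_def[abs_def] using \<tau> T
    by (intro borel_measurable_sum borel_measurable_times borel_measurable_diff \<xi> B_meas) auto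
  obtain r1 where r1: "strict_mono r1"
    "AE \<omega> in M. (\<lambda>k. LBINT s:{0..T}. (simple_value (n (r1 k)) (\<tau> (r1 k)) (\<xi> (r1 k)) s \<omega> - \<theta> s \<omega>)\<^sup>2) \<longlonglongrightarrow> 0"
    using tendsto_in_prob_AE_subseq[OF D_meas _ D] by auto
  obtain r2 where r2: "strict_mono r2"
    "AE \<omega> in M. (\<lambda>k. simple_integral (n (r1 (r2 k))) (\<tau> (r1 (r2 k))) (\<xi> (r1 (r2 k))) B T \<omega>) \<longlonglongrightarrow> J T \<omega>"
    using tendsto_in_prob_AE_subseq[OF I_meas JT tendsto_in_prob_subseq[OF I r1(1)]] by auto
  show thesis
  proof (rule that[of "\<lambda>k. n (r1 (r2 k))" "\<lambda>k. \<tau> (r1 (r2 k))" "\<lambda>k. \<xi> (r1 (r2 k))"])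
    show "AE \<omega> in M. (\<lambda>k. LBINT s:{0..T}. (simple_value (n (r1 (r2 k))) (\<tau> (r1 (r2 k))) (\<xi> (r1 (r2 k))) s \<omega> - \<theta> s \<omega>)\<^sup>2) \<longlonglongrightarrow> 0"
      using r1(2) by eventually_elim (use LIMSEQ_subseq_LIMSEQ[OF _ r2(1)] in \<open>force simp: comp_def\<close>)
  qed (use simple r2 in auto)
qed

lemma set_integral_initial_diff:
  fixes g :: "real \<Rightarrow> real"
  assumes g: "integrable (restrict_space lborel {0..T}) g" and ab: "0 \<le> a" "a \<le> b" "b \<le> T"
  shows "(LBINT s:{0..b}. g s) - (LBINT s:{0..a}. g s) =
    (\<integral>s. indicator {a<..b} s * g s \<partial>restrict_space lborel {0..T})"
proof -
  have sets: "{0..c} \<in> sets (restrict_space lborel {0..T})" if "c \<le> T" for c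
    using that by (auto simp: sets_restrict_space intro!: image_eqI[of _ _ "{0..c}"])
  have int: "integrable (restrict_space lborel {0..T}) (\<lambda>s. indicator {0..c} s * g s)" if "c \<le> T" for c
    using integrable_mult_indicator[OF sets[OF that] g] by simp
  have "(LBINT s:{0..b}. g s) - (LBINT s:{0..a}. g s) =
      (\<integral>s. indicator {0..b} s * g s - indicator {0..a} s * g s \<partial>restrict_space lborel {0..T})"
    using ab int[of a] int[of b]
    by (simp add: set_integral_initial_eq_restrict_space[of _ T])
  also have "\<dots> = (\<integral>s. indicator {a<..b} s * g s \<partial>restrict_space lborel {0..T})"
    using ab by (intro Bochner_Integration.integral_cong refl) (auto simp: indicator_def)
  finally show ?thesis .
qed

text \<open>With \<open>F2 = \<integral>f^2 ds\<close>, \<open>K = \<integral>f dB\<close> and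
  \<open>C = \<integral>f \<theta> ds\<close>, the limiting complex exponential is
  \<open>E * U\<close> with \<open>U = exp (F2 / 2) * iexp (K - C)\<close>, and \<open>K - C\<close>
  is almost surely the sum in the claim. So the claim is that \<open>E * U\<close> has mean
  \<open>1\<close>, divided by \<open>exp (F2 / 2)\<close>.\<close>

lemma (in prob_space) girsanov_characteristic_function:
  fixes B \<theta> J :: "real \<Rightarrow> 'a \<Rightarrow> real" and l \<sigma> :: "nat \<Rightarrow> real" and T :: real
  defines "E \<equiv> \<lambda>\<omega>. exp (J T \<omega> - 1 / 2 * (LBINT s:{0..T}. (\<theta> s \<omega>)\<^sup>2))"
    and "W \<equiv> \<lambda>t \<omega>. B t \<omega> - (LBINT s:{0..t}. \<theta> s \<omega>)"
  assumes B: "standard_brownian_motion M {0..} B" and T: "0 \<le> T" and ito: "is_ito_integral M T B \<theta> J"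
    and E: "integrable M E" "expectation E = 1"
    and \<sigma>: "\<sigma> ` {..N} \<subseteq> {0..T}" "strict_mono_on {..N} \<sigma>"
  shows "(\<integral>\<omega>. E \<omega> * iexp (\<Sum>k<N. l k * (W (\<sigma> (Suc k)) \<omega> - W (\<sigma> k) \<omega>)) \<partial>M) =
    complex_of_real (exp (- (\<Sum>k<N. (l k)\<^sup>2 * (\<sigma> (Suc k) - \<sigma> k)) / 2))"
proof -
  let ?L = "restrict_space lborel {0..T}"
  interpret L: finite_measure ?L
    by (rule finite_measure_restrict_lborel)
  have B_meas: "B r \<in> borel_measurable M" if "0 \<le> r" for r
    using B that by (auto simp: standard_brownian_motion_def)
  have integrand: "ito_integrand M T (augmented_filtration M B) \<theta>"
    using ito by (auto simp: is_ito_integral_def)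
  note \<theta>_swap = ito_integrand_measurable_swap[OF integrand]
  obtain n \<tau> \<xi> where
    simple: "\<And>k. simple_integrand (augmented_filtration M B) T (n k) (\<tau> k) (\<xi> k)" and
    D: "AE \<omega> in M. (\<lambda>k. LBINT s:{0..T}. (simple_value (n k) (\<tau> k) (\<xi> k) s \<omega> - \<theta> s \<omega>)\<^sup>2) \<longlonglongrightarrow> 0" and
    I: "AE \<omega> in M. (\<lambda>k. simple_integral (n k) (\<tau> k) (\<xi> k) B T \<omega>) \<longlonglongrightarrow> J T \<omega>"
    using ito_integral_AE_approximation[OF B T ito] by blast
  have sub: "subalgebra M (augmented_filtration M B (\<tau> k i))" for k i
    using B_meas by (intro subalgebra_augmented_filtration) auto
  have \<xi>: "\<xi> k i \<in> borel_measurable M" if "i < n k" for k i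
    using simple[of k] that by (auto simp: simple_integrand_def intro!: measurable_from_subalg[OF sub])
  define v where "v k s \<omega> = simple_value (n k) (\<tau> k) (\<xi> k) s \<omega>" for k s \<omega>
  define f where "f s = (\<Sum>k<N. l k * indicator {\<sigma> k<..\<sigma> (Suc k)} s)" for s :: real
  have \<sigma>_in: "0 \<le> \<sigma> k" "\<sigma> k < \<sigma> (Suc k)" "\<sigma> (Suc k) \<le> T" if "k < N" for k
    using strict_mono_partition_step[OF \<sigma> that] by auto
  have f_borel[measurable]: "f \<in> borel_measurable borel" and v_borel[measurable]: "(\<lambda>s. v k s \<omega>) \<in> borel_measurable borel" for k \<omega>
    unfolding f_def v_def by measurable
  have L_meas: "g \<in> borel_measurable ?L" if "g \<in> borel_measurable borel" for g :: "real \<Rightarrow> real"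
    using that by (intro measurable_restrict_space1) simp
  have L_int: "integrable ?L g" if "g \<in> borel_measurable borel" "\<And>s. \<bar>g s\<bar> \<le> b" for g :: "real \<Rightarrow> real" and b
    using that by (intro L.integrable_const_bound[where B = b]) (auto intro: L_meas)
  have f_le: "\<bar>f s\<bar> \<le> (\<Sum>k<N. \<bar>l k\<bar>)" for s
    using abs_simple_value_le[of N \<sigma> "\<lambda>k _. l k" s undefined] by (simp add: simple_value_def f_def)
  have v_le: "\<bar>v k s \<omega>\<bar> \<le> (\<Sum>i<n k. \<bar>\<xi> k i \<omega>\<bar>)" for k s \<omega>
    unfolding v_def by (rule abs_simple_value_le)
  have f2_int: "integrable ?L (\<lambda>s. (f s)\<^sup>2)"
    by (rule L_int[of _ "(\<Sum>k<N. \<bar>l k\<bar>)\<^sup>2"]) (use f_le in \<open>auto simp: abs_le_square_iff[symmetric] intro: order_trans[OF _ abs_ge_self]\<close>)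
  have v2_int: "integrable ?L (\<lambda>s. (v k s \<omega>)\<^sup>2)" for k \<omega>
    by (rule L_int[of _ "(\<Sum>i<n k. \<bar>\<xi> k i \<omega>\<bar>)\<^sup>2"]) (use v_le in \<open>auto simp: abs_le_square_iff[symmetric] intro: order_trans[OF _ abs_ge_self]\<close>)
  have fv_int: "integrable ?L (\<lambda>s. f s * v k s \<omega>)" for k \<omega>
    by (rule L_int[of _ "(\<Sum>k<N. \<bar>l k\<bar>) * (\<Sum>i<n k. \<bar>\<xi> k i \<omega>\<bar>)"])
       (use f_le v_le in \<open>auto simp: abs_mult intro!: mult_mono sum_nonneg\<close>)
  define F2 where "F2 = (\<Sum>k<N. (l k)\<^sup>2 * (\<sigma> (Suc k) - \<sigma> k))"
  have F2: "(\<integral>s. (f s)\<^sup>2 \<partial>?L) = F2"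
  proof -
    have ind: "integrable ?L (indicator {\<sigma> k<..\<sigma> (Suc k)} :: real \<Rightarrow> real)"
      "(\<integral>s. indicator {\<sigma> k<..\<sigma> (Suc k)} s \<partial>?L) = \<sigma> (Suc k) - \<sigma> k" if "k < N" for k
    proof -
      show "integrable ?L (indicator {\<sigma> k<..\<sigma> (Suc k)} :: real \<Rightarrow> real)"
        by (rule L_int[of _ 1]) auto
      have "{\<sigma> k<..\<sigma> (Suc k)} \<subseteq> {0..T}"
        using \<sigma>_in[OF that] by auto
      then have "measure ?L ({\<sigma> k<..\<sigma> (Suc k)} \<inter> space ?L) = measure lborel {\<sigma> k<..\<sigma> (Suc k)}"
        by (simp add: space_restrict_space Int_absorb2 measure_restrict_space)
      then show "(\<integral>s. indicator {\<sigma> k<..\<sigma> (Suc k)} s \<partial>?L) = \<sigma> (Suc k) - \<sigma> k"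
        unfolding Bochner_Integration.integral_indicator using \<sigma>_in[OF that] by simp
    qed
    have "(\<integral>s. (f s)\<^sup>2 \<partial>?L) = (\<Sum>k<N. (\<integral>s. (l k)\<^sup>2 * indicator {\<sigma> k<..\<sigma> (Suc k)} s \<partial>?L))"
      unfolding f_def step_function_sq[OF \<sigma>(2)]
      by (rule Bochner_Integration.integral_sum) (simp add: ind(1))
    also have "\<dots> = F2"
      unfolding F2_def integral_mult_right_zero by (intro sum.cong refl arg_cong2[where f = "(*)"] ind(2)) simp
    finally show ?thesis .
  qed
  define K where "K \<omega> = (\<Sum>k<N. l k * (B (\<sigma> (Suc k)) \<omega> - B (\<sigma> k) \<omega>))" for \<omega>
  have K: "simple_integral N \<sigma> (\<lambda>k _. l k) B T \<omega> = K \<omega>" for \<omega>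
    unfolding simple_integral_def K_def using \<sigma>_in by (intro sum.cong) (force simp: min_absorb2)+
  have [measurable]: "K \<in> borel_measurable M"
    unfolding K_def using \<sigma>_in
    by (intro borel_measurable_sum borel_measurable_times borel_measurable_diff B_meas borel_measurable_const) force+
  \<comment> \<open>Primed names belong to the approximation number \<open>k\<close>.
    \<open>K\<close> and \<open>F2\<close> do not depend on it, since \<theta> is approximated while
    \<open>f\<close> is fixed.\<close>
  define E' where "E' k \<omega> = exp (simple_integral (n k) (\<tau> k) (\<xi> k) B T \<omega> - (\<integral>s. (v k s \<omega>)\<^sup>2 \<partial>?L) / 2)" for k \<omega>
  define C' where "C' k \<omega> = (\<integral>s. f s * v k s \<omega> \<partial>?L)" for k \<omega>
  define C where "C \<omega> = (\<integral>s. f s * \<theta> s \<omega> \<partial>?L)" for \<omega>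
  define U' where "U' k \<omega> = exp (F2 / 2) * iexp (K \<omega> - C' k \<omega>)" for k \<omega>
  define U where "U \<omega> = exp (F2 / 2) * iexp (K \<omega> - C \<omega>)" for \<omega>
  have f_snd: "(\<lambda>x. f (snd x)) \<in> borel_measurable (M \<Otimes>\<^sub>M ?L)"
    by (rule borel_measurable_restrict_lborel_Pair2) simp
  have [measurable]: "C \<in> borel_measurable M"
    unfolding C_def using f_snd \<theta>_swap
    by (intro borel_measurable_parametric_integral) (simp add: case_prod_beta)
  have [measurable]: "C' k \<in> borel_measurable M" for k
    unfolding C'_def v_def using f_snd simple_value_measurable_pair[of "n k" "\<xi> k" M "\<tau> k" T, OF \<xi>]
    by (intro borel_measurable_parametric_integral) (simp add: case_prod_beta)
  have E'_props: "integrable M (E' k)" "expectation (E' k) = 1" for k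
  proof -
    \<comment> \<open>The empty partition switches off the imaginary part, so the mean of the real
      exponential is a special case of the complex one.\<close>
    have zero: "(\<lambda>_. 0) ` {..0::nat} \<subseteq> {0..T}" "strict_mono_on {..0::nat} (\<lambda>_. 0 :: real)"
      using T by (auto simp: strict_mono_on_def)
    have eq: "exp (complex_of_real (simple_integral (n k) (\<tau> k) (\<xi> k) B T \<omega>)
        + \<i> * simple_integral 0 (\<lambda>_. 0) (\<lambda>k _. 0) B T \<omega>
        - (CLBINT r:{0..T}. (simple_value (n k) (\<tau> k) (\<xi> k) r \<omega> + \<i> * simple_value 0 (\<lambda>_. 0) (\<lambda>k _. 0) r \<omega>)\<^sup>2) / 2)
      = complex_of_real (E' k \<omega>)" for \<omega>
    proof -
      have "(CLBINT r:{0..T}. (simple_value (n k) (\<tau> k) (\<xi> k) r \<omega> + \<i> * simple_value 0 (\<lambda>_. 0) (\<lambda>k _. 0) r \<omega>)\<^sup>2)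
          = (\<integral>s. complex_of_real ((v k s \<omega>)\<^sup>2) \<partial>?L)"
        by (simp add: set_integral_eq_restrict_space simple_value_def[of 0] v_def)
      also have "\<dots> = complex_of_real (\<integral>s. (v k s \<omega>)\<^sup>2 \<partial>?L)"
        by (rule integral_complex_of_real)
      finally show ?thesis
        by (simp add: simple_integral_def[of 0] E'_def exp_of_real[symmetric])
    qed
    have "integrable M (\<lambda>\<omega>. complex_of_real (E' k \<omega>))" "(\<integral>\<omega>. complex_of_real (E' k \<omega>) \<partial>M) = 1"
      using simple_stochastic_exponential[OF B T simple[of k] zero, of "\<lambda>_. 0"] unfolding eq by blast+
    then show "integrable M (E' k)" "expectation (E' k) = 1"
      unfolding complex_of_real_integrable_eq integral_complex_of_real by (simp_all only: of_real_eq_1_iff)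
  qed
  have EU': "(\<integral>\<omega>. E' k \<omega> * U' k \<omega> \<partial>M) = 1" for k
  proof -
    have "exp (complex_of_real (simple_integral (n k) (\<tau> k) (\<xi> k) B T \<omega>)
        + \<i> * simple_integral N \<sigma> (\<lambda>k _. l k) B T \<omega>
        - (CLBINT r:{0..T}. (simple_value (n k) (\<tau> k) (\<xi> k) r \<omega> + \<i> * simple_value N \<sigma> (\<lambda>k _. l k) r \<omega>)\<^sup>2) / 2)
      = E' k \<omega> * U' k \<omega>" for \<omega>
    proof -
      \<comment> \<open>The squared integrand has real part \<open>v^2 - f^2\<close> and imaginary
        part \<open>2 f v\<close>: the former yields the quadratic terms of both factors, the latter
        the phase \<open>C' k\<close>.\<close>
      have "(CLBINT r:{0..T}. (simple_value (n k) (\<tau> k) (\<xi> k) r \<omega> + \<i> * simple_value N \<sigma> (\<lambda>k _. l k) r \<omega>)\<^sup>2)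
          = (\<integral>s. complex_of_real ((v k s \<omega>)\<^sup>2 - (f s)\<^sup>2) + 2 * \<i> * complex_of_real (f s * v k s \<omega>) \<partial>?L)"
        unfolding set_integral_eq_restrict_space[OF atLeastAtMost_borel]
        by (intro Bochner_Integration.integral_cong refl)
           (simp add: simple_value_def[of N] v_def f_def[symmetric] power2_eq_square algebra_simps)
      also have "\<dots> = (\<integral>s. complex_of_real ((v k s \<omega>)\<^sup>2 - (f s)\<^sup>2) \<partial>?L) + (\<integral>s. 2 * \<i> * complex_of_real (f s * v k s \<omega>) \<partial>?L)"
        using v2_int f2_int fv_int
        by (intro Bochner_Integration.integral_add integrable_of_real integrable_mult_right Bochner_Integration.integrable_diff)
      also have "\<dots> = complex_of_real ((\<integral>s. (v k s \<omega>)\<^sup>2 \<partial>?L) - F2) + 2 * \<i> * complex_of_real (C' k \<omega>)"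
        unfolding integral_mult_right_zero integral_complex_of_real C'_def F2[symmetric]
        using v2_int f2_int by simp
      finally have Q: "(CLBINT r:{0..T}. (simple_value (n k) (\<tau> k) (\<xi> k) r \<omega> + \<i> * simple_value N \<sigma> (\<lambda>k _. l k) r \<omega>)\<^sup>2) =
        complex_of_real ((\<integral>s. (v k s \<omega>)\<^sup>2 \<partial>?L) - F2) + 2 * \<i> * complex_of_real (C' k \<omega>)" .
      show ?thesis
        unfolding Q K E'_def U'_def exp_of_real[symmetric] exp_add[symmetric]
        by (rule arg_cong[where f = exp]) (simp add: field_simps)
    qed
    then show ?thesis
      using simple_stochastic_exponential(2)[OF B T simple[of k] \<sigma>, of l] by simp
  qed
  have "(\<integral>\<omega>. E \<omega> * U \<omega> \<partial>M) = 1"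
  proof (rule expectation_mult_eq_limit_Scheffe[where E' = E' and U' = U' and c = "exp (F2 / 2)"])
    have AE: "AE \<omega> in M. (\<lambda>k. E' k \<omega>) \<longlonglongrightarrow> E \<omega> \<and> (\<lambda>k. U' k \<omega>) \<longlonglongrightarrow> U \<omega>"
      using D I ito_integrand_AE[OF integrand]
    proof eventually_elim
      case (elim \<omega>)
      have lim: "(\<lambda>k. \<integral>s. (v k s \<omega> - \<theta> s \<omega>)\<^sup>2 \<partial>?L) \<longlonglongrightarrow> 0"
        using elim(1) by (simp add: v_def set_integral_eq_restrict_space)
      have limC: "(\<lambda>k. C' k \<omega>) \<longlonglongrightarrow> C \<omega>" and limA: "(\<lambda>k. \<integral>s. (v k s \<omega>)\<^sup>2 \<partial>?L) \<longlonglongrightarrow> (\<integral>s. (\<theta> s \<omega>)\<^sup>2 \<partial>?L)"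
        unfolding C'_def C_def
        using integral_tendsto_L2[OF L_meas[OF f_borel] f2_int _ _ L_meas[OF v_borel] v2_int lim] elim(3) by blast+
      have "(\<lambda>k. E' k \<omega>) \<longlonglongrightarrow> exp (J T \<omega> - (\<integral>s. (\<theta> s \<omega>)\<^sup>2 \<partial>?L) / 2)"
        unfolding E'_def by (intro tendsto_exp tendsto_diff elim(2) tendsto_divide limA tendsto_const) simp
      moreover have "(\<lambda>k. U' k \<omega>) \<longlonglongrightarrow> U \<omega>"
        unfolding U'_def U_def by (intro tendsto_mult tendsto_exp tendsto_const tendsto_of_real tendsto_diff limC)
      ultimately show ?case
        unfolding E_def set_integral_eq_restrict_space[OF atLeastAtMost_borel] by simp
    qed
    show "AE \<omega> in M. (\<lambda>k. E' k \<omega>) \<longlonglongrightarrow> E \<omega>" "AE \<omega> in M. (\<lambda>k. U' k \<omega>) \<longlonglongrightarrow> U \<omega>"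
      using AE by auto
    show "U' k \<in> borel_measurable M" for k unfolding U'_def by measurable
    show "U \<in> borel_measurable M" unfolding U_def by measurable
    show "norm (U' k \<omega>) \<le> exp (F2 / 2)" for k \<omega>
      unfolding U'_def norm_mult norm_exp_i_times by simp
  qed (use E E'_props EU' in \<open>auto simp: E'_def E_def\<close>)
  moreover have "(\<integral>\<omega>. E \<omega> * U \<omega> \<partial>M) =
    exp (F2 / 2) * (\<integral>\<omega>. E \<omega> * iexp (\<Sum>k<N. l k * (W (\<sigma> (Suc k)) \<omega> - W (\<sigma> k) \<omega>)) \<partial>M)"
  proof -
    have \<theta>_int_meas: "(\<lambda>\<omega>. LBINT s:{0..t}. \<theta> s \<omega>) \<in> borel_measurable M" if "t \<le> T" for t
    proof -
      have ind_snd: "(\<lambda>x. indicator {0..t} (snd x) :: real) \<in> borel_measurable (M \<Otimes>\<^sub>M ?L)"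
        by (rule borel_measurable_restrict_lborel_Pair2) simp
      show ?thesis
        unfolding set_integral_initial_eq_restrict_space[OF that]
        by (rule borel_measurable_parametric_integral, unfold case_prod_beta,
            rule borel_measurable_times[OF ind_snd \<theta>_swap[unfolded case_prod_beta]])
    qed
    have W_meas: "W t \<in> borel_measurable M" if "0 \<le> t" "t \<le> T" for t
      unfolding W_def by (intro borel_measurable_diff B_meas \<theta>_int_meas that)
    have S_meas: "(\<lambda>\<omega>. \<Sum>k<N. l k * (W (\<sigma> (Suc k)) \<omega> - W (\<sigma> k) \<omega>)) \<in> borel_measurable M"
      using \<sigma>_in by (intro borel_measurable_sum borel_measurable_times borel_measurable_diff W_meas) force+
    \<comment> \<open>Almost everywhere only: splitting the integral of \<open>f * \<theta>\<close>
      over the pieces uses that the path of \<theta> is integrable on \<open>{0..T}\<close>.\<close>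
    have "AE \<omega> in M. K \<omega> - C \<omega> = (\<Sum>k<N. l k * (W (\<sigma> (Suc k)) \<omega> - W (\<sigma> k) \<omega>))"
      using ito_integrand_AE[OF integrand]
    proof eventually_elim
      case (elim \<omega>)
      then have \<theta>_int: "integrable ?L (\<lambda>s. \<theta> s \<omega>)" by simp
      have ind_int: "integrable ?L (\<lambda>s. indicator {\<sigma> k<..\<sigma> (Suc k)} s * \<theta> s \<omega>)" for k
      proof (rule Bochner_Integration.integrable_bound[OF \<theta>_int])
        show "(\<lambda>s. indicator {\<sigma> k<..\<sigma> (Suc k)} s * \<theta> s \<omega>) \<in> borel_measurable ?L"
          by (rule borel_measurable_times[OF L_meas borel_measurable_integrable[OF \<theta>_int]]) simp
      qed (auto simp: indicator_def)
      have "C \<omega> = (\<Sum>k<N. l k * (\<integral>s. indicator {\<sigma> k<..\<sigma> (Suc k)} s * \<theta> s \<omega> \<partial>?L))"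
        unfolding C_def f_def sum_distrib_right mult.assoc
        using ind_int by (subst Bochner_Integration.integral_sum) auto
      also have "\<dots> = (\<Sum>k<N. l k * ((LBINT s:{0..\<sigma> (Suc k)}. \<theta> s \<omega>) - (LBINT s:{0..\<sigma> k}. \<theta> s \<omega>)))"
        using \<sigma>_in by (intro sum.cong refl) (subst set_integral_initial_diff[OF \<theta>_int]; force)
      finally have C_eq: "C \<omega> = (\<Sum>k<N. l k * ((LBINT s:{0..\<sigma> (Suc k)}. \<theta> s \<omega>) - (LBINT s:{0..\<sigma> k}. \<theta> s \<omega>)))" .
      show ?case
        unfolding C_eq K_def W_def sum_subtractf[symmetric] by (intro sum.cong refl) (simp add: algebra_simps)
    qed
    then have "(\<integral>\<omega>. E \<omega> * U \<omega> \<partial>M) =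
      (\<integral>\<omega>. exp (F2 / 2) * (E \<omega> * iexp (\<Sum>k<N. l k * (W (\<sigma> (Suc k)) \<omega> - W (\<sigma> k) \<omega>))) \<partial>M)"
      using borel_measurable_integrable[OF E(1)] S_meas unfolding U_def
      by (intro integral_cong_AE) (auto elim!: eventually_mono simp del: of_real_diff of_real_sum)
    then show ?thesis by simp
  qed
  ultimately have "exp (F2 / 2) * (\<integral>\<omega>. E \<omega> * iexp (\<Sum>k<N. l k * (W (\<sigma> (Suc k)) \<omega> - W (\<sigma> k) \<omega>)) \<partial>M) = 1"
    by simp
  then have "(\<integral>\<omega>. E \<omega> * iexp (\<Sum>k<N. l k * (W (\<sigma> (Suc k)) \<omega> - W (\<sigma> k) \<omega>)) \<partial>M) = inverse (complex_of_real (exp (F2 / 2)))"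
    by (rule inverse_unique[symmetric])
  also have "\<dots> = complex_of_real (exp (- F2 / 2))"
    unfolding of_real_inverse[symmetric] exp_minus[symmetric] by simp
  finally show ?thesis
    unfolding F2_def .
qed

section \<open>Path continuity\<close>

lemma uniformly_continuous_on_subset:
  fixes f :: "'a::metric_space \<Rightarrow> 'b::metric_space"
  shows "uniformly_continuous_on A f \<Longrightarrow> A' \<subseteq> A \<Longrightarrow> uniformly_continuous_on A' f"
  unfolding uniformly_continuous_on_def by (meson subsetD)

lemma closure_rationals_greaterThanLessThan:
  fixes a b :: real
  assumes "a < b"
  shows "closure ({a<..<b} \<inter> \<rat>) = {a..b}"
  using assms by (simp add: closure_open_Int_superset Rats_closure_real closure_greaterThanLessThan)

lemma continuous_on_interval_eqI_rationals:
  fixes g h :: "real \<Rightarrow> real"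
  assumes "a < b" "continuous_on {a..b} g" "continuous_on {a..b} h"
    and "\<And>x. x \<in> {a<..<b} \<inter> \<rat> \<Longrightarrow> g x = h x" and x: "x \<in> {a..b}"
  shows "g x = h x"
proof -
  have "(\<lambda>x. g x - h x) x = 0"
    by (rule continuous_constant_on_closure[of "{a<..<b} \<inter> \<rat>"])
       (use assms in \<open>auto simp: closure_rationals_greaterThanLessThan intro!: continuous_intros\<close>)
  then show ?thesis by simp
qed

text \<open>For an integrable \<open>g\<close> the Lebesgue integral agrees with the gauge integral,
  whose indefinite integral is continuous.\<close>

lemma continuous_on_set_integral_initial:
  fixes g :: "real \<Rightarrow> real"
  assumes "set_integrable lborel {0..T} g"
  shows "continuous_on {0..T} (\<lambda>t. LBINT s:{0..t}. g s)"
proof -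
  have "continuous_on {0..T} (\<lambda>t. integral {0..t} g)"
    by (intro indefinite_integral_continuous_1 set_borel_integral_eq_integral(1) assms)
  then show ?thesis
  proof (rule continuous_on_cong[THEN iffD1, rotated -1])
    fix t assume "t \<in> {0..T}"
    then have "set_integrable lborel {0..t} g"
      by (intro set_integrable_subset[OF assms]) auto
    then show "integral {0..t} g = (LBINT s:{0..t}. g s)"
      by (rule set_borel_integral_eq_integral(2)[symmetric])
  qed simp
qed

text \<open>Past the first time up to which \<open>g\<close> is not integrable the integral is \<open>0\<close> by convention,
  so that a jump of the indefinite integral is visible on every dense set containing \<open>T\<close>.\<close>

lemma continuous_on_set_integral_initial_if_uniformly_continuous_on_rationals:
  fixes g :: "real \<Rightarrow> real"
  defines "G \<equiv> \<lambda>t. LBINT s:{0..t}. g s"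
  assumes T: "0 < T" and D: "uniformly_continuous_on (({0<..<T} \<inter> \<rat>) \<union> {0, T}) G"
  shows "continuous_on {0..T} G"
proof -
  let ?D = "({0<..<T} \<inter> \<rat>) \<union> {0, T}"
  have "closure ?D = {0..T}"
    using T by (auto simp: closure_Un closure_rationals_greaterThanLessThan simp del: Un_insert_right)
  then obtain h where h: "uniformly_continuous_on {0..T} h" "\<And>x. x \<in> ?D \<Longrightarrow> G x = h x"
    using uniformly_continuous_on_extension_on_closure[OF D] by metis
  have h_cont: "continuous_on A h" if "A \<subseteq> {0..T}" for A
    using uniformly_continuous_imp_continuous[OF h(1)] that by (rule continuous_on_subset)
  \<comment> \<open>The endpoint \<open>T\<close> has to be in the dense set itself: if
    \<open>g\<close> is integrable up to every time before \<open>T\<close> but not up to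
    \<open>T\<close>, no interval of zeros to the right reveals the jump.\<close>
  have "G t = h t" if t: "t \<in> {0..T}" for t
  proof (cases "t = 0 \<or> t = T")
    case True
    then show ?thesis using h(2) by auto
  next
    case False
    with t have t': "0 < t" "t < T" by auto
    show ?thesis
    proof (cases "set_integrable lborel {0..t} g")
      case True
      show ?thesis
      proof (rule continuous_on_interval_eqI_rationals[OF \<open>0 < t\<close>, of G h])
        show "continuous_on {0..t} G"
          unfolding G_def by (rule continuous_on_set_integral_initial[OF True])
        show "G x = h x" if "x \<in> {0<..<t} \<inter> \<rat>" for x
          using that t' by (intro h(2)) auto
      qed (use t' in \<open>auto intro: h_cont\<close>)
    next
      case False
      \<comment> \<open>Nonintegrability persists on every longer interval, so \<open>G\<close> is
        \<open>0\<close> from \<open>t\<close> on; \<open>h\<close> then vanishes at the rationals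
        after \<open>t\<close> and, by continuity, at \<open>t\<close>.\<close>
      have G0: "G x = 0" if "t \<le> x" for x
      proof -
        have "\<not> set_integrable lborel {0..x} g"
          using False that by (auto intro: set_integrable_subset)
        then show ?thesis
          unfolding G_def set_integrable_def set_lebesgue_integral_def by (rule not_integrable_integral_eq)
      qed
      have "0 = h t"
      proof (rule continuous_on_interval_eqI_rationals[OF \<open>t < T\<close>, of "\<lambda>_. 0" h])
        show "0 = h x" if "x \<in> {t<..<T} \<inter> \<rat>" for x
          using that t' G0[of x] h(2)[of x] by auto
      qed (use t' in \<open>auto intro: h_cont\<close>)
      then show ?thesis using G0[of t] by simp
    qed
  qed
  then show ?thesis
    using h_cont[OF subset_refl] continuous_on_cong[of "{0..T}" "{0..T}" G h] by blast
qed

section \<open>Fubini extensions\<close>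

lemma space_fubini_extension:
  assumes "fubini_extension L M V"
  shows "space V = space L \<times> space M"
  using assms by (simp add: fubini_extension_def measure_extension_def space_pair_measure)

text \<open>The Fubini property, applied to the indicator of the complement, gives measure zero. It
  speaks only about functions measurable for \<open>V\<close>, hence the premise on
  \<open>S\<close>: null sections alone do not make a set measurable.\<close>

lemma fubini_extension_AE:
  assumes F: "fubini_extension L M V" and S: "S \<in> sets V"
    and AE: "\<And>u. u \<in> space L \<Longrightarrow> AE \<omega> in M. (u, \<omega>) \<in> S"
  shows "AE x in V. x \<in> S"
proof -
  interpret V: prob_space V using F by (simp add: fubini_extension_def)
  define N where "N = space V - S"
  have N: "N \<in> sets V" using S by (simp add: N_def)
  have "integrable V (indicator N :: _ \<Rightarrow> real)"
    using N by (intro integrable_real_indicator) (auto simp: V.emeasure_eq_measure)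
  with F have "(\<integral>x. indicator N x \<partial>V) = (\<integral>u. (\<integral>\<omega>. indicator N (u, \<omega>) \<partial>M) \<partial>L :: real)"
    unfolding fubini_extension_def by blast
  also have "\<dots> = (\<integral>u. 0 \<partial>L)"
  proof (intro Bochner_Integration.integral_cong refl integral_eq_zero_AE)
    fix u assume u: "u \<in> space L"
    show "AE \<omega> in M. (indicator N (u, \<omega>) :: real) = 0"
      using AE[OF u] by eventually_elim (simp add: N_def)
  qed
  finally have "V.prob N = 0"
    using N by (simp add: Int_absorb2 sets.sets_into_space)
  then have "N \<in> null_sets V"
    using N by (auto simp: V.emeasure_eq_measure intro: null_setsI)
  then have "AE x in V. x \<notin> N"
    by (rule AE_not_in)
  with AE_space show ?thesis
    by eventually_elim (simp add: N_def)
qed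

text \<open>The measurable version is applied to \<open>A \<union> N'\<close>, which contains
  \<open>S\<close>, and the null set \<open>N'\<close> is removed afterwards. This serves for path
  continuity of \<open>B\<close>, which is an event of the completion.\<close>

lemma fubini_extension_AE_completion:
  assumes F: "fubini_extension L M V" and S: "S \<in> sets (completion V)"
    and AE: "\<And>u. u \<in> space L \<Longrightarrow> AE \<omega> in M. (u, \<omega>) \<in> S"
  shows "AE x in V. x \<in> S"
proof -
  obtain A N N' where A: "S = A \<union> N" "N \<subseteq> N'" "N' \<in> null_sets V" "A \<in> sets V"
    using S by (rule sets_completionE)
  have "AE x in V. x \<in> A \<union> N'"
  proof (rule fubini_extension_AE[OF F])
    show "A \<union> N' \<in> sets V" using A by auto
    show "AE \<omega> in M. (u, \<omega>) \<in> A \<union> N'" if "u \<in> space L" for u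
      using AE[OF that] A(1,2) by (auto elim!: eventually_mono)
  qed
  moreover have "AE x in V. x \<notin> N'"
    using A(3) by (rule AE_not_in)
  ultimately show ?thesis
    by eventually_elim (use A(1) in auto)
qed

text \<open>The Fubini property is stated for real functions, so real and imaginary parts are
  treated separately; a constant inner integral leaves the total mass \<open>1\<close> of
  \<open>L\<close> as a factor.\<close>

lemma fubini_extension_integral_const:
  fixes g :: "'i \<times> 'w \<Rightarrow> complex"
  assumes F: "fubini_extension L M V" and g: "integrable V g"
    and sect: "\<And>u. u \<in> space L \<Longrightarrow> integrable M (\<lambda>\<omega>. g (u, \<omega>))"
      "\<And>u. u \<in> space L \<Longrightarrow> (\<integral>\<omega>. g (u, \<omega>) \<partial>M) = c"
  shows "(\<integral>x. g x \<partial>V) = c"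
proof -
  interpret L: prob_space L using F by (simp add: fubini_extension_def)
  have iter: "(\<integral>x. h x \<partial>V) = (\<integral>u. (\<integral>\<omega>. h (u, \<omega>) \<partial>M) \<partial>L)" if "integrable V h" for h :: "'i \<times> 'w \<Rightarrow> real"
    using F that by (simp add: fubini_extension_def)
  have "(\<integral>x. Re (g x) \<partial>V) = (\<integral>u. Re c \<partial>L)" "(\<integral>x. Im (g x) \<partial>V) = (\<integral>u. Im c \<partial>L)"
    unfolding iter[OF integrable_Re[OF g]] iter[OF integrable_Im[OF g]]
    by (intro Bochner_Integration.integral_cong refl; simp add: sect integral_Re integral_Im)+
  then show ?thesis
    using integral_Re[OF g] integral_Im[OF g] by (simp add: complex_eq_iff L.prob_space)
qed

text \<open>The Fubini property presupposes integrability on \<open>V\<close>, which is the claim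
  here. It is therefore applied to the bounded truncations \<open>min (X x) (real n)\<close>, whose
  integrals are at most \<open>c\<close>, and Fatou's lemma removes the truncation.\<close>

lemma fubini_extension_integrable_nonneg:
  fixes X :: "'i \<times> 'w \<Rightarrow> real"
  assumes F: "fubini_extension L M V" and X[measurable]: "X \<in> borel_measurable V"
    and nonneg: "\<And>x. x \<in> space V \<Longrightarrow> 0 \<le> X x"
    and sect: "\<And>u. u \<in> space L \<Longrightarrow> integrable M (\<lambda>\<omega>. X (u, \<omega>))"
      "\<And>u. u \<in> space L \<Longrightarrow> (\<integral>\<omega>. X (u, \<omega>) \<partial>M) \<le> c"
  shows "integrable V X"
proof -
  interpret L: prob_space L using F by (simp add: fubini_extension_def)
  interpret M: prob_space M using F by (simp add: fubini_extension_def)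
  interpret V: prob_space V using F by (simp add: fubini_extension_def)
  have space: "space V = space L \<times> space M"
    by (rule space_fubini_extension[OF F])
  have int: "integrable V (\<lambda>x. min (X x) (real n))" for n
    using nonneg by (intro V.integrable_const_bound[where B = "real n"]) auto
  have "(\<integral>x. min (X x) (real n) \<partial>V) \<le> c" for n
  proof -
    have iL: "integrable L (\<lambda>u. \<integral>\<omega>. min (X (u, \<omega>)) (real n) \<partial>M)"
      using F int[of n] by (auto simp: fubini_extension_def)
    have "(\<integral>x. min (X x) (real n) \<partial>V) = (\<integral>u. (\<integral>\<omega>. min (X (u, \<omega>)) (real n) \<partial>M) \<partial>L)"
      using F int[of n] by (auto simp: fubini_extension_def)
    also have "(\<integral>u. (\<integral>\<omega>. min (X (u, \<omega>)) (real n) \<partial>M) \<partial>L) \<le> (\<integral>u. c \<partial>L)"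
    proof (rule integral_mono[OF iL])
      fix u assume u: "u \<in> space L"
      have "(\<integral>\<omega>. min (X (u, \<omega>)) (real n) \<partial>M) \<le> (\<integral>\<omega>. X (u, \<omega>) \<partial>M)"
      proof (rule integral_mono[OF _ sect(1)[OF u]])
        have [measurable]: "(\<lambda>\<omega>. X (u, \<omega>)) \<in> borel_measurable M"
          using sect(1)[OF u] by auto
        show "integrable M (\<lambda>\<omega>. min (X (u, \<omega>)) (real n))"
          using nonneg u by (intro M.integrable_const_bound[where B = "real n"]) (auto simp: space)
      qed auto
      with sect(2)[OF u] show "(\<integral>\<omega>. min (X (u, \<omega>)) (real n) \<partial>M) \<le> c"
        by simp
    qed simp
    finally show ?thesis by (simp add: L.prob_space)
  qed
  then have nn_le: "(\<integral>\<^sup>+x. ennreal (min (X x) (real n)) \<partial>V) \<le> ennreal c" for n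
    using int nonneg by (subst nn_integral_eq_integral) (auto intro: ennreal_leI)
  have "(\<integral>\<^sup>+x. ennreal (X x) \<partial>V) = (\<integral>\<^sup>+x. liminf (\<lambda>n. ennreal (min (X x) (real n))) \<partial>V)"
  proof (intro nn_integral_cong)
    fix x
    have "\<forall>\<^sub>F n in sequentially. min (X x) (real n) = X x"
      using eventually_ge_at_top[of "nat \<lceil>X x\<rceil>"] by eventually_elim linarith
    then have "(\<lambda>n. ennreal (min (X x) (real n))) \<longlonglongrightarrow> ennreal (X x)"
      by (intro tendsto_ennrealI tendsto_eventually)
    then show "ennreal (X x) = liminf (\<lambda>n. ennreal (min (X x) (real n)))"
      by (simp add: lim_imp_Liminf)
  qed
  also have "\<dots> \<le> liminf (\<lambda>n. \<integral>\<^sup>+x. ennreal (min (X x) (real n)) \<partial>V)"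
    by (rule nn_integral_liminf) simp
  also have "\<dots> \<le> liminf (\<lambda>n. ennreal c)"
    by (intro Liminf_mono always_eventually allI nn_le)
  also have "\<dots> < \<infinity>"
    by (simp add: Liminf_const)
  finally show ?thesis
    using nonneg by (intro integrableI_nonneg) auto
qed

section \<open>Constant expectation and initial values\<close>

lemma expectation_martingale_on:
  assumes M: "prob_space M" and X: "martingale_on M T F X" and T: "0 \<le> T"
    and sub: "subalgebra M (F 0)"
  shows "(\<integral>\<omega>. X T \<omega> \<partial>M) = (\<integral>\<omega>. X 0 \<omega> \<partial>M)"
proof -
  interpret prob_space M by fact
  interpret finite_measure_subalgebra M "F 0"
    by unfold_locales (rule sub)
  have int: "integrable M (X T)" "integrable M (X 0)"
    using X T by (auto simp: martingale_on_def)
  have "(\<integral>\<omega>. X T \<omega> \<partial>M) = (\<integral>\<omega>. real_cond_exp M (F 0) (X T) \<omega> \<partial>M)"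
    using real_cond_exp_int(2)[OF int(1)] by simp
  also have "\<dots> = (\<integral>\<omega>. X 0 \<omega> \<partial>M)"
    using X T int(2) by (intro integral_cong_AE) (auto simp: martingale_on_def)
  finally show ?thesis .
qed

text \<open>At time \<open>0\<close> both minima in every increment of a simple integral are
  \<open>0\<close>, so these integrals vanish, and the limit in probability inherits this almost
  surely.\<close>

lemma ito_integral_0:
  assumes M: "prob_space M" and ito: "is_ito_integral M T B \<theta> J" and T: "0 \<le> T"
  shows "AE \<omega> in M. J 0 \<omega> = 0"
proof -
  interpret prob_space M by fact
  have 0: "0 \<in> {0..T}" using T by simp
  obtain n \<tau> \<xi> where simple: "\<And>k. simple_integrand (augmented_filtration M B) T (n k) (\<tau> k) (\<xi> k)"
    and lim: "tendsto_in_prob M (\<lambda>k. simple_integral (n k) (\<tau> k) (\<xi> k) B 0) (J 0)"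
    and J[measurable]: "J 0 \<in> borel_measurable M"
    using ito 0 unfolding is_ito_integral_def by blast
  have "simple_integral (n k) (\<tau> k) (\<xi> k) B 0 = (\<lambda>_. 0)" for k
    using simple[of k] by (intro ext simple_integral_0) (auto simp: simple_integrand_def)
  then have "tendsto_in_prob M (\<lambda>k _. 0) (J 0)"
    using lim by simp
  from tendsto_in_prob_AE_subseq[OF _ J this] show ?thesis
    by (auto elim!: eventually_mono dest: LIMSEQ_unique[OF tendsto_const])
qed

section \<open>Brownian motion from characteristic functions of increments\<close>

lemma (in prob_space) distributed_normal_if_char:
  assumes X[measurable]: "X \<in> borel_measurable M" and \<sigma>: "\<sigma> > 0"
    and char: "\<And>u. (\<integral>\<omega>. iexp (u * X \<omega>) \<partial>M) = complex_of_real (exp (- (u * \<sigma>)\<^sup>2 / 2))"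
  shows "distributed M lborel X (\<lambda>x. ennreal (normal_density 0 \<sigma> x))"
proof -
  let ?N = "density lborel (\<lambda>x. ennreal (normal_density 0 \<sigma> x))"
  have "real_distribution ?N"
    using prob_space_normal_density[OF \<sigma>, of 0] by (simp add: real_distribution_def real_distribution_axioms_def)
  moreover have "char (distr M borel X) = char ?N"
  proof
    fix u
    have "char (distr M borel X) u = (\<integral>\<omega>. iexp (u * X \<omega>) \<partial>M)"
      unfolding char_def by (subst integral_distr) auto
    also have "\<dots> = char ?N u"
      unfolding char_def char using integral_normal_density_iexp[OF \<sigma>, of 0 u]
      by (subst integral_density) auto
    finally show "char (distr M borel X) u = char ?N u" .
  qed
  ultimately have "distr M borel X = ?N"
    by (intro Levy_uniqueness real_distribution_distr) auto
  moreover have "distr M lborel X = distr M borel X"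
    by (rule distr_cong) auto
  ultimately show ?thesis
    by (simp add: distributed_def)
qed

text \<open>The formula for a two-point partition gives the normal law of an increment. For a longer
  partition, setting all but one \<open>c k\<close> to \<open>0\<close> computes the individual
  characteristic functions, and their product is the joint one because the exponent is a
  sum.\<close>

lemma standard_brownian_motion_if_char:
  assumes P: "prob_space P"
    and meas: "\<And>t. t \<in> S \<Longrightarrow> W t \<in> borel_measurable P"
    and zero: "AE x in P. W 0 x = 0" and cont: "AE x in P. continuous_on S (\<lambda>t. W t x)"
    and char: "\<And>n \<tau> c. \<tau> ` {..n} \<subseteq> S \<Longrightarrow> strict_mono_on {..n} \<tau> \<Longrightarrow>
      (\<integral>x. iexp (\<Sum>k<n. c k * (W (\<tau> (Suc k)) x - W (\<tau> k) x)) \<partial>P) =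
      complex_of_real (exp (- (\<Sum>k<n. (c k)\<^sup>2 * (\<tau> (Suc k) - \<tau> k)) / 2))"
  shows "standard_brownian_motion P S W"
proof -
  interpret prob_space P by fact
  have "distributed P lborel (\<lambda>x. W t x - W s x) (\<lambda>y. ennreal (normal_density 0 (sqrt (t - s)) y))"
    if "s \<in> S" "t \<in> S" "s < t" for s t
  proof (rule distributed_normal_if_char)
    fix u
    have "(\<integral>x. iexp (\<Sum>k<1. u * (W ((\<lambda>i. if i = 0 then s else t) (Suc k)) x - W ((\<lambda>i. if i = 0 then s else t) k) x)) \<partial>P) =
      complex_of_real (exp (- (\<Sum>k<1. u\<^sup>2 * ((\<lambda>i. if i = 0 then s else t) (Suc k) - (\<lambda>i. if i = 0 then s else t) k)) / 2))"
      by (rule char) (use that in \<open>auto simp: strict_mono_on_def\<close>)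
    then show "(\<integral>x. iexp (u * (W t x - W s x)) \<partial>P) = complex_of_real (exp (- (u * sqrt (t - s))\<^sup>2 / 2))"
      using that by (simp add: power_mult_distrib)
  qed (use that meas in auto)
  moreover have "indep_vars (\<lambda>_. borel) (\<lambda>k x. W (\<tau> (Suc k)) x - W (\<tau> k) x) {..<n}"
    if \<tau>: "\<tau> ` {..n} \<subseteq> S" "strict_mono_on {..n} \<tau>" for n \<tau>
  proof (rule indep_vars_if_char_prod)
    show "(\<lambda>x. W (\<tau> (Suc k)) x - W (\<tau> k) x) \<in> borel_measurable P" if "k \<in> {..<n}" for k
      using that \<tau>(1) by (intro borel_measurable_diff meas) auto
    fix c :: "nat \<Rightarrow> real"
    have single: "(\<integral>x. iexp (c k * (W (\<tau> (Suc k)) x - W (\<tau> k) x)) \<partial>P) =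
        complex_of_real (exp (- ((c k)\<^sup>2 * (\<tau> (Suc k) - \<tau> k)) / 2))" if "k < n" for k
    proof -
      have sums: "(\<Sum>j<n. (if j = k then c k else 0) * a j) = c k * a k"
        "(\<Sum>j<n. (if j = k then c k else 0)\<^sup>2 * a j) = (c k)\<^sup>2 * a k" for a :: "nat \<Rightarrow> real"
        using that by (simp_all add: if_distrib[of "\<lambda>x. x * _"] if_distrib[of "\<lambda>x. x\<^sup>2"] cong: if_cong)
      show ?thesis
        using char[OF \<tau>, of "\<lambda>j. if j = k then c k else 0"] unfolding sums .
    qed
    have "(\<integral>x. iexp (\<Sum>k<n. c k * (W (\<tau> (Suc k)) x - W (\<tau> k) x)) \<partial>P) =
        complex_of_real (exp (\<Sum>k<n. - ((c k)\<^sup>2 * (\<tau> (Suc k) - \<tau> k)) / 2))"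
      unfolding char[OF \<tau>] by (simp only: sum_divide_distrib[symmetric] sum_negf)
    also have "\<dots> = (\<Prod>k<n. (\<integral>x. iexp (c k * (W (\<tau> (Suc k)) x - W (\<tau> k) x)) \<partial>P))"
      by (simp only: exp_sum finite_lessThan of_real_prod) (intro prod.cong refl single[symmetric], simp)
    finally show "(\<integral>x. iexp (\<Sum>k<n. c k * (W (\<tau> (Suc k)) x - W (\<tau> k) x)) \<partial>P) =
        (\<Prod>k<n. (\<integral>x. iexp (c k * (W (\<tau> (Suc k)) x - W (\<tau> k) x)) \<partial>P))" .
  qed simp
  ultimately show ?thesis
    unfolding standard_brownian_motion_def using P meas zero cont by blast
qed

text \<open>\<open>J\<close> is a chosen version of the stochastic integral for each index, as the
  integral is determined only up to indistinguishability. Measurability of \<open>B\<close> at fixed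
  times does not address the event of continuous paths, an uncountable condition, so
  \<open>B_paths\<close> places it in the completion of \<open>V\<close>.\<close>

theorem theorem3:
  fixes \<Lambda> :: "real measure"
    and M :: "'w measure"
    and V P :: "(real \<times> 'w) measure"
    and T :: real
    and B \<Theta> J \<E> W :: "real \<Rightarrow> real \<times> 'w \<Rightarrow> real"
  assumes lebesgue: "measure_extension (lebesgue_on {0..1}) \<Lambda>"
    and fubini: "rich_fubini_extension TYPE('e::polish_space) \<Lambda> M V"
    and T: "T > 0"
    and B: "epi_brownian_motions \<Lambda> M V B"
    and B_paths: "{x\<in>space V. continuous_on {0..T} (\<lambda>t. B t x)} \<in> sets (completion V)"
    and \<Theta>_measurable: "\<forall>t\<in>{0..T}. \<Theta> t \<in> borel_measurable V"
    and \<Theta>_adapted: "\<forall>t\<in>{0..T}. \<forall>u\<in>{0..1}.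
      (\<lambda>\<omega>. \<Theta> t (u, \<omega>)) \<in> borel_measurable (natural_filtration M (\<lambda>s \<omega>. B s (u, \<omega>)) t)"
    and J: "\<forall>u\<in>{0..1}.
      is_ito_integral M T (\<lambda>s \<omega>. B s (u, \<omega>)) (\<lambda>s \<omega>. \<Theta> s (u, \<omega>)) (\<lambda>t \<omega>. J t (u, \<omega>))"
    and \<E>: "\<forall>t\<in>{0..T}. \<forall>x\<in>space V. \<E> t x = exp (J t x - 1 / 2 * (LBINT s:{0..t}. (\<Theta> s x)\<^sup>2))"
    and \<E>_measurable: "\<forall>t\<in>{0..T}. \<E> t \<in> borel_measurable V"
    and \<E>_martingale: "\<forall>u\<in>{0..1}.
      martingale_on M T (augmented_filtration M (\<lambda>s \<omega>. B s (u, \<omega>))) (\<lambda>t \<omega>. \<E> t (u, \<omega>))"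
    and P: "P = density V (\<lambda>x. ennreal (\<E> T x))"
    and W: "\<forall>t\<in>{0..T}. \<forall>x\<in>space V. W t x = B t x - (LBINT s:{0..t}. \<Theta> s x)"
    and W_measurable: "\<forall>t\<in>{0..T}. W t \<in> borel_measurable V"
  shows "standard_brownian_motion P {0..T} W"
proof -
  have F: "fubini_extension \<Lambda> M V"
    using fubini by (simp add: rich_fubini_extension_def)
  interpret M: prob_space M using F by (simp add: fubini_extension_def)
  interpret V: prob_space V using F by (simp add: fubini_extension_def)
  have space_\<Lambda>: "space \<Lambda> = {0..1}"
    using lebesgue by (simp add: measure_extension_def space_restrict_space)
  have space_V: "space V = {0..1} \<times> space M"
    using space_fubini_extension[OF F] space_\<Lambda> by simp
  have B_u: "standard_brownian_motion M {0..} (\<lambda>t \<omega>. B t (u, \<omega>))" if "u \<in> {0..1}" for u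
    using B that by (simp add: epi_brownian_motions_def space_\<Lambda>)
  have B_meas: "B t \<in> borel_measurable V" if "0 \<le> t" for t
    using B that by (simp add: epi_brownian_motions_def)
  have [measurable]: "\<E> T \<in> borel_measurable V"
    using \<E>_measurable T by simp
  have W_meas: "W t \<in> borel_measurable V" if "0 \<le> t" "t \<le> T" for t
    using W_measurable that by simp
  have \<E>_pos: "0 \<le> \<E> T x" if "x \<in> space V" for x
    using \<E> T that by simp
  have L0: "(LBINT s:{0}. g s) = 0" for g :: "real \<Rightarrow> real"
  proof -
    have "AE s in lborel. indicat_real {0} s *\<^sub>R g s = 0"
      using AE_lborel_singleton[of "0 :: real"] by eventually_elim simp
    then show ?thesis
      unfolding set_lebesgue_integral_def by (rule integral_eq_zero_AE)
  qed
  \<comment> \<open>The martingale property moves the expectation from \<open>T\<close> to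
    \<open>0\<close>, where the stochastic integral vanishes almost surely and the time integral is
    over a point.\<close>
  have \<E>_u: "integrable M (\<lambda>\<omega>. \<E> T (u, \<omega>))" "(\<integral>\<omega>. \<E> T (u, \<omega>) \<partial>M) = 1" if u: "u \<in> {0..1}" for u
  proof -
    have mart: "martingale_on M T (augmented_filtration M (\<lambda>s \<omega>. B s (u, \<omega>))) (\<lambda>t \<omega>. \<E> t (u, \<omega>))"
      using \<E>_martingale u by blast
    then show "integrable M (\<lambda>\<omega>. \<E> T (u, \<omega>))"
      using T by (simp add: martingale_on_def)
    have "subalgebra M (augmented_filtration M (\<lambda>s \<omega>. B s (u, \<omega>)) 0)"
      using B_u[OF u] by (intro subalgebra_augmented_filtration) (auto simp: standard_brownian_motion_def)
    from expectation_martingale_on[OF M.prob_space_axioms mart _ this]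
    have "(\<integral>\<omega>. \<E> T (u, \<omega>) \<partial>M) = (\<integral>\<omega>. \<E> 0 (u, \<omega>) \<partial>M)"
      using T by simp
    also have "\<dots> = (\<integral>\<omega>. 1 \<partial>M)"
    proof (rule integral_cong_AE)
      show "(\<lambda>\<omega>. \<E> 0 (u, \<omega>)) \<in> borel_measurable M"
        using mart T by (auto simp: martingale_on_def)
      have "AE \<omega> in M. J 0 (u, \<omega>) = 0"
        using ito_integral_0[OF M.prob_space_axioms] J u T by fastforce
      with AE_space show "AE \<omega> in M. \<E> 0 (u, \<omega>) = 1"
      proof eventually_elim
        case (elim \<omega>)
        then show ?case using \<E> u T by (simp add: space_V L0)
      qed
    qed simp
    finally show "(\<integral>\<omega>. \<E> T (u, \<omega>) \<partial>M) = 1"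
      by (simp add: M.prob_space)
  qed
  have \<E>_int: "integrable V (\<E> T)"
    by (rule fubini_extension_integrable_nonneg[OF F, where c = 1]) (use \<E>_pos \<E>_u in \<open>auto simp: space_\<Lambda>\<close>)
  have P_integral: "(\<integral>x. g x \<partial>P) = (\<integral>x. \<E> T x * g x \<partial>V)" if "g \<in> borel_measurable V" for g :: "real \<times> 'w \<Rightarrow> complex"
    unfolding P using that \<E>_pos by (subst integral_density) (auto simp: scaleR_conv_of_real)
  have char: "(\<integral>x. iexp (\<Sum>k<n. c k * (W (\<tau> (Suc k)) x - W (\<tau> k) x)) \<partial>P) =
      complex_of_real (exp (- (\<Sum>k<n. (c k)\<^sup>2 * (\<tau> (Suc k) - \<tau> k)) / 2))"
    if \<tau>: "\<tau> ` {..n} \<subseteq> {0..T}" "strict_mono_on {..n} \<tau>" for n \<tau> c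
  proof -
    have \<tau>_in: "0 \<le> \<tau> k" "\<tau> k \<le> T" if "k \<le> n" for k
      using \<tau>(1) that by (auto simp: image_subset_iff)
    define S where "S x = (\<Sum>k<n. c k * (W (\<tau> (Suc k)) x - W (\<tau> k) x))" for x
    have [measurable]: "S \<in> borel_measurable V"
      unfolding S_def
      by (intro borel_measurable_sum borel_measurable_times borel_measurable_diff borel_measurable_const W_meas \<tau>_in) auto
    have "(\<integral>x. iexp (S x) \<partial>P) = (\<integral>x. \<E> T x * iexp (S x) \<partial>V)"
      by (rule P_integral) measurable
    also have "\<dots> = complex_of_real (exp (- (\<Sum>k<n. (c k)\<^sup>2 * (\<tau> (Suc k) - \<tau> k)) / 2))"
    proof (rule fubini_extension_integral_const[OF F])
      show "integrable V (\<lambda>x. \<E> T x * iexp (S x))"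
        by (rule Bochner_Integration.integrable_bound[OF \<E>_int]) (auto simp: norm_mult)
    next
      fix u assume "u \<in> space \<Lambda>"
      then have u: "u \<in> {0..1}" by (simp add: space_\<Lambda>)
      have ito: "is_ito_integral M T (\<lambda>s \<omega>. B s (u, \<omega>)) (\<lambda>s \<omega>. \<Theta> s (u, \<omega>)) (\<lambda>t \<omega>. J t (u, \<omega>))"
        using J u by blast
      define E where "E \<omega> = exp (J T (u, \<omega>) - 1 / 2 * (LBINT s:{0..T}. (\<Theta> s (u, \<omega>))\<^sup>2))" for \<omega>
      define Y where "Y t \<omega> = B t (u, \<omega>) - (LBINT s:{0..t}. \<Theta> s (u, \<omega>))" for t \<omega>
      have E_eq: "\<E> T (u, \<omega>) = E \<omega>" if "\<omega> \<in> space M" for \<omega>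
        using \<E> T u that by (simp add: space_V E_def)
      have Y_eq: "W t (u, \<omega>) = Y t \<omega>" if "0 \<le> t" "t \<le> T" "\<omega> \<in> space M" for t \<omega>
        using W u that by (simp add: space_V Y_def)
      have S_eq: "S (u, \<omega>) = (\<Sum>k<n. c k * (Y (\<tau> (Suc k)) \<omega> - Y (\<tau> k) \<omega>))" if "\<omega> \<in> space M" for \<omega>
        unfolding S_def using that by (intro sum.cong refl) (simp add: Y_eq \<tau>_in)
      have E_int: "integrable M E" "(\<integral>\<omega>. E \<omega> \<partial>M) = 1"
        using \<E>_u[OF u] by (simp_all add: E_eq cong: Bochner_Integration.integrable_cong Bochner_Integration.integral_cong)
      have "(\<integral>\<omega>. E \<omega> * iexp (\<Sum>k<n. c k * (Y (\<tau> (Suc k)) \<omega> - Y (\<tau> k) \<omega>)) \<partial>M) =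
          complex_of_real (exp (- (\<Sum>k<n. (c k)\<^sup>2 * (\<tau> (Suc k) - \<tau> k)) / 2))"
        unfolding E_def Y_def
        by (rule M.girsanov_characteristic_function[OF B_u[OF u] _ ito E_int[unfolded E_def] \<tau>]) (use T in simp)
      also have "(\<integral>\<omega>. E \<omega> * iexp (\<Sum>k<n. c k * (Y (\<tau> (Suc k)) \<omega> - Y (\<tau> k) \<omega>)) \<partial>M) =
          (\<integral>\<omega>. \<E> T (u, \<omega>) * iexp (S (u, \<omega>)) \<partial>M)"
        by (intro Bochner_Integration.integral_cong refl) (simp only: E_eq S_eq)
      finally show "(\<integral>\<omega>. \<E> T (u, \<omega>) * iexp (S (u, \<omega>)) \<partial>M) =
          complex_of_real (exp (- (\<Sum>k<n. (c k)\<^sup>2 * (\<tau> (Suc k) - \<tau> k)) / 2))" .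
      \<comment> \<open>The Bochner integral of a nonintegrable function is \<open>0\<close>, so the
        nonzero value already proves integrability of the section.\<close>
      then have "(\<integral>\<omega>. \<E> T (u, \<omega>) * iexp (S (u, \<omega>)) \<partial>M) \<noteq> 0"
        by simp
      then show "integrable M (\<lambda>\<omega>. \<E> T (u, \<omega>) * iexp (S (u, \<omega>)))"
        using not_integrable_integral_eq by blast
    qed
    finally show ?thesis by (simp only: S_def)
  qed
  \<comment> \<open>With \<open>n = 0\<close> the sum in \<open>char\<close> is empty and the
    formula gives the total mass of \<open>P\<close>.\<close>
  have "(\<integral>x. iexp (\<Sum>k<0. 0 * (W ((\<lambda>_. 0) (Suc k)) x - W ((\<lambda>_. 0) k) x)) \<partial>P) =
      complex_of_real (exp (- (\<Sum>k<0. 0\<^sup>2 * ((\<lambda>_. 0) (Suc k) - (\<lambda>_. 0) k)) / 2))"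
    by (rule char) (use T in \<open>auto simp: strict_mono_on_def\<close>)
  then have "(\<integral>x. 1 \<partial>P) = (1 :: complex)"
    by simp
  then have "measure P (space P) = 1"
    by (simp add: scaleR_conv_of_real)
  \<comment> \<open>\<open>measure\<close> returns \<open>0\<close> for infinite mass, so the value
    \<open>1\<close> determines \<open>emeasure\<close>.\<close>
  then have "emeasure P (space P) = 1"
    by (metis Sigma_Algebra.measure_def emeasure_eq_ennreal_measure enn2real_top ennreal_1 zero_neq_one)
  then have prob_P: "prob_space P"
    by (rule prob_spaceI)
  have AE_P: "AE x in P. Q x" if "AE x in V. Q x" for Q
    unfolding P using that by (subst AE_density) (auto elim: eventually_mono)
  have B_cont: "AE x in V. x \<in> {x\<in>space V. continuous_on {0..T} (\<lambda>t. B t x)}"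
  proof (rule fubini_extension_AE_completion[OF F B_paths])
    fix u assume "u \<in> space \<Lambda>"
    then have u: "u \<in> {0..1}" by (simp add: space_\<Lambda>)
    have "AE \<omega> in M. continuous_on {0..} (\<lambda>t. B t (u, \<omega>))"
      using B_u[OF u] by (simp add: standard_brownian_motion_def)
    with AE_space show "AE \<omega> in M. (u, \<omega>) \<in> {x\<in>space V. continuous_on {0..T} (\<lambda>t. B t x)}"
      by eventually_elim (use u in \<open>auto simp: space_V intro: continuous_on_subset\<close>)
  qed
  \<comment> \<open>Countable, so that quantifying over times keeps events measurable, and dense in
    \<open>{0..T}\<close> with both endpoints included.\<close>
  define D where "D = ({0<..<T} \<inter> \<rat>) \<union> {0, T}"
  have D: "countable D" "D \<subseteq> {0..T}"
    using T countable_rat by (auto simp: D_def)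
  \<comment> \<open>Uniform continuity of the path of \<open>W\<close> on \<open>D\<close>, with
    tolerances restricted to reciprocals so that only countable operations occur.\<close>
  define U where "U = {x\<in>space V. \<forall>n. \<exists>m. \<forall>p\<in>D. \<forall>q\<in>D. \<bar>q - p\<bar> < 1 / Suc m \<longrightarrow> \<bar>W q x - W p x\<bar> < 1 / Suc n}"
  have U: "x \<in> U \<longleftrightarrow> uniformly_continuous_on D (\<lambda>t. W t x)" if "x \<in> space V" for x
  proof
    assume x: "x \<in> U"
    show "uniformly_continuous_on D (\<lambda>t. W t x)"
      unfolding uniformly_continuous_on_def dist_real_def
    proof (intro allI impI)
      fix e :: real assume "e > 0"
      then obtain n where n: "1 / Suc n < e"
        using nat_approx_posE by blast
      obtain m where m: "\<And>p q. p \<in> D \<Longrightarrow> q \<in> D \<Longrightarrow> \<bar>q - p\<bar> < 1 / Suc m \<Longrightarrow> \<bar>W q x - W p x\<bar> < 1 / Suc n"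
        using x unfolding U_def by blast
      show "\<exists>d>0. \<forall>p\<in>D. \<forall>q\<in>D. \<bar>q - p\<bar> < d \<longrightarrow> \<bar>W q x - W p x\<bar> < e"
        by (intro exI[of _ "1 / Suc m"]) (use m n in \<open>auto intro: less_trans\<close>)
    qed
  next
    assume unif: "uniformly_continuous_on D (\<lambda>t. W t x)"
    have "\<exists>m. \<forall>p\<in>D. \<forall>q\<in>D. \<bar>q - p\<bar> < 1 / Suc m \<longrightarrow> \<bar>W q x - W p x\<bar> < 1 / Suc n" for n
    proof -
      obtain d where d: "d > 0" "\<And>p q. p \<in> D \<Longrightarrow> q \<in> D \<Longrightarrow> \<bar>q - p\<bar> < d \<Longrightarrow> \<bar>W q x - W p x\<bar> < 1 / Suc n"
        using unif[unfolded uniformly_continuous_on_def dist_real_def, rule_format, of "1 / Suc n"] by auto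
      obtain m where "1 / Suc m < d"
        using d(1) nat_approx_posE by blast
      with d(2) show ?thesis by (meson less_trans)
    qed
    with that show "x \<in> U" by (simp add: U_def)
  qed
  have "U \<in> sets V"
  proof -
    have W_D: "W t \<in> borel_measurable V" if "t \<in> D" for t
      using that D(2) by (intro W_meas) auto
    have "{x\<in>space V. \<bar>q - p\<bar> < 1 / Suc m \<longrightarrow> \<bar>W q x - W p x\<bar> < 1 / Suc n} \<in> sets V"
      if "p \<in> D" "q \<in> D" for p q m n
      using W_D[OF that(1)] W_D[OF that(2)] by measurable
    then show ?thesis
      unfolding U_def using D(1)
      by (intro sets.sets_Collect_countable_All sets.sets_Collect_countable_Ex sets.sets_Collect_countable_All') blast
  qed
  have W_unif: "AE x in V. x \<in> U"
  proof (rule fubini_extension_AE[OF F \<open>U \<in> sets V\<close>])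
    fix u assume "u \<in> space \<Lambda>"
    then have u: "u \<in> {0..1}" by (simp add: space_\<Lambda>)
    have cont: "AE \<omega> in M. continuous_on {0..} (\<lambda>t. B t (u, \<omega>))"
      using B_u[OF u] by (simp add: standard_brownian_motion_def)
    have "ito_integrand M T (augmented_filtration M (\<lambda>s \<omega>. B s (u, \<omega>))) (\<lambda>s \<omega>. \<Theta> s (u, \<omega>))"
      using J u by (simp add: is_ito_integral_def)
    from AE_space cont ito_integrand_AE[OF this]
    show "AE \<omega> in M. (u, \<omega>) \<in> U"
    proof eventually_elim
      case (elim \<omega>)
      have x: "(u, \<omega>) \<in> space V" using elim(1) u by (simp add: space_V)
      have "set_integrable lborel {0..T} (\<lambda>s. \<Theta> s (u, \<omega>))"
        using elim(3) by (simp add: set_integrable_def integrable_restrict_space)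
      then have "continuous_on {0..T} (\<lambda>t. B t (u, \<omega>) - (LBINT s:{0..t}. \<Theta> s (u, \<omega>)))"
        using elim(2) by (intro continuous_on_diff continuous_on_set_integral_initial) (auto elim: continuous_on_subset)
      then have "continuous_on {0..T} (\<lambda>t. W t (u, \<omega>))"
        using W x continuous_on_cong[of "{0..T}" "{0..T}" "\<lambda>t. W t (u, \<omega>)"] by auto
      then have "uniformly_continuous_on {0..T} (\<lambda>t. W t (u, \<omega>))"
        by (intro compact_uniformly_continuous) auto
      then show ?case
        unfolding U[OF x] using D(2) by (rule uniformly_continuous_on_subset)
    qed
  qed
  \<comment> \<open>Uniform continuity on \<open>D\<close> alone says nothing about \<open>W\<close>
    at the remaining times. Subtracting \<open>W\<close> from the continuous path of
    \<open>B\<close> leaves the indefinite integral of \<open>\<Theta>\<close>, for which regularity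
    on \<open>D\<close> does suffice, and \<open>W\<close> is recovered as a difference of
    continuous paths.\<close>
  have W_cont: "AE x in V. continuous_on {0..T} (\<lambda>t. W t x)"
    using AE_space B_cont W_unif
  proof eventually_elim
    case (elim x)
    have B_x: "continuous_on {0..T} (\<lambda>t. B t x)" using elim(2) by simp
    have eq: "W t x = B t x - (LBINT s:{0..t}. \<Theta> s x)" if "t \<in> {0..T}" for t
      using W elim(1) that by blast
    have "uniformly_continuous_on D (\<lambda>t. B t x)"
      using compact_uniformly_continuous[OF B_x compact_Icc] D(2) by (rule uniformly_continuous_on_subset)
    then have "uniformly_continuous_on D (\<lambda>t. B t x - W t x)"
      using elim(3) U[OF elim(1)] by (intro uniformly_continuous_on_diff) auto
    moreover have "B t x - W t x = (LBINT s:{0..t}. \<Theta> s x)" if "t \<in> D" for t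
      using eq[of t] that D(2) by auto
    ultimately have "uniformly_continuous_on D (\<lambda>t. LBINT s:{0..t}. \<Theta> s x)"
      by (simp add: uniformly_continuous_on_def)
    then have "continuous_on {0..T} (\<lambda>t. LBINT s:{0..t}. \<Theta> s x)"
      unfolding D_def by (rule continuous_on_set_integral_initial_if_uniformly_continuous_on_rationals[OF T])
    then have "continuous_on {0..T} (\<lambda>t. B t x - (LBINT s:{0..t}. \<Theta> s x))"
      by (intro continuous_on_diff B_x)
    then show ?case
      using eq continuous_on_cong[of "{0..T}" "{0..T}" "\<lambda>t. W t x"] by auto
  qed
  have W_0: "AE x in V. W 0 x = 0"
  proof -
    have "AE x in V. x \<in> {x\<in>space V. B 0 x = 0}"
    proof (rule fubini_extension_AE[OF F])
      show "{x\<in>space V. B 0 x = 0} \<in> sets V"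
        using B_meas[of 0] by measurable
      fix u assume "u \<in> space \<Lambda>"
      then have u: "u \<in> {0..1}" by (simp add: space_\<Lambda>)
      have "AE \<omega> in M. B 0 (u, \<omega>) = 0"
        using B_u[OF u] by (simp add: standard_brownian_motion_def)
      with AE_space show "AE \<omega> in M. (u, \<omega>) \<in> {x\<in>space V. B 0 x = 0}"
        by eventually_elim (use u in \<open>simp add: space_V\<close>)
    qed
    then show ?thesis
      by eventually_elim (use W T in \<open>simp add: L0\<close>)
  qed
  show ?thesis
  proof (rule standard_brownian_motion_if_char[OF prob_P _ AE_P[OF W_0] AE_P[OF W_cont] char])
    show "W t \<in> borel_measurable P" if "t \<in> {0..T}" for t
      using W_measurable that by (simp add: P)
  qed
qed

end
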